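(* Let $\Omega=\mathbb{D}(\mathbb{R}_+)$ be the space of càdlàg functions $\mathbb{R}_+\to\mathbb{R}$, let $X$ be the canonical process $X_t(\omega)=\omega(t)$, and let $\mathcal{F}_t=\sigma(X_s:s\in[0,t])$ and $\mathcal{F}=\sigma(X_t:t\ge0)$. For $i=1,2$ let $\alpha_i^+,\lambda_i^+,\alpha_i^-,\lambda_i^-\in(0,\infty)$ and $\beta_i^+,\beta_i^-\in[0,1)$. Let $\mathbb{P}$ be a probability measure on $(\Omega,\mathcal{F})$ under which $X\sim\mathrm{TS}(\alpha_1^+,\beta_1^+,\lambda_1^+;\alpha_1^-,\beta_1^-,\lambda_1^-)$ is a tempered stable process, and let $\mathbb{Q}$ be a probability measure on $(\Omega,\mathcal{F})$ under which $X\sim\mathrm{TS}(\alpha_2^+,\beta_2^+,\lambda_2^+;\alpha_2^-,\beta_2^-,\lambda_2^-)$ is a tempered stable process. The following statements are equivalent: (1) The measures $\mathbb{P}$ and $\mathbb{Q}$ are locally equivalent. (2) $\alpha_1^+=\alpha_2^+$, $\alpha_1^-=\alpha_2^-$, $\beta_1^+=\beta_2^+$ and $\beta_1^-=\beta_2^-$.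
   Context: For $\alpha^+,\lambda^+,\alpha^-,\lambda^-\in(0,\infty)$ and $\beta^+,\beta^-\in[0,1)$, the tempered stable distribution $\mathrm{TS}(\alpha^+,\beta^+,\lambda^+;\alpha^-,\beta^-,\lambda^-)$ is the infinitely divisible distribution on $\mathbb{R}$ with characteristic function $\varphi(z)=\exp\big(\int_{\mathbb{R}}(e^{izx}-1)F(dx)\big)$, $z\in\mathbb{R}$, where $$F(dx)=\Big(\frac{\alpha^+}{x^{1+\beta^+}}e^{-\lambda^+x}\mathbf{1}_{(0,\infty)}(x)+\frac{\alpha^-}{|x|^{1+\beta^-}}e^{-\lambda^-|x|}\mathbf{1}_{(-\infty,0)}(x)\Big)dx.$$ A tempered stable process $X\sim\mathrm{TS}(\alpha^+,\beta^+,\lambda^+;\alpha^-,\beta^-,\lambda^-)$ is a Lévy process such that $X_1$ has this distribution. $\mathbb{P}$ and $\mathbb{Q}$ are locally equivalent if the restrictions $\mathbb{P}|_{\mathcal{F}_t}$ and $\mathbb{Q}|_{\mathcal{F}_t}$ are equivalent (mutually absolutely continuous) for every $t\ge0$. *)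

theory Defs
  imports "HOL-Probability.Probability"
begin

definition cadlag :: "(real \<Rightarrow> real) \<Rightarrow> bool" where
  "cadlag \<omega> \<longleftrightarrow>
     (\<forall>t\<ge>0. continuous (at_right t) \<omega>) \<and> (\<forall>t>0. \<exists>l. (\<omega> \<longlongrightarrow> l) (at_left t))"

(* The Skorokhod space of paths on [0,\<infinity>): a path is represented by a total function that is
   undefined on the negative half-line, so that distinct elements are distinct paths. *)
definition cadlag_paths :: "(real \<Rightarrow> real) set" where
  "cadlag_paths = {\<omega> \<in> extensional {0..}. cadlag \<omega>}"

abbreviation canonical_process :: "real \<Rightarrow> (real \<Rightarrow> real) \<Rightarrow> real" where
  "canonical_process t \<omega> \<equiv> \<omega> t"

(* The sigma-algebra on the path space generated by the coordinates X_s with s in T.  As usual, it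
   is represented by a measure, of which only the underlying measurable space is used. *)
definition coord_algebra :: "real set \<Rightarrow> (real \<Rightarrow> real) measure" where
  "coord_algebra T =
     sigma cadlag_paths {canonical_process s -` B \<inter> cadlag_paths | s B. s \<in> T \<and> B \<in> sets borel}"

definition path_filtration :: "real \<Rightarrow> (real \<Rightarrow> real) measure" where
  "path_filtration t = coord_algebra {0..t}"

definition path_algebra :: "(real \<Rightarrow> real) measure" where
  "path_algebra = coord_algebra {0..}"

locale levy_process = prob_space M for M :: "'a measure" +
  fixes X :: "real \<Rightarrow> 'a \<Rightarrow> real"
  assumes random_variable: "\<And>t. t \<ge> 0 \<Longrightarrow> random_variable borel (X t)"
    and start_zero: "AE \<omega> in M. X 0 \<omega> = 0"
    and independent_increments:
      "\<And>(t :: nat \<Rightarrow> real) n. 0 \<le> t 0 \<Longrightarrow> mono_on {..n} t \<Longrightarrow>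
         indep_vars (\<lambda>_. borel) (\<lambda>i \<omega>. X (t (Suc i)) \<omega> - X (t i) \<omega>) {..<n}"
    and stationary_increments:
      "\<And>s t. 0 \<le> s \<Longrightarrow> s \<le> t \<Longrightarrow>
         distr M borel (\<lambda>\<omega>. X t \<omega> - X s \<omega>) = distr M borel (X (t - s))"
    and cadlag_sample_paths: "AE \<omega> in M. cadlag (\<lambda>t. X t \<omega>)"

definition ts_levy_measure ::
  "real \<Rightarrow> real \<Rightarrow> real \<Rightarrow> real \<Rightarrow> real \<Rightarrow> real \<Rightarrow> real measure" where
  "ts_levy_measure \<alpha>_p \<beta>_p lam_p \<alpha>_m \<beta>_m lam_m =
     density lborel (\<lambda>x. ennreal
       (\<alpha>_p / x powr (1 + \<beta>_p) * exp (- lam_p * x) * indicator {0<..} x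
        + \<alpha>_m / \<bar>x\<bar> powr (1 + \<beta>_m) * exp (- lam_m * \<bar>x\<bar>) * indicator {..<0} x))"

(* The law is determined by its characteristic function.  Its infinite divisibility is not listed
   separately, because the form of the characteristic function implies it. *)
definition tempered_stable_distribution ::
  "real measure \<Rightarrow> real \<Rightarrow> real \<Rightarrow> real \<Rightarrow> real \<Rightarrow> real \<Rightarrow> real \<Rightarrow> bool" where
  "tempered_stable_distribution \<mu> \<alpha>_p \<beta>_p lam_p \<alpha>_m \<beta>_m lam_m \<longleftrightarrow>
     real_distribution \<mu> \<and>
     (\<forall>z. char \<mu> z = exp (CLINT x | ts_levy_measure \<alpha>_p \<beta>_p lam_p \<alpha>_m \<beta>_m lam_m. iexp (z * x) - 1))"

definition tempered_stable_process ::
  "'a measure \<Rightarrow> (real \<Rightarrow> 'a \<Rightarrow> real) \<Rightarrow>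
     real \<Rightarrow> real \<Rightarrow> real \<Rightarrow> real \<Rightarrow> real \<Rightarrow> real \<Rightarrow> bool" where
  "tempered_stable_process M X \<alpha>_p \<beta>_p lam_p \<alpha>_m \<beta>_m lam_m \<longleftrightarrow>
     levy_process M X \<and>
     tempered_stable_distribution (distr M borel (X 1)) \<alpha>_p \<beta>_p lam_p \<alpha>_m \<beta>_m lam_m"

definition equivalent_measures :: "'a measure \<Rightarrow> 'a measure \<Rightarrow> bool" where
  "equivalent_measures M N \<longleftrightarrow> absolutely_continuous M N \<and> absolutely_continuous N M"

definition locally_equivalent ::
  "(real \<Rightarrow> 'a measure) \<Rightarrow> 'a measure \<Rightarrow> 'a measure \<Rightarrow> bool" where
  "locally_equivalent F P Q \<longleftrightarrow>
     (\<forall>t\<ge>0. equivalent_measures (restr_to_subalg P (F t)) (restr_to_subalg Q (F t)))"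

lemma space_coord_algebra: "space (coord_algebra T) = cadlag_paths"
  unfolding coord_algebra_def by (rule space_measure_of) auto

lemma sets_coord_algebra:
  "sets (coord_algebra T) = sigma_sets cadlag_paths
     {canonical_process s -` B \<inter> cadlag_paths | s B. s \<in> T \<and> B \<in> sets borel}"
  unfolding coord_algebra_def by (rule sets_measure_of) auto

lemma subalgebra_path_filtration:
  assumes "sets P = sets path_algebra"
  shows "subalgebra P (path_filtration t)"
proof -
  have "sets (path_filtration t) \<subseteq> sets path_algebra"
    unfolding path_filtration_def path_algebra_def sets_coord_algebra
    by (rule sigma_sets_mono') auto
  moreover have "space P = space (path_filtration t)"
    using sets_eq_imp_space_eq[OF assms]
    by (simp add: path_filtration_def path_algebra_def space_coord_algebra)
  ultimately show ?thesis
    using assms by (simp add: subalgebra_def)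
qed

end

theory Submission
  imports Defs
begin

text \<open>
  The increments of a tempered stable process are differences of two independent subordinators,
  one for each sign of the jumps.

  If the \<open>\<alpha>\<close> and \<open>\<beta>\<close> parameters agree, changing \<open>\<lambda>\<close> multiplies the joint law of the increments of the two
  subordinators by an exponential in their values (an Esscher transform). On a dyadic grid over
  \<open>[0, T]\<close> the two products of densities depend only on the terminal values of the subordinators, so their
  ratio is bounded as long as these values are bounded by \<open>R\<close>, and the exceptional event has a probability
  that tends to 0 as \<open>R\<close> grows, uniformly in the grid. Hence for every \<open>\<delta>\<close> there is a \<open>K\<close> with
  \<open>Q(A) \<le> K P(A) + \<delta>\<close> for all grid events \<open>A\<close>. The grid events generate the \<open>\<sigma>\<close>-algebra, because
  paths are right-continuous, and the bound passes to the limit.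

  Conversely, let \<open>g(x) = 1 - exp(-u x)\<close> for \<open>x \<ge> 0\<close> and \<open>g(x) = 0\<close> for \<open>x < 0\<close>. The sum of \<open>g\<close> over the
  increments on a fine grid concentrates around the Laplace exponent \<open>\<Phi>(u)\<close> of the positive jumps, which
  tends to infinity with \<open>u\<close>. If the stability parameters of the positive jumps differ, the two exponents
  satisfy \<open>\<Phi>\<^sub>1 \<le> c \<Phi>\<^sub>2 + C\<close> with \<open>c < 1\<close> up to order, so these sums separate the two measures; negative jumps
  are treated by reflection. A sum over the increments is used instead of the empirical characteristic
  function because for \<open>\<beta> = 0\<close> the latter does not see the sign of the jumps.
\<close>

section \<open>Laplace transforms of laws on the half-line\<close>

text \<open>The process is prescribed only through the characteristic function of
  \<open>X 1\<close>, so neither the jumps of a path nor the two subordinators behind it are given.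
  Their laws over a single grid step are therefore constructed as weak limits on the half-line and
  identified with the increment law through characteristic functions. Laws are enough: on a finite
  grid a product measure replaces the processes.

  The pair of subordinators is not a function of \<open>X\<close>, and the law of a difference has
  no convenient density. However, both increment laws are images of tilted pair laws under one and
  the same map, and a bound of the form \<open>Q \<le> K P + \<delta>\<close> survives passing to
  images. The additive \<open>\<delta>\<close> absorbs the region where the exponential density
  ratio is not controlled.

  For the converse, a single grid only yields an event that is improbable under one measure and has
  probability at least 1/2 under the other. Borel-Cantelli turns a sequence of such events, on
  varying grids but inside one \<open>\<sigma>\<close>-algebra, into a null set of the first measure
  that the second one charges.\<close>

lemma norm_one_minus_exp_le:
  fixes w :: complex
  assumes "0 \<le> Re w"
  shows "norm (1 - exp (- w)) \<le> norm w"
proof -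
  have "norm (exp (- 0) - exp (- w)) \<le> 1 * norm (0 - w)"
  proof (rule field_differentiable_bound[where S = "{z. 0 \<le> Re z}" and f' = "\<lambda>z. - exp (- z)"])
    show "convex {z. 0 \<le> Re z}" by (rule convex_halfspace_Re_ge)
  qed (use assms in \<open>auto intro!: derivative_eq_intros\<close>)
  then show ?thesis by simp
qed

text \<open>Support in the half-line is imposed almost everywhere on a Borel law on all of the
  reals, so that convolutions, weak limits and characteristic functions apply directly.
  \<open>L\<close> is unconstrained for \<open>Re w < 0\<close>, where the integral need not
  exist.\<close>

definition has_laplace :: "real measure \<Rightarrow> (complex \<Rightarrow> complex) \<Rightarrow> bool" where
  "has_laplace \<mu> L \<longleftrightarrow> prob_space \<mu> \<and> sets \<mu> = sets borel \<and> (AE x in \<mu>. 0 \<le> x) \<and>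
     (\<forall>w. 0 \<le> Re w \<longrightarrow> (CLINT x|\<mu>. exp (- (w * of_real x))) = L w)"

lemma has_laplaceD:
  assumes "has_laplace \<mu> L"
  shows "prob_space \<mu>" "sets \<mu> = sets borel" "AE x in \<mu>. 0 \<le> x"
    "\<And>w. 0 \<le> Re w \<Longrightarrow> (CLINT x|\<mu>. exp (- (w * of_real x))) = L w"
  using assms by (auto simp: has_laplace_def)

lemma integrable_laplace:
  assumes "has_laplace \<mu> L" "0 \<le> Re w"
  shows "complex_integrable \<mu> (\<lambda>x. exp (- (w * of_real x)))"
proof -
  note L = has_laplaceD[OF assms(1)]
  interpret prob_space \<mu> by (rule L)
  note [measurable_cong] = L(2)
  show ?thesis
    by (rule integrable_const_bound[where B = 1]) (use L(3) assms(2) in auto)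
qed

lemma norm_laplace_le:
  assumes "has_laplace \<mu> L" "0 \<le> Re w"
  shows "norm (L w) \<le> 1"
proof -
  note L = has_laplaceD[OF assms(1)]
  interpret prob_space \<mu> by (rule L)
  have "norm (CLINT x|\<mu>. exp (- (w * of_real x))) \<le> (LINT x|\<mu>. norm (exp (- (w * of_real x))))"
    by (rule integral_norm_bound)
  also have "\<dots> \<le> (LINT x|\<mu>. 1)"
    by (rule integral_mono_AE)
      (use L(3) assms(2) integrable_norm[OF integrable_laplace[OF assms]] in auto)
  finally show ?thesis using L(4)[OF assms(2)] by (simp add: prob_space)
qed

lemma has_laplace_cong:
  assumes "has_laplace \<mu> L" "\<And>w. 0 \<le> Re w \<Longrightarrow> L w = L' w"
  shows "has_laplace \<mu> L'"
  using assms by (auto simp: has_laplace_def)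

lemma has_laplace_return: "has_laplace (return borel 0) (\<lambda>_. 1)"
  unfolding has_laplace_def
  by (auto simp: integral_return AE_return intro: prob_space_return)

lemma has_laplace_convolution:
  assumes "has_laplace \<mu> L" "has_laplace \<nu> L'"
  shows "has_laplace (distr (\<mu> \<Otimes>\<^sub>M \<nu>) borel (\<lambda>(x, y). x + y)) (\<lambda>w. L w * L' w)"
proof -
  note L = has_laplaceD[OF assms(1)] and L' = has_laplaceD[OF assms(2)]
  note [measurable_cong] = L(2) L'(2)
  interpret \<mu>: prob_space \<mu> by (rule L)
  interpret \<nu>: prob_space \<nu> by (rule L')
  interpret P: pair_prob_space \<mu> \<nu> ..
  have AE: "AE x in \<mu> \<Otimes>\<^sub>M \<nu>. 0 \<le> fst x \<and> 0 \<le> snd x"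
  proof (rule P.AE_pair_measure)
    show "AE x in \<mu>. AE y in \<nu>. 0 \<le> fst (x, y) \<and> 0 \<le> snd (x, y)"
      using L(3)
    proof eventually_elim
      case (elim x)
      show ?case using L'(3) by eventually_elim (use elim in simp)
    qed
  qed simp
  then have "AE x in \<mu> \<Otimes>\<^sub>M \<nu>. 0 \<le> fst x + snd x" by eventually_elim auto
  moreover have "(CLINT x|\<mu> \<Otimes>\<^sub>M \<nu>. exp (- (w * of_real (fst x + snd x)))) = L w * L' w"
    if w: "0 \<le> Re w" for w
  proof -
    have "(CLINT x|\<mu> \<Otimes>\<^sub>M \<nu>. exp (- (w * of_real (fst x + snd x))))
       = (CLINT x|\<mu> \<Otimes>\<^sub>M \<nu>. exp (- (w * of_real (fst x))) * exp (- (w * of_real (snd x))))"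
      by (simp add: algebra_simps exp_add[symmetric])
    also have "\<dots> = (CLINT x|\<mu>. CLINT y|\<nu>. exp (- (w * of_real x)) * exp (- (w * of_real y)))"
    proof (subst P.integral_fst'[symmetric])
      show "complex_integrable (\<mu> \<Otimes>\<^sub>M \<nu>)
          (\<lambda>x. exp (- (w * of_real (fst x))) * exp (- (w * of_real (snd x))))"
      proof (rule P.integrable_const_bound[where B = 1])
        show "AE x in \<mu> \<Otimes>\<^sub>M \<nu>.
            norm (exp (- (w * of_real (fst x))) * exp (- (w * of_real (snd x)))) \<le> 1"
          using AE by eventually_elim (use w in \<open>auto simp: norm_mult intro!: mult_le_one\<close>)
      qed simp
    qed simp
    also have "\<dots> = L w * L' w"
      using L(4)[OF w] L'(4)[OF w] by simp
    finally show ?thesis .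
  qed
  ultimately show ?thesis
    unfolding has_laplace_def
    by (auto intro!: P.prob_space_distr simp: AE_distr_iff integral_distr case_prod_beta)
qed

lemma has_laplace_power:
  assumes "has_laplace \<mu> L"
  shows "\<exists>\<nu>. has_laplace \<nu> (\<lambda>w. L w ^ n)"
proof (induction n)
  case 0
  then show ?case using has_laplace_return by auto
next
  case (Suc n)
  then show ?case using has_laplace_convolution[OF assms] by auto
qed

text \<open>Independent thinning: a draw from \<open>\<mu>\<close> is kept with probability
  \<open>p\<close> and replaced by 0 otherwise, which gives the transform
  \<open>(1 - p) + p * L w\<close>.\<close>

lemma has_laplace_mixture:
  fixes L :: "complex \<Rightarrow> complex" and p :: real
  assumes "has_laplace \<mu> L" and p: "p \<in> {0..1}"
  shows "\<exists>\<nu>. has_laplace \<nu> (\<lambda>w. 1 - of_real p * (1 - L w))"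
proof -
  note L = has_laplaceD[OF assms(1)]
  note [measurable_cong] = L(2)
  define B where "B = measure_pmf (bernoulli_pmf p)"
  have [measurable_cong]: "sets B = sets (count_space UNIV)" by (simp add: B_def)
  interpret \<mu>: prob_space \<mu> by (rule L)
  interpret B: prob_space B by (simp add: B_def measure_pmf.prob_space_axioms)
  interpret P: pair_prob_space B \<mu> ..
  define f where "f = (\<lambda>(b :: bool, x :: real). if b then x else 0)"
  have [measurable]: "f \<in> borel_measurable (B \<Otimes>\<^sub>M \<mu>)" by (simp add: f_def)
  have AE: "AE x in B \<Otimes>\<^sub>M \<mu>. 0 \<le> f x"
  proof (rule P.AE_pair_measure)
    show "AE b in B. AE x in \<mu>. 0 \<le> f (b, x)"
    proof (rule AE_I2)
      show "AE x in \<mu>. 0 \<le> f (b, x)" for b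
        using L(3) by eventually_elim (simp add: f_def)
    qed
  qed simp
  moreover have "(CLINT x|B \<Otimes>\<^sub>M \<mu>. exp (- (w * of_real (f x)))) = 1 - of_real p * (1 - L w)"
    if w: "0 \<le> Re w" for w
  proof -
    have "complex_integrable (B \<Otimes>\<^sub>M \<mu>) (\<lambda>x. exp (- (w * of_real (f x))))"
      by (rule P.integrable_const_bound[where B = 1]) (use AE w in auto)
    then have "(CLINT x|B \<Otimes>\<^sub>M \<mu>. exp (- (w * of_real (f x))))
       = (CLINT b|B. CLINT x|\<mu>. exp (- (w * of_real (f (b, x)))))"
      by (rule P.integral_fst'[symmetric])
    also have "\<dots> = (CLINT b|B. if b then L w else 1)"
      using L(4)[OF w] by (intro Bochner_Integration.integral_cong) (auto simp: f_def \<mu>.prob_space)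
    also have "\<dots> = 1 - of_real p * (1 - L w)"
      using p unfolding B_def 
      by (subst integral_measure_pmf[of UNIV])
        (auto simp: UNIV_bool scaleR_conv_of_real algebra_simps)
    finally show ?thesis .
  qed
  ultimately have "has_laplace (distr (B \<Otimes>\<^sub>M \<mu>) borel f) (\<lambda>w. 1 - of_real p * (1 - L w))"
    unfolding has_laplace_def
    by (auto intro!: P.prob_space_distr simp: AE_distr_iff integral_distr)
  then show ?thesis by blast
qed

text \<open>A continuity theorem for Laplace transforms. The linear bound, uniform in
  \<open>n\<close>, yields tightness; the pointwise limit then identifies the weak limit along any
  convergent subsequence, so one subsequence is enough.\<close>

lemma has_laplace_limit:
  assumes L: "\<And>n. has_laplace (\<mu> n) (L n)"
    and lim: "\<And>w. 0 \<le> Re w \<Longrightarrow> (\<lambda>n. L n w) \<longlonglongrightarrow> L' w"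
    and bound: "\<And>n u. 0 < u \<Longrightarrow> 1 - Re (L n (of_real u)) \<le> C * u"
  shows "\<exists>\<nu>. has_laplace \<nu> L'"
proof -
  note D = has_laplaceD[OF L]
  note [measurable_cong] = D(2)
  have [simp]: "space (\<mu> n) = UNIV" for n
    using sets_eq_imp_space_eq[OF D(2)] by simp
  interpret \<mu>: prob_space "\<mu> n" for n by (rule D)
  have real_distr: "real_distribution (\<mu> n)" for n
    by unfold_locales (simp_all add: D(2))
  have markov: "measure (\<mu> n) {M<..} \<le> 2 * (C / M)" if M: "0 < M" for n and M :: real
  proof -
    have int: "integrable (\<mu> n) (\<lambda>x. exp (- (x / M)))"
      by (rule \<mu>.integrable_const_bound[where B = 1]) (use D(3)[of n] M in auto)
    have "measure (\<mu> n) {M<..} = (LINT x|\<mu> n. indicator {M<..} x)" by simp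
    also have "\<dots> \<le> (LINT x|\<mu> n. 2 * (1 - exp (- (x / M))))"
    proof (rule integral_mono_AE)
      show "AE x in \<mu> n. indicator {M<..} x \<le> 2 * (1 - exp (- (x / M)))"
        using D(3)[of n]
      proof eventually_elim
        case (elim x)
        \<comment> \<open>Beyond \<open>M\<close> the function \<open>1 - exp (- (x / M))\<close> is
          at least 1/2, so its double dominates the indicator.\<close>
        have "exp (- (x / M)) \<le> 1 / 2" if "M < x"
        proof -
          have "exp (- (x / M)) \<le> exp (- 1)" using that M by simp
          also have "\<dots> \<le> 1 / 2" using exp_ge_add_one_self[of 1] by (simp add: exp_minus field_simps)
          finally show ?thesis .
        qed
        then show ?case using elim M by (auto simp: indicator_def)
      qed
    qed (use int in \<open>auto intro!: integrable_real_indicator \<mu>.emeasure_finite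
        simp: D(2) less_top[symmetric]\<close>)
    also have "\<dots> = 2 * (1 - Re (L n (of_real (1 / M))))"
    proof -
      have "(CLINT x|\<mu> n. exp (- (of_real (1 / M) * of_real x)))
          = (CLINT x|\<mu> n. of_real (exp (- (x / M))))"
        by (simp add: exp_of_real[symmetric])
      then have "L n (of_real (1 / M)) = of_real (LINT x|\<mu> n. exp (- (x / M)))"
        using D(4)[of "of_real (1 / M)" n] M by simp
      then show ?thesis using int \<mu>.prob_space[of n] by simp
    qed
    also have "\<dots> \<le> 2 * (C / M)" using bound[of "1 / M" n] M by simp
    finally show ?thesis .
  qed
  have "tight \<mu>"
    unfolding tight_def
  proof (intro conjI allI impI real_distr)
    fix \<epsilon> :: real assume "0 < \<epsilon>"
    define M where "M = (2 * \<bar>C\<bar> + 1) / \<epsilon>"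
    have "0 < M" using \<open>0 < \<epsilon>\<close> by (simp add: M_def)
    have "2 * (C / M) < \<epsilon>" 
    proof -
      have "2 * C < \<epsilon> * M" using \<open>0 < \<epsilon>\<close> by (auto simp: M_def)
      then show ?thesis using \<open>0 < M\<close> by (simp add: field_simps)
    qed
    \<comment> \<open>The interval is open on the left, so its lower end lies strictly below 0 in
      order to keep a possible atom at 0.\<close>
    have "1 - \<epsilon> < measure (\<mu> n) {-1<..M}" for n
    proof -
      have "measure (\<mu> n) {-1<..M} = measure (\<mu> n) (UNIV - {M<..})"
        by (rule \<mu>.finite_measure_eq_AE) (use D(3)[of n] in auto)
      also have "\<dots> = 1 - measure (\<mu> n) {M<..}" using \<mu>.prob_compl[of "{M<..}" n] by simp
      finally show ?thesis using markov[OF \<open>0 < M\<close>, of n] \<open>2 * (C / M) < \<epsilon>\<close> by simp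
    qed
    then show "\<exists>a b. a < b \<and> (\<forall>n. 1 - \<epsilon> < measure (\<mu> n) {a<..b})"
      using \<open>0 < M\<close> by (intro exI[of _ "-1"] exI[of _ M]) auto
  qed
  from tight_imp_convergent_subsubsequence[OF this strict_mono_id]
  obtain r M where r: "strict_mono (r :: nat \<Rightarrow> nat)" and M: "real_distribution M"
    and conv: "weak_conv_m (\<mu> \<circ> r) M"
    by auto
  interpret M: real_distribution M by fact
  \<comment> \<open>The exponential may be unbounded on the negative half-line. Composing with
    \<open>max 0\<close> yields a bounded continuous integrand, leaves the integrals under
    \<open>\<mu> n\<close> unchanged, and places the limit law on the half-line.\<close>
  define \<nu> where "\<nu> = distr M borel (max 0)"
  have "(CLINT x|\<nu>. exp (- (w * of_real x))) = L' w" if w: "0 \<le> Re w" for w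
  proof -
    let ?f = "\<lambda>x. exp (- (w * of_real (max 0 x)))"
    have "(\<lambda>n. CLINT x|(\<mu> \<circ> r) n. ?f x) \<longlonglongrightarrow> (CLINT x|M. ?f x)"
    proof (rule weak_conv_imp_integral_bdd_continuous_conv[OF _ M conv, where B = 1])
      show "real_distribution ((\<mu> \<circ> r) n)" for n using real_distr by simp
      have "continuous_on UNIV ?f" by (intro continuous_intros)
      then show "isCont ?f x" for x by (simp add: continuous_on_eq_continuous_at)
      show "norm (?f x) \<le> 1" for x using w by simp
    qed
    moreover have "(CLINT x|(\<mu> \<circ> r) n. ?f x) = L (r n) w" for n
    proof -
      have "(CLINT x|\<mu> (r n). ?f x) = (CLINT x|\<mu> (r n). exp (- (w * of_real x)))"
        by (rule integral_cong_AE) (use D(3)[of "r n"] in \<open>auto simp: max_def\<close>)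
      then show ?thesis using D(4)[OF w] by simp
    qed
    moreover have "(\<lambda>n. L (r n) w) \<longlonglongrightarrow> L' w"
      using LIMSEQ_subseq_LIMSEQ[OF lim[OF w] r] by (simp add: comp_def)
    ultimately have "(CLINT x|M. ?f x) = L' w" by (simp add: LIMSEQ_unique)
    then show ?thesis by (simp add: \<nu>_def integral_distr)
  qed
  moreover have "AE x in \<nu>. 0 \<le> x"
    unfolding \<nu>_def by (subst AE_distr_iff) auto
  ultimately have "has_laplace \<nu> L'"
    unfolding has_laplace_def
    by (simp add: \<nu>_def M.prob_space_distr)
  then show ?thesis by blast
qed

section \<open>Laws of subordinators\<close>

text \<open>The derivative of \<open>z + exp (- z)\<close> is \<open>1 - exp (- z)\<close>, of norm
  at most that of \<open>z\<close>. On the half-disc of radius \<open>norm a\<close> this supplies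
  one factor \<open>norm a\<close>, and the mean value inequality supplies the other.\<close>

lemma norm_exp_minus_linear_le:
  fixes a :: complex
  assumes "0 \<le> Re a"
  shows "norm (1 - a - exp (- a)) \<le> norm a ^ 2"
proof -
  let ?S = "{z. 0 \<le> Re z} \<inter> cball 0 (norm a)"
  have "norm ((0 + exp (- 0)) - (a + exp (- a))) \<le> norm a * norm (0 - a)"
  proof (rule field_differentiable_bound[where S = ?S and f' = "\<lambda>z. 1 - exp (- z)"])
    show "convex ?S" by (intro convex_Int convex_halfspace_Re_ge convex_cball)
    show "norm (1 - exp (- z)) \<le> norm a" if "z \<in> ?S" for z
      using norm_one_minus_exp_le[of z] that by auto
  qed (use assms in \<open>auto intro!: derivative_eq_intros\<close>)
  then show ?thesis by (simp add: power2_eq_square algebra_simps)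
qed

text \<open>\<open>laplace_exponent\<close> lives on the closed right half-plane, so that it covers characteristic functions
  and exponential tilting at once; \<open>bernstein\<close> is its restriction to the half-line.\<close>

definition laplace_exponent :: "real measure \<Rightarrow> complex \<Rightarrow> complex" where
  "laplace_exponent F w = (CLINT x|F. 1 - exp (- (w * of_real x)))"

definition bernstein :: "real measure \<Rightarrow> real \<Rightarrow> real" where
  "bernstein F u = (LINT x|F. 1 - exp (- (u * x)))"

text \<open>The Levy measure of a driftless subordinator with finite mean. Its total mass may be
  infinite: the first moment controls the small jumps, because \<open>1 - exp (- (w * x))\<close> is
  bounded by \<open>norm w * x\<close>.\<close>

locale jump_measure =
  fixes F :: "real measure"
  assumes sets_F [measurable_cong]: "sets F = sets borel"
    and AE_pos: "AE x in F. 0 < x"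
    and integrable_id: "integrable F (\<lambda>x. x)"
begin

definition mean :: real where "mean = (LINT x|F. x)"

lemma mean_nonneg: "0 \<le> mean"
  unfolding mean_def by (rule integral_nonneg_AE) (use AE_pos in auto)

lemma AE_laplace_le:
  assumes "0 \<le> Re w"
  shows "AE x in F. norm (1 - exp (- (w * of_real x))) \<le> norm w * x"
  using AE_pos
proof eventually_elim
  case (elim x)
  then show ?case using norm_one_minus_exp_le[of "w * of_real x"] assms by (simp add: norm_mult)
qed

lemma integrable_laplace_exponent:
  assumes "0 \<le> Re w"
  shows "complex_integrable F (\<lambda>x. 1 - exp (- (w * of_real x)))"
proof (rule Bochner_Integration.integrable_bound)
  show "integrable F (\<lambda>x. norm w * x)" using integrable_id by simp
  show "AE x in F. norm (1 - exp (- (w * of_real x))) \<le> norm (norm w * x)"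
    using AE_laplace_le[OF assms] by eventually_elim auto
qed simp

lemma integrable_bernstein:
  assumes "0 \<le> u"
  shows "integrable F (\<lambda>x. 1 - exp (- (u * x)))"
proof -
  have "complex_integrable F (\<lambda>x. of_real (1 - exp (- (u * x))))"
    using integrable_laplace_exponent[of "of_real u"] assms by (simp add: exp_of_real[symmetric])
  then show ?thesis by (subst (asm) complex_of_real_integrable_eq)
qed

lemma laplace_exponent_of_real: "laplace_exponent F (of_real u) = of_real (bernstein F u)"
  unfolding laplace_exponent_def bernstein_def
  by (subst integral_complex_of_real[symmetric]) (simp add: exp_of_real[symmetric])

lemma bernstein_nonneg: "0 \<le> u \<Longrightarrow> 0 \<le> bernstein F u"
  unfolding bernstein_def by (rule integral_nonneg_AE) (use AE_pos in auto)

lemma bernstein_le: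
  assumes "0 \<le> u"
  shows "bernstein F u \<le> u * mean"
proof -
  have "bernstein F u \<le> (LINT x|F. u * x)"
    unfolding bernstein_def
  proof (rule integral_mono_AE)
    show "AE x in F. 1 - exp (- (u * x)) \<le> u * x"
      using exp_ge_add_one_self[of "- (u * x)" for x] by (intro AE_I2) (simp add: algebra_simps)
  qed (use integrable_bernstein[OF assms] integrable_id in auto)
  then show ?thesis by (simp add: mean_def)
qed

lemma integrable_tail:
  assumes "0 < \<epsilon>"
  shows "integrable F (indicator {\<epsilon><..} :: real \<Rightarrow> real)"
proof (rule Bochner_Integration.integrable_bound)
  show "integrable F (\<lambda>x. x / \<epsilon>)" using integrable_id by simp
  have "norm (indicator {\<epsilon><..} x :: real) \<le> norm (x / \<epsilon>)" for x
    using assms by (cases "\<epsilon> < x") (auto simp: le_divide_eq)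
  then show "AE x in F. norm (indicator {\<epsilon><..} x :: real) \<le> norm (x / \<epsilon>)" by simp
qed simp

lemma measure_tail_le:
  assumes "0 < \<epsilon>"
  shows "measure F {\<epsilon><..} \<le> mean / \<epsilon>"
proof -
  have "measure F {\<epsilon><..} = (LINT x|F. indicator {\<epsilon><..} x)" by (simp add: sets_eq_imp_space_eq[OF sets_F])
  also have "\<dots> \<le> (LINT x|F. x / \<epsilon>)"
  proof (rule integral_mono_AE)
    show "AE x in F. indicator {\<epsilon><..} x \<le> x / \<epsilon>"
      using AE_pos by eventually_elim (use assms in \<open>auto simp: indicator_def le_divide_eq\<close>)
  qed (use integrable_tail[OF assms] integrable_id in auto)
  finally show ?thesis by (simp add: mean_def)
qed

text \<open>This is the transform of a variable that equals 0 with probability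
  \<open>1 - c * q\<close> and is otherwise drawn from \<open>F\<close> conditioned on
  \<open>{\<epsilon><..}\<close>, where \<open>q\<close> is the mass of that set.\<close>

lemma has_laplace_thinned:
  assumes "0 < \<epsilon>" "0 \<le> c" "c * measure F {\<epsilon><..} \<le> 1"
  shows "\<exists>\<rho>. has_laplace \<rho>
    (\<lambda>w. 1 - of_real c * (CLINT x|F. indicator {\<epsilon><..} x * (1 - exp (- (w * of_real x)))))"
proof (cases "measure F {\<epsilon><..} = 0")
  case True
  \<comment> \<open>Here conditioning is impossible, but the integral vanishes and the unit mass at
    0 serves. \<open>measure\<close> is also 0 on sets of infinite mass, so finiteness has to be
    checked before the tail can be called null.\<close>
  have "emeasure F {\<epsilon><..} < \<infinity>"
    using integrable_tail[OF assms(1)] unfolding integrable_indicator_iff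
    by (simp add: sets_eq_imp_space_eq[OF sets_F])
  then have "{\<epsilon><..} \<in> null_sets F"
    using True by (auto simp: null_sets_def sets_F measure_def enn2real_eq_0_iff)
  then have AE: "AE x in F. x \<notin> {\<epsilon><..}" by (rule AE_not_in)
  have "(CLINT x|F. indicator {\<epsilon><..} x * (1 - exp (- (w * of_real x)))) = 0" for w
    by (rule integral_eq_zero_AE) (use AE in \<open>auto simp: indicator_def\<close>)
  then show ?thesis using has_laplace_return by (intro exI[of _ "return borel 0"]) simp
next
  case False
  define q where "q = measure F {\<epsilon><..}"
  define \<kappa> where "\<kappa> = density F (\<lambda>x. ennreal (indicator {\<epsilon><..} x / q))"
  have q: "0 < q" using False by (simp add: q_def zero_less_measure_iff)
  note int_ind = integrable_tail[OF assms(1)]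
  have [measurable_cong]: "sets \<kappa> = sets borel" by (simp add: \<kappa>_def sets_F)
  have \<kappa>: "prob_space \<kappa>"
  proof
    have "emeasure \<kappa> (space \<kappa>) = (\<integral>\<^sup>+x. ennreal (indicator {\<epsilon><..} x / q) \<partial>F)"
      unfolding \<kappa>_def by (subst emeasure_density) (auto intro!: nn_integral_cong)
    also have "\<dots> = ennreal (LINT x|F. indicator {\<epsilon><..} x / q)"
      by (rule nn_integral_eq_integral) (use int_ind q in auto)
    also have "(LINT x|F. indicator {\<epsilon><..} x / q) = 1"
      using q by (simp add: q_def sets_eq_imp_space_eq[OF sets_F])
    finally show "emeasure \<kappa> (space \<kappa>) = 1" by simp
  qed
  have "AE x in \<kappa>. 0 \<le> x"
    unfolding \<kappa>_def using assms(1) by (subst AE_density) (auto simp: indicator_def)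
  have L: "has_laplace \<kappa> (\<lambda>w. (CLINT x|F. indicator {\<epsilon><..} x * exp (- (w * of_real x))) / of_real q)"
    unfolding has_laplace_def
  proof (intro conjI allI impI \<kappa>)
    fix w :: complex assume "0 \<le> Re w"
    have "(CLINT x|\<kappa>. exp (- (w * of_real x)))
        = (CLINT x|F. (indicator {\<epsilon><..} x / q) *\<^sub>R exp (- (w * of_real x)))"
      unfolding \<kappa>_def by (rule integral_density) (use q in auto)
    also have "\<dots> = (CLINT x|F. indicator {\<epsilon><..} x * exp (- (w * of_real x)) / of_real q)"
      by (rule Bochner_Integration.integral_cong) (auto simp: indicator_def scaleR_conv_of_real)
    finally show "(CLINT x|\<kappa>. exp (- (w * of_real x)))
        = (CLINT x|F. indicator {\<epsilon><..} x * exp (- (w * of_real x))) / of_real q" by simp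
  qed fact+
  from has_laplace_mixture[OF L, of "c * q"] assms q
  obtain \<rho> where \<rho>: "has_laplace \<rho> (\<lambda>w. 1 - of_real (c * q) * (1 -
      (CLINT x|F. indicator {\<epsilon><..} x * exp (- (w * of_real x))) / of_real q))"
    by (auto simp: q_def)
  have "1 - of_real (c * q) * (1 - (CLINT x|F. indicator {\<epsilon><..} x * exp (- (w * of_real x))) / of_real q)
      = 1 - of_real c * (CLINT x|F. indicator {\<epsilon><..} x * (1 - exp (- (w * of_real x))))"
    if w: "0 \<le> Re w" for w
  proof -
    have ind: "complex_integrable F (\<lambda>x. indicator {\<epsilon><..} x)"
      using integrable_of_real[OF int_ind, where 'a = complex] by (simp add: of_real_indicator)
    have "complex_integrable F (\<lambda>x. indicator {\<epsilon><..} x * exp (- (w * of_real x)))"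
    proof (rule Bochner_Integration.integrable_bound[OF int_ind])
      show "AE x in F. norm (indicator {\<epsilon><..} x * exp (- (w * of_real x))) \<le> norm (indicator {\<epsilon><..} x :: real)"
        using AE_pos by eventually_elim (use w in \<open>auto simp: indicator_def\<close>)
    qed simp
    then have "(CLINT x|F. indicator {\<epsilon><..} x * (1 - exp (- (w * of_real x))))
       = (CLINT x|F. indicator {\<epsilon><..} x) - (CLINT x|F. indicator {\<epsilon><..} x * exp (- (w * of_real x)))"
      using ind by (simp add: algebra_simps)
    also have "(CLINT x|F. indicator {\<epsilon><..} x) = of_real (LINT x|F. indicator {\<epsilon><..} x)"
      by (subst integral_complex_of_real[symmetric]) (simp add: of_real_indicator)
    also have "(LINT x|F. indicator {\<epsilon><..} x) = q" by (simp add: q_def sets_eq_imp_space_eq[OF sets_F])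
    finally have *: "(CLINT x|F. indicator {\<epsilon><..} x * (1 - exp (- (w * of_real x))))
       = of_real q - (CLINT x|F. indicator {\<epsilon><..} x * exp (- (w * of_real x)))" .
    have "1 - of_real (c * q) * (1 - J / of_real q) = 1 - of_real c * (of_real q - J)" for J :: complex
      using q by (simp add: field_simps)
    then show ?thesis unfolding * .
  qed
  from has_laplace_cong[OF \<rho> this] show ?thesis by blast
qed

text \<open>Binomial approximation of the Poisson limit: jumps of size at most \<open>\<epsilon> n\<close> are discarded, where \<open>\<epsilon> n\<close>
  is chosen such that the remaining jump measure, scaled by \<open>s / n\<close>, has mass at most 1.\<close>

theorem subordinator_law_exists:
  assumes s: "0 < s"
  shows "\<exists>\<mu>. has_laplace \<mu> (\<lambda>w. exp (- (of_real s * laplace_exponent F w)))"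
proof -
  \<comment> \<open>By Markov's inequality the tail beyond \<open>\<epsilon> n\<close> has mass at
    most \<open>mean / \<epsilon> n\<close>, so scaling by \<open>s / Suc n\<close> brings it below
    \<open>s * mean / (s * mean + 1)\<close>. The added 1 keeps \<open>\<epsilon> n\<close> positive
    even if \<open>mean\<close> is 0.\<close>
  define \<epsilon> where "\<epsilon> n = (s * mean + 1) / real (Suc n)" for n
  have pos: "0 < s * mean + 1" using s mean_nonneg by (simp add: add_nonneg_pos)
  then have \<epsilon>: "0 < \<epsilon> n" for n by (simp add: \<epsilon>_def)
  define \<Psi> where "\<Psi> n w = (CLINT x|F. indicator {\<epsilon> n<..} x * (1 - exp (- (w * of_real x))))" for n w
  define a where "a n w = of_real (s / real (Suc n)) * \<Psi> n w" for n w
  have "\<exists>\<rho>. has_laplace \<rho> (\<lambda>w. 1 - a n w)" for n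
    unfolding a_def \<Psi>_def
  proof (rule has_laplace_thinned[OF \<epsilon>])
    have "s / real (Suc n) * measure F {\<epsilon> n<..} \<le> s / real (Suc n) * (mean / \<epsilon> n)"
      using measure_tail_le[OF \<epsilon>, of n] s by (intro mult_left_mono) auto
    also have "\<dots> = s * mean / (s * mean + 1)" by (simp add: \<epsilon>_def)
    also have "\<dots> \<le> 1" using pos by (simp add: field_simps)
    finally show "s / real (Suc n) * measure F {\<epsilon> n<..} \<le> 1" .
  qed (use s in auto)
  then obtain \<rho> where \<rho>: "\<And>n. has_laplace (\<rho> n) (\<lambda>w. 1 - a n w)" by metis
  have "\<exists>\<mu>. has_laplace \<mu> (\<lambda>w. (1 - a n w) ^ Suc n)" for n
    by (rule has_laplace_power[OF \<rho>])
  then obtain \<mu> where \<mu>: "\<And>n. has_laplace (\<mu> n) (\<lambda>w. (1 - a n w) ^ Suc n)" by metis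
  have norm1: "norm (1 - a n w) \<le> 1" if "0 \<le> Re w" for n w
    using norm_laplace_le[OF \<rho> that] .
  have AE_bound: "AE x in F. norm (indicator {\<epsilon> n<..} x * (1 - exp (- (w * of_real x)))) \<le> norm w * x"
    if "0 \<le> Re w" for n w
    using AE_pos AE_laplace_le[OF that] by eventually_elim (auto simp: indicator_def)
  have int_\<Psi>: "complex_integrable F (\<lambda>x. indicator {\<epsilon> n<..} x * (1 - exp (- (w * of_real x))))"
    if w: "0 \<le> Re w" for n w
  proof (rule Bochner_Integration.integrable_bound[of _ "\<lambda>x. norm w * x"])
    show "AE x in F. norm (indicator {\<epsilon> n<..} x * (1 - exp (- (w * of_real x)))) \<le> norm (norm w * x)"
      using AE_bound[OF w, of n] by eventually_elim (metis abs_ge_self order_trans real_norm_def)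
  qed (use integrable_id in auto)
  have \<Psi>_bound: "norm (\<Psi> n w) \<le> norm w * mean" if w: "0 \<le> Re w" for n w
  proof -
    have "norm (\<Psi> n w) \<le> (LINT x|F. norm (indicator {\<epsilon> n<..} x * (1 - exp (- (w * of_real x)))))"
      unfolding \<Psi>_def by (rule integral_norm_bound)
    also have "\<dots> \<le> (LINT x|F. norm w * x)"
      by (rule integral_mono_AE)
        (use integrable_norm[OF int_\<Psi>[OF w]] AE_bound[OF w] integrable_id in auto)
    finally show ?thesis by (simp add: mean_def)
  qed
  have a_bound: "real (Suc n) * norm (a n w) \<le> s * (norm w * mean)" if "0 \<le> Re w" for n w
  proof -
    have "norm (a n w) = s / real (Suc n) * norm (\<Psi> n w)"
      using s by (simp only: a_def norm_mult norm_of_real) simp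
    then have "real (Suc n) * norm (a n w) = s * norm (\<Psi> n w)" by simp
    then show ?thesis using mult_left_mono[OF \<Psi>_bound[OF that, of n], of s] s by simp
  qed
  have \<Psi>_lim: "(\<lambda>n. \<Psi> n w) \<longlonglongrightarrow> laplace_exponent F w" if w: "0 \<le> Re w" for w
    unfolding \<Psi>_def laplace_exponent_def
  proof (rule integral_dominated_convergence[where w = "\<lambda>x. norm w * x"])
    show "AE x in F. (\<lambda>n. indicator {\<epsilon> n<..} x * (1 - exp (- (w * of_real x))))
        \<longlonglongrightarrow> 1 - exp (- (w * of_real x))"
      using AE_pos
    proof eventually_elim
      case (elim x)
      have "(\<lambda>n. (s * mean + 1) * inverse (real (Suc n))) \<longlonglongrightarrow> (s * mean + 1) * 0"
        by (intro tendsto_intros LIMSEQ_inverse_real_of_nat)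
      then have "\<epsilon> \<longlonglongrightarrow> 0" by (simp add: \<epsilon>_def[abs_def] field_simps)
      then have "\<forall>\<^sub>F n in sequentially. \<epsilon> n < x" by (rule order_tendstoD) (use elim in simp)
      then have "\<forall>\<^sub>F n in sequentially. indicator {\<epsilon> n<..} x * (1 - exp (- (w * of_real x)))
          = 1 - exp (- (w * of_real x))"
        by eventually_elim simp
      then show ?case by (rule tendsto_eventually)
    qed
  qed (use AE_bound[OF w] integrable_id in auto)
  show ?thesis
  proof (rule has_laplace_limit[OF \<mu>])
    fix w :: complex assume w: "0 \<le> Re w"
    have Re_a: "0 \<le> Re (a n w)" for n
    proof -
      have "0 \<le> Re (\<Psi> n w)"
      proof -
        have "Re (\<Psi> n w) = (LINT x|F. Re (indicator {\<epsilon> n<..} x * (1 - exp (- (w * of_real x)))))"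
          unfolding \<Psi>_def using integral_Re[OF int_\<Psi>[OF w]] by simp
        moreover have "0 \<le> \<dots>"
        proof (rule integral_nonneg_AE)
          show "AE x in F. 0 \<le> Re (indicator {\<epsilon> n<..} x * (1 - exp (- (w * of_real x))))"
            using AE_pos
          proof eventually_elim
            case (elim x)
            have "Re (exp (- (w * of_real x))) \<le> 1"
              by (rule order_trans[OF complex_Re_le_cmod]) (use elim w in simp)
            then show ?case by (auto simp: indicator_def)
          qed
        qed
        ultimately show ?thesis by simp
      qed
      then show ?thesis using s by (simp add: a_def Re_divide_of_real)
    qed
    \<comment> \<open>Both bases lie in the unit disc, the first as a Laplace transform and the
      second because \<open>Re (a n w)\<close> is non-negative. Powers on the disc are Lipschitz
      with constant the exponent, and \<open>a n w\<close> is of order \<open>1 / n\<close>, so the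
      total error is of order \<open>1 / n\<close>.\<close>
    have "(\<lambda>n. (1 - a n w) ^ Suc n - exp (- a n w) ^ Suc n) \<longlonglongrightarrow> 0"
    proof (rule Lim_null_comparison)
      show "\<forall>\<^sub>F n in sequentially. norm ((1 - a n w) ^ Suc n - exp (- a n w) ^ Suc n)
          \<le> (s * (norm w * mean)) ^ 2 * inverse (real (Suc n))"
      proof (rule always_eventually, rule allI)
        fix n
        have "norm ((1 - a n w) ^ Suc n - exp (- a n w) ^ Suc n)
            \<le> real (Suc n) * norm (1 - a n w - exp (- a n w))"
          by (rule norm_power_diff) (use norm1[OF w] Re_a in auto)
        also have "\<dots> \<le> real (Suc n) * norm (a n w) ^ 2"
          by (intro mult_left_mono norm_exp_minus_linear_le Re_a) auto
        also have "\<dots> = (real (Suc n) * norm (a n w)) ^ 2 * inverse (real (Suc n))"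
          by (simp add: power2_eq_square field_simps)
        also have "\<dots> \<le> (s * (norm w * mean)) ^ 2 * inverse (real (Suc n))"
          by (intro mult_right_mono power_mono a_bound w) auto
        finally show "norm ((1 - a n w) ^ Suc n - exp (- a n w) ^ Suc n)
          \<le> (s * (norm w * mean)) ^ 2 * inverse (real (Suc n))" .
      qed
      have "(\<lambda>n. (s * (norm w * mean)) ^ 2 * inverse (real (Suc n))) \<longlonglongrightarrow> (s * (norm w * mean)) ^ 2 * 0"
        by (intro tendsto_intros LIMSEQ_inverse_real_of_nat)
      then show "(\<lambda>n. (s * (norm w * mean)) ^ 2 * inverse (real (Suc n))) \<longlonglongrightarrow> 0" by simp
    qed
    moreover have "exp (- a n w) ^ Suc n = exp (- (of_real s * \<Psi> n w))" for n
    proof -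
      have "exp (- a n w) ^ Suc n = exp (of_nat (Suc n) * (- a n w))"
        by (rule exp_of_nat_mult[symmetric])
      also have "of_nat (Suc n) * (- a n w) = - (of_real s * \<Psi> n w)"
        unfolding a_def by (simp del: of_nat_Suc)
      finally show ?thesis .
    qed
    moreover have "(\<lambda>n. exp (- (of_real s * \<Psi> n w))) \<longlonglongrightarrow> exp (- (of_real s * laplace_exponent F w))"
      by (intro tendsto_intros \<Psi>_lim w)
    ultimately show "(\<lambda>n. (1 - a n w) ^ Suc n) \<longlonglongrightarrow> exp (- (of_real s * laplace_exponent F w))"
      by (auto dest: tendsto_add)
  next
    fix n and u :: real assume "0 < u"
    \<comment> \<open>The same power estimate, now against the base 1, gives the linear bound that
      ensures tightness.\<close>
    have "1 - Re ((1 - a n u) ^ Suc n) = Re (1 ^ Suc n - (1 - a n u) ^ Suc n)" by simp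
    also have "\<dots> \<le> norm (1 ^ Suc n - (1 - a n u) ^ Suc n)" by (rule complex_Re_le_cmod)
    also have "\<dots> \<le> real (Suc n) * norm (1 - (1 - a n u))"
      by (rule norm_power_diff) (use norm1[of "of_real u" n] \<open>0 < u\<close> in auto)
    also have "\<dots> \<le> (s * mean) * u"
      using a_bound[of "of_real u" n] \<open>0 < u\<close> by (simp add: mult_ac)
    finally show "1 - Re ((1 - a n (of_real u)) ^ Suc n) \<le> (s * mean) * u" .
  qed
qed

end

section \<open>Tempered stable jump measures\<close>

text \<open>The law at time \<open>s\<close> of the driftless subordinator with Levy measure
  \<open>F\<close>.\<close>

definition subordinator_law :: "real measure \<Rightarrow> real \<Rightarrow> real measure \<Rightarrow> bool" where
  "subordinator_law F s \<mu> \<longleftrightarrow>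
     has_laplace \<mu> (\<lambda>w. exp (- (of_real s * laplace_exponent F w)))"

lemma exp_minus_mult_of_real:
  "exp (- (complex_of_real u * complex_of_real x)) = complex_of_real (exp (- (u * x)))"
  by (metis exp_of_real of_real_minus of_real_mult)

section \<open>Moments, exponential tilting and sublinear growth for general subordinators\<close>

context jump_measure
begin

lemma expectation_exp_subordinator:
  assumes "subordinator_law F s \<mu>" "0 \<le> u"
  shows "integrable \<mu> (\<lambda>x. exp (- (u * x)))"
    and "(LINT x|\<mu>. exp (- (u * x))) = exp (- (s * bernstein F u))"
proof -
  note L = assms(1)[unfolded subordinator_law_def]
  have "complex_integrable \<mu> (\<lambda>x. of_real (exp (- (u * x))))"
    using integrable_laplace[OF L, of "of_real u"] assms(2) by (simp add: exp_minus_mult_of_real)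
  then show "integrable \<mu> (\<lambda>x. exp (- (u * x)))" by (subst (asm) complex_of_real_integrable_eq)
  have "of_real (LINT x|\<mu>. exp (- (u * x))) = (CLINT x|\<mu>. exp (- (of_real u * of_real x)))"
    unfolding exp_minus_mult_of_real by (rule integral_complex_of_real[symmetric])
  also have "\<dots> = of_real (exp (- (s * bernstein F u)))"
    using has_laplaceD(4)[OF L, of "of_real u"] assms(2)
    by (simp only: laplace_exponent_of_real exp_minus_mult_of_real) simp
  finally show "(LINT x|\<mu>. exp (- (u * x))) = exp (- (s * bernstein F u))"
    by (simp only: of_real_eq_iff)
qed

text \<open>The quotients \<open>(1 - exp (- (h * x))) / h\<close> tend to \<open>x\<close> as
  \<open>h\<close> tends to 0, and their integrals are at most \<open>s * mean\<close>. Fatou's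
  lemma passes the bound to the limit without presupposing a finite first moment.\<close>

lemma subordinator_mean_le:
  assumes \<mu>: "subordinator_law F s \<mu>" and s: "0 \<le> s"
  shows "(\<integral>\<^sup>+x. ennreal x \<partial>\<mu>) \<le> ennreal (s * mean)"
proof -
  note L = has_laplaceD[OF \<mu>[unfolded subordinator_law_def]]
  interpret prob_space \<mu> by (rule L)
  note [measurable_cong] = L(2)
  define f where "f n x = real (Suc n) * (1 - exp (- (1 / real (Suc n) * x)))" for n x
  have f_int: "integrable \<mu> (f n)" for n
    unfolding f_def using expectation_exp_subordinator(1)[OF \<mu>, of "1 / real (Suc n)"]
    by (intro integrable_mult_right Bochner_Integration.integrable_diff) auto
  have lim: "(\<lambda>n. f n x) \<longlonglongrightarrow> x" for x
  proof -
    have "((\<lambda>h. (1 - exp (- (h * x))) / h) \<longlongrightarrow> x) (at 0)"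
    proof -
      have "((\<lambda>h. 1 - exp (- (h * x))) has_real_derivative x) (at 0)"
        by (auto intro!: derivative_eq_intros)
      then show ?thesis by (simp add: DERIV_def)
    qed
    moreover have "filterlim (\<lambda>n. 1 / real (Suc n)) (at 0) sequentially"
      using LIMSEQ_Suc[OF lim_1_over_n] by (intro filterlim_atI) auto
    ultimately have "(\<lambda>n. (1 - exp (- (1 / real (Suc n) * x))) / (1 / real (Suc n))) \<longlonglongrightarrow> x"
      by (rule filterlim_compose)
    then show ?thesis by (simp add: f_def mult.commute del: of_nat_Suc)
  qed
  have bound: "(\<integral>\<^sup>+x. ennreal (f n x) \<partial>\<mu>) \<le> ennreal (s * mean)" for n
  proof -
    define u where "u = 1 / real (Suc n)"
    have u: "0 < u" "real (Suc n) = 1 / u" by (simp_all add: u_def)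
    have "(\<integral>\<^sup>+x. ennreal (f n x) \<partial>\<mu>) = ennreal (LINT x|\<mu>. f n x)"
    proof (rule nn_integral_eq_integral[OF f_int])
      show "AE x in \<mu>. 0 \<le> f n x"
        using L(3) by eventually_elim (auto simp: f_def simp del: of_nat_Suc)
    qed
    also have "(LINT x|\<mu>. f n x) = (1 / u) * (1 - exp (- (s * bernstein F u)))"
      using expectation_exp_subordinator[OF \<mu>, of u] u
      by (simp add: f_def prob_space u_def[symmetric] del: of_nat_Suc)
    also have "\<dots> \<le> (1 / u) * (s * (u * mean))"
    proof (rule mult_left_mono)
      have "1 - exp (- (s * bernstein F u)) \<le> s * bernstein F u"
        using exp_ge_add_one_self[of "- (s * bernstein F u)"] by simp
      also have "\<dots> \<le> s * (u * mean)" using bernstein_le[of u] s u by (intro mult_left_mono) auto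
      finally show "1 - exp (- (s * bernstein F u)) \<le> s * (u * mean)" .
    qed (use u in auto)
    finally show ?thesis using u by (simp add: ennreal_leI)
  qed
  have "(\<integral>\<^sup>+x. ennreal x \<partial>\<mu>) = (\<integral>\<^sup>+x. liminf (\<lambda>n. ennreal (f n x)) \<partial>\<mu>)"
    using lim by (intro nn_integral_cong lim_imp_Liminf[symmetric] tendsto_ennrealI) auto
  also have "\<dots> \<le> liminf (\<lambda>n. \<integral>\<^sup>+x. ennreal (f n x) \<partial>\<mu>)"
    by (rule nn_integral_liminf) (simp add: f_def)
  also have "\<dots> \<le> ennreal (s * mean)"
    by (rule Liminf_le) (use bound in auto)
  finally show ?thesis .
qed

text \<open>Writing \<open>\<Phi>\<close> for the exponent of \<open>F\<close>, the tilted jump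
  measure has exponent \<open>\<Phi>(w + a) - \<Phi>(a)\<close>. The subtracted constant is exactly
  what the normalising factor \<open>exp (s * \<Phi>(a))\<close> of the tilted law
  contributes.\<close>

lemma subordinator_law_tilt:
  assumes \<mu>: "subordinator_law F s \<mu>" and a: "0 \<le> a"
  shows "subordinator_law (density F (\<lambda>x. ennreal (exp (- (a * x))))) s
    (density \<mu> (\<lambda>x. ennreal (exp (s * bernstein F a - a * x))))"
    (is "subordinator_law ?F s ?\<mu>")
proof -
  note L = has_laplaceD[OF \<mu>[unfolded subordinator_law_def]]
  interpret \<mu>: prob_space \<mu> by (rule L)
  note [measurable_cong] = L(2)
  let ?B = "s * bernstein F a"
  have split: "exp (?B - a * x) = exp ?B * exp (- (a * x))" for x
    by (simp add: exp_diff exp_minus field_simps)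
  have "prob_space ?\<mu>"
  proof
    have "emeasure ?\<mu> (space ?\<mu>) = (\<integral>\<^sup>+x. ennreal (exp (?B - a * x)) \<partial>\<mu>)"
      by (simp add: emeasure_density cong: nn_integral_cong)
    also have "\<dots> = ennreal (LINT x|\<mu>. exp (?B - a * x))"
      using expectation_exp_subordinator(1)[OF \<mu> a]
      by (intro nn_integral_eq_integral) (simp_all add: split)
    also have "(LINT x|\<mu>. exp (?B - a * x)) = 1"
      using expectation_exp_subordinator(2)[OF \<mu> a] by (simp add: split exp_minus)
    finally show "emeasure ?\<mu> (space ?\<mu>) = 1" by simp
  qed
  moreover have "AE x in ?\<mu>. 0 \<le> x"
    using L(3) by (subst AE_density) auto
  moreover have "(CLINT x|?\<mu>. exp (- (w * of_real x))) = exp (- (of_real s * laplace_exponent ?F w))"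
    if w: "0 \<le> Re w" for w
  proof -
    have wa: "0 \<le> Re (w + of_real a)" using w a by simp
    have "laplace_exponent ?F w = (CLINT x|F. exp (- (a * x)) *\<^sub>R (1 - exp (- (w * of_real x))))"
      unfolding laplace_exponent_def by (subst integral_density) auto
    also have "\<dots> = (CLINT x|F. (1 - exp (- ((w + of_real a) * of_real x)))
        - (1 - exp (- (of_real a * of_real x))))"
    proof (rule Bochner_Integration.integral_cong)
      show "exp (- (a * x)) *\<^sub>R (1 - exp (- (w * of_real x)))
        = (1 - exp (- ((w + of_real a) * of_real x))) - (1 - exp (- (of_real a * of_real x)))" for x
        by (simp add: scaleR_conv_of_real exp_of_real[symmetric] algebra_simps exp_add[symmetric])
    qed simp
    also have "\<dots> = laplace_exponent F (w + of_real a) - of_real (bernstein F a)"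
      unfolding laplace_exponent_of_real[symmetric] laplace_exponent_def
      by (rule Bochner_Integration.integral_diff)
        (use integrable_laplace_exponent[OF wa] integrable_laplace_exponent[of "of_real a"] a in auto)
    finally have \<Psi>: "laplace_exponent ?F w = laplace_exponent F (w + of_real a) - of_real (bernstein F a)" .
    have "(CLINT x|?\<mu>. exp (- (w * of_real x)))
        = (CLINT x|\<mu>. exp (?B - a * x) *\<^sub>R exp (- (w * of_real x)))"
      by (subst integral_density) auto
    also have "\<dots> = (CLINT x|\<mu>. of_real (exp ?B) * exp (- ((w + of_real a) * of_real x)))"
    proof (rule Bochner_Integration.integral_cong)
      show "exp (?B - a * x) *\<^sub>R exp (- (w * of_real x))
        = of_real (exp ?B) * exp (- ((w + of_real a) * of_real x))" for x
        by (simp add: scaleR_conv_of_real exp_of_real[symmetric] algebra_simps exp_add[symmetric])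
    qed simp
    also have "\<dots> = of_real (exp ?B) * exp (- (of_real s * laplace_exponent F (w + of_real a)))"
      using L(4)[OF wa] by simp
    also have "\<dots> = exp (- (of_real s * laplace_exponent ?F w))"
      unfolding \<Psi> by (simp add: exp_of_real[symmetric] exp_add[symmetric] algebra_simps)
    finally show ?thesis .
  qed
  ultimately show ?thesis
    unfolding subordinator_law_def has_laplace_def by (simp add: L(2))
qed

text \<open>This expresses the absence of drift: \<open>(1 - exp (- (n * x))) / n\<close> tends to 0
  and is dominated by \<open>x\<close>. It is used to make the influence of jumps of the opposite
  sign on a one-sided test function negligible.\<close>

lemma bernstein_sublinear:
  assumes "0 < \<epsilon>"
  shows "\<exists>v>0. bernstein F v \<le> \<epsilon> * v"
proof -
  have "(\<lambda>n. LINT x|F. (1 - exp (- (real (Suc n) * x))) * inverse (real (Suc n))) \<longlonglongrightarrow> (LINT x|F. 0)"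
  proof (rule integral_dominated_convergence[where w = "\<lambda>x. x"])
    show "AE x in F. (\<lambda>n. (1 - exp (- (real (Suc n) * x))) * inverse (real (Suc n))) \<longlonglongrightarrow> 0"
      using AE_pos
    proof eventually_elim
      case (elim x)
      show ?case
      proof (rule Lim_null_comparison[OF always_eventually LIMSEQ_inverse_real_of_nat], rule allI)
        fix n
        have "exp (- (real (Suc n) * x)) \<le> 1" using elim by (simp del: of_nat_Suc)
        then have "\<bar>1 - exp (- (real (Suc n) * x))\<bar> \<le> 1"
          using exp_gt_zero[of "- (real (Suc n) * x)"] by linarith
        then show "norm ((1 - exp (- (real (Suc n) * x))) * inverse (real (Suc n))) \<le> inverse (real (Suc n))"
          using mult_right_mono[of "\<bar>1 - exp (- (real (Suc n) * x))\<bar>" 1 "inverse (real (Suc n))"]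
          by (simp only: real_norm_def abs_mult) simp
      qed
    qed
    show "AE x in F. norm ((1 - exp (- (real (Suc n) * x))) * inverse (real (Suc n))) \<le> x" for n
      using AE_pos
    proof eventually_elim
      case (elim x)
      have "\<bar>1 - exp (- y)\<bar> \<le> y" if "0 \<le> y" for y :: real
        using exp_ge_add_one_self[of "- y"] that by (simp add: abs_if)
      then have "\<bar>1 - exp (- (real (Suc n) * x))\<bar> \<le> real (Suc n) * x"
        using elim by (simp del: of_nat_Suc)
      then show ?case by (simp add: abs_mult field_simps del: of_nat_Suc)
    qed
  qed (simp_all add: integrable_id del: of_nat_Suc)
  then have "(\<lambda>n. bernstein F (real (Suc n)) * inverse (real (Suc n))) \<longlonglongrightarrow> 0"
    by (simp add: bernstein_def del: of_nat_Suc)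
  then have "\<forall>\<^sub>F n in sequentially. bernstein F (real (Suc n)) * inverse (real (Suc n)) < \<epsilon>"
    by (rule order_tendstoD) fact
  then obtain n where "bernstein F (real (Suc n)) * inverse (real (Suc n)) < \<epsilon>"
    by (auto dest: eventually_happens)
  then have "bernstein F (real (Suc n)) \<le> \<epsilon> * real (Suc n)"
    by (simp add: field_simps del: of_nat_Suc)
  then show ?thesis by (intro exI[of _ "real (Suc n)"]) auto
qed

end

text \<open>The second component enters with a minus sign, hence the two conjugate arguments on the
  imaginary axis.\<close>

lemma char_subordinator_difference:
  assumes "subordinator_law F s \<mu>" "subordinator_law G s \<nu>"
  shows "char (distr (\<mu> \<Otimes>\<^sub>M \<nu>) borel (\<lambda>(x, y). x - y)) z
    = exp (- (of_real s * (laplace_exponent F (- \<i> * of_real z) + laplace_exponent G (\<i> * of_real z))))"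
proof -
  note L = has_laplaceD[OF assms(1)[unfolded subordinator_law_def]]
    and L' = has_laplaceD[OF assms(2)[unfolded subordinator_law_def]]
  note [measurable_cong] = L(2) L'(2)
  interpret \<mu>: prob_space \<mu> by (rule L)
  interpret \<nu>: prob_space \<nu> by (rule L')
  interpret P: pair_prob_space \<mu> \<nu> ..
  have "char (distr (\<mu> \<Otimes>\<^sub>M \<nu>) borel (\<lambda>(x, y). x - y)) z
      = (CLINT p|\<mu> \<Otimes>\<^sub>M \<nu>. iexp (z * (fst p - snd p)))"
    unfolding char_def by (subst integral_distr) (auto simp: case_prod_beta)
  also have "\<dots> = (CLINT p|\<mu> \<Otimes>\<^sub>M \<nu>. iexp (z * fst p) * iexp (- z * snd p))"
    by (simp add: algebra_simps exp_add[symmetric])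
  also have "\<dots> = (CLINT x|\<mu>. CLINT y|\<nu>. iexp (z * x) * iexp (- z * y))"
    by (subst P.integral_fst'[symmetric])
      (auto intro!: P.integrable_const_bound[where B = 1] simp: norm_mult simp del: of_real_mult of_real_minus)
  also have "\<dots> = (CLINT x|\<mu>. exp (- ((- \<i> * of_real z) * of_real x)))
      * (CLINT y|\<nu>. exp (- ((\<i> * of_real z) * of_real y)))"
    by (simp add: mult.assoc)
  also have "\<dots> = exp (- (of_real s * (laplace_exponent F (- \<i> * of_real z) + laplace_exponent G (\<i> * of_real z))))"
    using L(4)[of "- \<i> * of_real z"] L'(4)[of "\<i> * of_real z"]
    by (simp add: exp_add[symmetric] algebra_simps)
  finally show ?thesis .
qed

section \<open>Tempered stable jumps: finite mean, tilting, growth and comparison of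
  exponents\<close>

definition ts_density :: "real \<Rightarrow> real \<Rightarrow> real \<Rightarrow> real \<Rightarrow> real" where
  "ts_density \<alpha> \<beta> lam x = \<alpha> / x powr (1 + \<beta>) * exp (- lam * x) * indicator {0<..} x"

definition ts_jumps :: "real \<Rightarrow> real \<Rightarrow> real \<Rightarrow> real measure" where
  "ts_jumps \<alpha> \<beta> lam = density lborel (\<lambda>x. ennreal (ts_density \<alpha> \<beta> lam x))"

lemma ts_density_measurable [measurable]: "ts_density \<alpha> \<beta> lam \<in> borel_measurable borel"
  unfolding ts_density_def[abs_def] by measurable

lemma ts_density_nonneg: "0 < \<alpha> \<Longrightarrow> 0 \<le> ts_density \<alpha> \<beta> lam x"
  by (auto simp: ts_density_def intro!: mult_nonneg_nonneg)

text \<open>After the substitution \<open>t = lam * x\<close> the first moment becomes a multiple of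
  the Gamma integral with parameter \<open>1 - \<beta>\<close>, which converges because
  \<open>\<beta> < 1\<close>.\<close>

lemma jump_measure_ts_jumps:
  assumes "0 < \<alpha>" "\<beta> \<in> {0..<1}" "0 < lam"
  shows "jump_measure (ts_jumps \<alpha> \<beta> lam)"
proof
  show "sets (ts_jumps \<alpha> \<beta> lam) = sets borel" by (simp add: ts_jumps_def)
  show "AE x in ts_jumps \<alpha> \<beta> lam. 0 < x"
    unfolding ts_jumps_def
    by (subst AE_density) (auto simp: ts_density_def indicator_def split: if_splits)
  define g where "g t = indicator {0..} t * t powr (- \<beta>) / exp t" for t :: real
  have "integrable lborel g"
  proof (rule integrableI_nn_integral_finite)
    show "(\<integral>\<^sup>+t. ennreal (g t) \<partial>lborel) = ennreal (Gamma (1 - \<beta>))"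
      using Gamma_conv_nn_integral_real[of "1 - \<beta>"] assms by (simp add: g_def)
  qed (auto simp: g_def[abs_def])
  then have "integrable lborel (\<lambda>x. g (0 + lam * x))"
    using assms by (intro lborel_integrable_real_affine) auto
  then have "integrable lborel (\<lambda>x. \<alpha> * lam powr \<beta> * g (lam * x))" by simp
  moreover have "\<alpha> * lam powr \<beta> * g (lam * x) = ts_density \<alpha> \<beta> lam x * x" for x
  proof (cases "0 < x")
    case True
    then have "g (lam * x) = (lam * x) powr (- \<beta>) / exp (lam * x)"
      using assms by (simp add: g_def)
    also have "\<dots> = exp (- lam * x) / (lam powr \<beta> * x powr \<beta>)"
      using True assms by (simp add: powr_mult powr_minus exp_minus field_simps)
    finally show ?thesis using True assms
      by (simp add: ts_density_def powr_add field_simps)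
  next
    case False
    then have "lam * x < 0 \<or> x = 0" using assms by (auto simp: mult_less_0_iff)
    with False show ?thesis by (auto simp: g_def ts_density_def)
  qed
  ultimately show "integrable (ts_jumps \<alpha> \<beta> lam) (\<lambda>x. x)"
    unfolding ts_jumps_def using assms
    by (subst integrable_real_density) (auto simp: ts_density_nonneg)
qed

text \<open>Tilting affects only the tempering parameter. This is why a change of \<open>lam\<close>
  alone is an Esscher transform.\<close>

lemma ts_jumps_tilt:
  assumes "0 < \<alpha>"
  shows "density (ts_jumps \<alpha> \<beta> lam) (\<lambda>x. ennreal (exp (- (a * x)))) = ts_jumps \<alpha> \<beta> (lam + a)"
proof -
  have "ts_density \<alpha> \<beta> lam x * exp (- (a * x)) = ts_density \<alpha> \<beta> (lam + a) x" for x
  proof -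
    have "exp (- (lam + a) * x) = exp (- lam * x) * exp (- (a * x))"
      by (simp add: exp_add[symmetric] algebra_simps)
    then show ?thesis by (simp add: ts_density_def)
  qed
  then have "ennreal (ts_density \<alpha> \<beta> lam x) * ennreal (exp (- (a * x))) = ennreal (ts_density \<alpha> \<beta> (lam + a) x)" for x
    using assms by (simp add: ennreal_mult[symmetric] ts_density_nonneg)
  then show ?thesis unfolding ts_jumps_def by (subst density_density_eq) auto
qed

lemma bernstein_ts_jumps:
  assumes "0 < \<alpha>" "\<beta> \<in> {0..<1}" "0 < lam" "0 \<le> u"
  shows "integrable lborel (\<lambda>x. ts_density \<alpha> \<beta> lam x * (1 - exp (- (u * x))))"
    and "bernstein (ts_jumps \<alpha> \<beta> lam) u = (LINT x|lborel. ts_density \<alpha> \<beta> lam x * (1 - exp (- (u * x))))"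
proof -
  interpret jump_measure "ts_jumps \<alpha> \<beta> lam" by (rule jump_measure_ts_jumps) fact+
  show "integrable lborel (\<lambda>x. ts_density \<alpha> \<beta> lam x * (1 - exp (- (u * x))))"
    using integrable_bernstein[OF assms(4)] assms unfolding ts_jumps_def
    by (subst (asm) integrable_real_density) (auto simp: ts_density_nonneg)
  show "bernstein (ts_jumps \<alpha> \<beta> lam) u = (LINT x|lborel. ts_density \<alpha> \<beta> lam x * (1 - exp (- (u * x))))"
    unfolding bernstein_def ts_jumps_def
    by (subst integral_real_density) (use assms in \<open>auto simp: ts_density_nonneg\<close>)
qed

text \<open>For \<open>\<beta> = 0\<close> the growth is only logarithmic, so the lower bound
  \<open>K * ln u\<close> is aimed at this worst case: on \<open>{1 / u..1}\<close> the density is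
  at least a multiple of \<open>1 / x\<close>, and \<open>1 - exp (- (u * x))\<close> is at least
  \<open>1 - exp (- 1)\<close>.\<close>

lemma bernstein_ts_jumps_at_top:
  assumes "0 < \<alpha>" "\<beta> \<in> {0..<1}" "0 < lam"
  shows "filterlim (bernstein (ts_jumps \<alpha> \<beta> lam)) at_top at_top"
proof -
  define K where "K = (1 - exp (- 1)) * (\<alpha> * exp (- lam))"
  have K: "0 < K" using assms by (simp add: K_def)
  have "K * ln u \<le> bernstein (ts_jumps \<alpha> \<beta> lam) u" if u: "1 \<le> u" for u
  proof -
    have FTC: "integrable lborel (\<lambda>x. K / x * indicator {1 / u..1} x)"
      "(LINT x|lborel. K / x * indicator {1 / u..1} x) = K * ln 1 - K * ln (1 / u)"
    proof -
      have D: "DERIV (\<lambda>x. K * ln x) x :> K / x" "0 \<le> K / x" if "x \<in> {1 / u..1}" for x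
      proof -
        have "0 < x" using that u by (auto intro: less_le_trans[of 0 "1 / u"])
        then show "DERIV (\<lambda>x. K * ln x) x :> K / x" "0 \<le> K / x"
          using K by (auto intro!: derivative_eq_intros)
      qed
      show "integrable lborel (\<lambda>x. K / x * indicator {1 / u..1} x)"
        by (rule integrable_FTC_Icc_nonneg[OF _ D]) (use u in auto)
      show "(LINT x|lborel. K / x * indicator {1 / u..1} x) = K * ln 1 - K * ln (1 / u)"
        by (rule integral_FTC_Icc_nonneg[OF _ D]) (use u in auto)
    qed
    have "K * ln u = (LINT x|lborel. K / x * indicator {1 / u..1} x)"
      using FTC(2) u by (simp add: ln_div)
    also have "\<dots> \<le> (LINT x|lborel. ts_density \<alpha> \<beta> lam x * (1 - exp (- (u * x))))"
    proof (rule integral_mono[OF FTC(1) bernstein_ts_jumps(1)])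
      fix x :: real
      show "K / x * indicator {1 / u..1} x \<le> ts_density \<alpha> \<beta> lam x * (1 - exp (- (u * x)))"
      proof (cases "x \<in> {1 / u..1}")
        case True
        then have x: "0 < x" "x \<le> 1" "1 \<le> u * x"
          using u by (auto intro: less_le_trans[of 0 "1 / u"] simp: field_simps)
        have "x powr (1 + \<beta>) \<le> x powr 1" using x assms by (intro powr_mono') auto
        then have "\<alpha> / x \<le> \<alpha> / x powr (1 + \<beta>)" using x assms by (intro divide_left_mono) auto
        moreover have "exp (- lam) \<le> exp (- lam * x)" using x assms by simp
        ultimately have "\<alpha> / x * exp (- lam) \<le> \<alpha> / x powr (1 + \<beta>) * exp (- lam * x)"
          using x assms by (intro mult_mono) auto
        then have "\<alpha> / x * exp (- lam) \<le> ts_density \<alpha> \<beta> lam x" using x by (simp add: ts_density_def)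
        moreover have "1 - exp (- 1) \<le> 1 - exp (- (u * x))" using x by simp
        ultimately have "\<alpha> / x * exp (- lam) * (1 - exp (- 1)) \<le> ts_density \<alpha> \<beta> lam x * (1 - exp (- (u * x)))"
          using x assms by (intro mult_mono) (auto simp: ts_density_nonneg)
        then show ?thesis using True by (simp add: K_def mult_ac)
      next
        case False
        then show ?thesis using u assms
          by (cases "0 < x") (auto simp: ts_density_nonneg ts_density_def)
      qed
    qed (use assms u in auto)
    also have "\<dots> = bernstein (ts_jumps \<alpha> \<beta> lam) u"
      by (rule bernstein_ts_jumps(2)[symmetric]) (use assms u in auto)
    finally show ?thesis .
  qed
  then have "\<forall>\<^sub>F u in at_top. K * ln u \<le> bernstein (ts_jumps \<alpha> \<beta> lam) u"
    by (intro eventually_at_top_linorderI[of 1])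
  moreover have "filterlim (\<lambda>u. K * ln u) at_top at_top"
    by (rule filterlim_tendsto_pos_mult_at_top[OF tendsto_const K ln_at_top])
  ultimately show ?thesis by (rule filterlim_at_top_mono[rotated])
qed

text \<open>Small jumps decide the growth. Near 0 the density ratio tends to 0 or to
  \<open>\<alpha>1 / \<alpha>2 < 1\<close>, whatever the tempering, and this gives \<open>c\<close>;
  jumps away from 0 have finite mass, and this gives \<open>C\<close>. The condition
  \<open>small\<close> is the strict lexicographic order of (\<open>\<beta>\<close>,
  \<open>\<alpha>\<close>).\<close>

lemma bernstein_ts_jumps_comparison:
  assumes 1: "0 < \<alpha>1" "\<beta>1 \<in> {0..<1}" "0 < lam1"
    and 2: "0 < \<alpha>2" "\<beta>2 \<in> {0..<1}" "0 < lam2"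
    and small: "\<beta>1 < \<beta>2 \<or> \<beta>1 = \<beta>2 \<and> \<alpha>1 < \<alpha>2"
  shows "\<exists>c C. 0 < c \<and> c < 1 \<and> (\<forall>u\<ge>0. bernstein (ts_jumps \<alpha>1 \<beta>1 lam1) u
    \<le> c * bernstein (ts_jumps \<alpha>2 \<beta>2 lam2) u + C)"
proof -
  let ?f1 = "ts_density \<alpha>1 \<beta>1 lam1" and ?f2 = "ts_density \<alpha>2 \<beta>2 lam2"
  have "\<exists>c>0. c < 1 \<and> (\<forall>\<^sub>F x in at_right 0. \<alpha>1 / \<alpha>2 * (x powr (\<beta>2 - \<beta>1) * exp ((lam2 - lam1) * x)) < c)"
  proof (cases "\<beta>1 < \<beta>2")
    case True
    have "((\<lambda>x. \<alpha>1 / \<alpha>2 * (x powr (\<beta>2 - \<beta>1) * exp ((lam2 - lam1) * x)))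
        \<longlongrightarrow> \<alpha>1 / \<alpha>2 * (0 powr (\<beta>2 - \<beta>1) * exp ((lam2 - lam1) * 0))) (at_right 0)"
      using True by (intro tendsto_intros tendsto_powr2)
        (auto intro!: tendsto_intros simp: eventually_at_filter)
    then have "\<forall>\<^sub>F x in at_right 0. \<alpha>1 / \<alpha>2 * (x powr (\<beta>2 - \<beta>1) * exp ((lam2 - lam1) * x)) < 1 / 2"
      by (rule order_tendstoD) simp
    then show ?thesis by (intro exI[of _ "1 / 2"]) simp
  next
    case False
    with small have *: "\<beta>1 = \<beta>2" "\<alpha>1 < \<alpha>2" by auto
    \<comment> \<open>The midpoint between the limit of the ratio and 1 leaves room on both
      sides.\<close>
    define c where "c = (1 + \<alpha>1 / \<alpha>2) / 2"
    have r: "0 < \<alpha>1 / \<alpha>2" "\<alpha>1 / \<alpha>2 < 1" using * 1 2 by (auto simp: field_simps)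
    then have c: "0 < c" "c < 1" by (auto simp: c_def)
    have "q < (1 + q) / 2" if "q < 1" for q :: real using that by simp
    from this[OF r(2)] have c': "\<alpha>1 / \<alpha>2 < c" by (simp only: c_def)
    have "((\<lambda>x. \<alpha>1 / \<alpha>2 * (1 * exp ((lam2 - lam1) * x))) \<longlongrightarrow> \<alpha>1 / \<alpha>2 * (1 * exp ((lam2 - lam1) * 0))) (at_right 0)"
      by (intro tendsto_intros)
    then have "\<forall>\<^sub>F x in at_right 0. \<alpha>1 / \<alpha>2 * (1 * exp ((lam2 - lam1) * x)) < c"
      by (rule order_tendstoD) (use c' in simp)
    moreover have "\<forall>\<^sub>F x in at_right 0. (0 :: real) < x" by (simp add: eventually_at_right_less)
    ultimately have "\<forall>\<^sub>F x in at_right 0. \<alpha>1 / \<alpha>2 * (x powr (\<beta>2 - \<beta>1) * exp ((lam2 - lam1) * x)) < c"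
      by eventually_elim (simp add: *)
    with c show ?thesis by blast
  qed
  then obtain c where c: "0 < c" "c < 1"
    and ev: "\<forall>\<^sub>F x in at_right 0. \<alpha>1 / \<alpha>2 * (x powr (\<beta>2 - \<beta>1) * exp ((lam2 - lam1) * x)) < c"
    by blast
  from ev obtain \<delta> where \<delta>: "0 < \<delta>"
    and small': "\<And>x. 0 < x \<Longrightarrow> x < \<delta> \<Longrightarrow> \<alpha>1 / \<alpha>2 * (x powr (\<beta>2 - \<beta>1) * exp ((lam2 - lam1) * x)) < c"
    by (auto simp: eventually_at_right_field)
  have f1_le: "?f1 x \<le> c * ?f2 x" if "x < \<delta>" for x
  proof (cases "0 < x")
    case True
    have "?f1 x = \<alpha>1 / \<alpha>2 * (x powr (\<beta>2 - \<beta>1) * exp ((lam2 - lam1) * x)) * ?f2 x"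
      using True 1 2 by (simp add: ts_density_def powr_diff powr_add exp_minus field_simps exp_add[symmetric] left_diff_distrib exp_diff)
    also have "\<dots> \<le> c * ?f2 x"
      using small'[OF True that] 2 by (intro mult_right_mono ts_density_nonneg) auto
    finally show ?thesis .
  qed (simp add: ts_density_def)
  interpret J1: jump_measure "ts_jumps \<alpha>1 \<beta>1 lam1" by (rule jump_measure_ts_jumps) fact+
  have "integrable (ts_jumps \<alpha>1 \<beta>1 lam1) (indicator {\<delta> / 2<..} :: real \<Rightarrow> real)"
    using J1.integrable_tail[of "\<delta> / 2"] \<delta> by simp
  then have int_tail: "integrable lborel (\<lambda>x. ?f1 x * indicator {\<delta> / 2<..} x)"
    unfolding ts_jumps_def using 1
    by (subst (asm) integrable_real_density) (auto simp: ts_density_nonneg)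
  define C where "C = (LINT x|lborel. ?f1 x * indicator {\<delta> / 2<..} x)"
  have "bernstein (ts_jumps \<alpha>1 \<beta>1 lam1) u \<le> c * bernstein (ts_jumps \<alpha>2 \<beta>2 lam2) u + C" if u: "0 \<le> u" for u
  proof -
    note B1 = bernstein_ts_jumps[OF 1 u] and B2 = bernstein_ts_jumps[OF 2 u]
    have "bernstein (ts_jumps \<alpha>1 \<beta>1 lam1) u = (LINT x|lborel. ?f1 x * (1 - exp (- (u * x))))"
      by (rule B1)
    also have "\<dots> \<le> (LINT x|lborel. c * (?f2 x * (1 - exp (- (u * x)))) + ?f1 x * indicator {\<delta> / 2<..} x)"
    proof (rule integral_mono)
      fix x :: real
      \<comment> \<open>Cutting at half of \<open>\<delta>\<close> gives the strict inequality that
        \<open>f1_le\<close> demands on the closed inner interval.\<close>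
      consider "x \<le> 0" | "0 < x" "x \<le> \<delta> / 2" | "0 < x" "\<delta> / 2 < x" by linarith
      then show "?f1 x * (1 - exp (- (u * x)))
          \<le> c * (?f2 x * (1 - exp (- (u * x)))) + ?f1 x * indicator {\<delta> / 2<..} x"
      proof cases
        case 1
        then show ?thesis by (simp add: ts_density_def)
      next
        case 2
        then have "?f1 x * (1 - exp (- (u * x))) \<le> c * ?f2 x * (1 - exp (- (u * x)))"
          using \<delta> u by (intro mult_right_mono f1_le) auto
        then show ?thesis using 2 by (simp add: mult_ac)
      next
        case 3
        have "?f1 x * (1 - exp (- (u * x))) \<le> ?f1 x * 1"
          using 1 by (intro mult_left_mono ts_density_nonneg) auto
        moreover have "0 \<le> c * (?f2 x * (1 - exp (- (u * x))))"
          using 3 2 u c by (intro mult_nonneg_nonneg ts_density_nonneg) auto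
        ultimately show ?thesis using 3 by simp
      qed
    qed (use B1 B2 int_tail in auto)
    also have "\<dots> = c * bernstein (ts_jumps \<alpha>2 \<beta>2 lam2) u + C"
      using B2 int_tail by (simp add: C_def)
    finally show ?thesis .
  qed
  with c show ?thesis by blast
qed

section \<open>Increments over dyadic grids\<close>

text \<open>Reflecting the negative half-line turns the two-sided Levy measure into two one-sided
  jump measures. A jump of size \<open>- x\<close> contributes \<open>iexp (- z * x) - 1\<close>,
  which accounts for the argument \<open>\<i> * z\<close> of the second exponent.\<close>

lemma ts_levy_exponent:
  assumes p: "0 < \<alpha>_p" "\<beta>_p \<in> {0..<1}" "0 < lam_p"
    and m: "0 < \<alpha>_m" "\<beta>_m \<in> {0..<1}" "0 < lam_m"
  shows "(CLINT x|ts_levy_measure \<alpha>_p \<beta>_p lam_p \<alpha>_m \<beta>_m lam_m. iexp (z * x) - 1)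
    = - (laplace_exponent (ts_jumps \<alpha>_p \<beta>_p lam_p) (- \<i> * of_real z)
       + laplace_exponent (ts_jumps \<alpha>_m \<beta>_m lam_m) (\<i> * of_real z))"
proof -
  let ?p = "ts_density \<alpha>_p \<beta>_p lam_p" and ?m = "ts_density \<alpha>_m \<beta>_m lam_m"
  let ?e = "\<lambda>x. iexp (z * x) - 1"
  have LE: "integrable lborel (\<lambda>x. ts_density \<alpha> \<beta> lam x *\<^sub>R (1 - exp (- (w * of_real x))))"
      "laplace_exponent (ts_jumps \<alpha> \<beta> lam) w = (CLINT x|lborel. ts_density \<alpha> \<beta> lam x *\<^sub>R (1 - exp (- (w * of_real x))))"
    if "0 < \<alpha>" "\<beta> \<in> {0..<1}" "0 < lam" "0 \<le> Re w" for \<alpha> \<beta> lam w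
  proof -
    interpret jump_measure "ts_jumps \<alpha> \<beta> lam" by (rule jump_measure_ts_jumps) fact+
    show "integrable lborel (\<lambda>x. ts_density \<alpha> \<beta> lam x *\<^sub>R (1 - exp (- (w * of_real x))))"
      using integrable_laplace_exponent[OF that(4)] that(1) unfolding ts_jumps_def
      by (subst (asm) integrable_density) (auto simp: ts_density_nonneg)
    show "laplace_exponent (ts_jumps \<alpha> \<beta> lam) w = (CLINT x|lborel. ts_density \<alpha> \<beta> lam x *\<^sub>R (1 - exp (- (w * of_real x))))"
      unfolding laplace_exponent_def ts_jumps_def
      by (rule integral_density) (use that(1) in \<open>auto simp: ts_density_nonneg\<close>)
  qed
  let ?fp = "\<lambda>x. ?p x *\<^sub>R (1 - exp (- ((- \<i> * of_real z) * of_real x)))"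
  let ?fm = "\<lambda>x. ?m x *\<^sub>R (1 - exp (- ((\<i> * of_real z) * of_real x)))"
  have fp: "integrable lborel ?fp" by (rule LE) (use p in auto)
  have fm: "integrable lborel (\<lambda>x. ?fm (0 + (- 1) * x))"
    by (rule lborel_integrable_real_affine, rule LE) (use m in auto)
  have "ts_levy_measure \<alpha>_p \<beta>_p lam_p \<alpha>_m \<beta>_m lam_m = density lborel (\<lambda>x. ennreal (?p x + ?m (- x)))"
    unfolding ts_levy_measure_def
    by (rule density_cong) (auto simp: ts_density_def indicator_def)
  then have "(CLINT x|ts_levy_measure \<alpha>_p \<beta>_p lam_p \<alpha>_m \<beta>_m lam_m. ?e x)
      = (CLINT x|lborel. (?p x + ?m (- x)) *\<^sub>R ?e x)"
    by (simp only:) (rule integral_density, use p m in \<open>auto simp: ts_density_nonneg\<close>)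
  also have "\<dots> = (CLINT x|lborel. - ?fp x - ?fm (0 + (- 1) * x))"
    by (rule Bochner_Integration.integral_cong) (simp_all add: algebra_simps)
  also have "\<dots> = - (CLINT x|lborel. ?fp x) - (CLINT x|lborel. ?fm (0 + (- 1) * x))"
    using fp fm by (subst Bochner_Integration.integral_diff) simp_all
  also have "(CLINT x|lborel. ?fm (0 + (- 1) * x)) = (CLINT x|lborel. ?fm x)"
    using lborel_integral_real_affine[of "-1" ?fm 0] by simp
  also have "(CLINT x|lborel. ?fp x) = laplace_exponent (ts_jumps \<alpha>_p \<beta>_p lam_p) (- \<i> * of_real z)"
    by (rule LE(2)[symmetric]) (use p in auto)
  also have "(CLINT x|lborel. ?fm x) = laplace_exponent (ts_jumps \<alpha>_m \<beta>_m lam_m) (\<i> * of_real z)"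
    by (rule LE(2)[symmetric]) (use m in auto)
  finally show ?thesis by simp
qed

definition grid_increment :: "(real \<Rightarrow> 'a \<Rightarrow> real) \<Rightarrow> nat \<Rightarrow> nat \<Rightarrow> 'a \<Rightarrow> real" where
  "grid_increment X n i \<omega> = X (real (Suc i) / 2 ^ n) \<omega> - X (real i / 2 ^ n) \<omega>"

lemma sum_grid_increment:
  "(\<Sum>i<k. grid_increment X n i \<omega>) = X (real k / 2 ^ n) \<omega> - X 0 \<omega>"
  unfolding grid_increment_def
  using sum_lessThan_telescope[of "\<lambda>i. X (real i / 2 ^ n) \<omega>" k] by simp

context levy_process
begin

lemma grid_increment_measurable [measurable]: "random_variable borel (grid_increment X n i)"
  unfolding grid_increment_def[abs_def] using random_variable by simp

lemma indep_grid_increments: "indep_vars (\<lambda>_. borel) (grid_increment X n) {..<N}"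
proof -
  have "mono_on {..N} (\<lambda>i. real i / 2 ^ n)" by (auto intro!: mono_onI divide_right_mono)
  from independent_increments[OF _ this] show ?thesis
    by (simp add: grid_increment_def[abs_def])
qed

lemma distr_grid_increment: "distr M borel (grid_increment X n i) = distr M borel (X (1 / 2 ^ n))"
proof -
  have "distr M borel (\<lambda>\<omega>. X (real (Suc i) / 2 ^ n) \<omega> - X (real i / 2 ^ n) \<omega>)
      = distr M borel (X (real (Suc i) / 2 ^ n - real i / 2 ^ n))"
    by (rule stationary_increments) (auto intro: divide_right_mono)
  then show ?thesis
    by (simp add: grid_increment_def[abs_def] diff_divide_distrib[symmetric] del: of_nat_Suc)
      (simp add: of_nat_Suc)
qed

lemma distr_grid_increments:
  assumes "0 < N"
  shows "distr M (PiM {..<N} (\<lambda>_. borel)) (\<lambda>\<omega>. \<lambda>i\<in>{..<N}. grid_increment X n i \<omega>)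
    = PiM {..<N} (\<lambda>_. distr M borel (X (1 / 2 ^ n)))"
proof -
  have "{..<N} \<noteq> {}" using assms by (auto simp: lessThan_empty_iff)
  then have "distr M (PiM {..<N} (\<lambda>_. borel)) (\<lambda>\<omega>. \<lambda>i\<in>{..<N}. grid_increment X n i \<omega>)
      = PiM {..<N} (\<lambda>i. distr M borel (grid_increment X n i))"
    using indep_vars_iff_distr_eq_PiM[where I = "{..<N}" and M' = "\<lambda>_. borel"
        and X = "grid_increment X n"] indep_grid_increments
    by simp
  then show ?thesis by (simp add: distr_grid_increment)
qed

text \<open>\<open>X 1\<close> is the sum of \<open>2 ^ n\<close> independent increments with the
  same law, apart from the starting value, which vanishes only almost surely.\<close>

lemma char_dyadic_power:
  "char (distr M borel (X (1 / 2 ^ n))) z ^ (2 ^ n) = char (distr M borel (X 1)) z"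
proof -
  have "distr M borel (X 1) = distr M borel (\<lambda>\<omega>. \<Sum>i<2 ^ n. grid_increment X n i \<omega>)"
  proof (rule distr_cong_AE)
    show "AE \<omega> in M. X 1 \<omega> = (\<Sum>i<2 ^ n. grid_increment X n i \<omega>)"
      using start_zero by eventually_elim (simp add: sum_grid_increment)
  qed (use random_variable in auto)
  then have "char (distr M borel (X 1)) z = (\<Prod>i<(2::nat) ^ n. char (distr M borel (grid_increment X n i)) z)"
    using char_distr_sum[OF indep_grid_increments] by simp
  then show ?thesis by (simp add: distr_grid_increment)
qed

end

text \<open>The prescribed law at time 1 is the \<open>2 ^ n\<close>-fold convolution power of the
  step law, so the step law has to be recovered by extracting a root. The candidate on the
  right-hand side has a characteristic function without zeros, which permits forming the quotient of
  the two.\<close>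

theorem ts_increment_law:
  assumes p: "0 < \<alpha>_p" "\<beta>_p \<in> {0..<1}" "0 < lam_p"
    and m: "0 < \<alpha>_m" "\<beta>_m \<in> {0..<1}" "0 < lam_m"
    and X: "tempered_stable_process M X \<alpha>_p \<beta>_p lam_p \<alpha>_m \<beta>_m lam_m"
    and \<mu>: "subordinator_law (ts_jumps \<alpha>_p \<beta>_p lam_p) (1 / 2 ^ n) \<mu>"
    and \<nu>: "subordinator_law (ts_jumps \<alpha>_m \<beta>_m lam_m) (1 / 2 ^ n) \<nu>"
  shows "distr M borel (X (1 / 2 ^ n)) = distr (\<mu> \<Otimes>\<^sub>M \<nu>) borel (\<lambda>(x, y). x - y)"
proof -
  interpret levy_process M X using X by (simp add: tempered_stable_process_def)
  note L = has_laplaceD[OF \<mu>[unfolded subordinator_law_def]]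
    and L' = has_laplaceD[OF \<nu>[unfolded subordinator_law_def]]
  note [measurable_cong] = L(2) L'(2)
  interpret \<mu>: prob_space \<mu> by (rule L)
  interpret \<nu>: prob_space \<nu> by (rule L')
  interpret P: pair_prob_space \<mu> \<nu> ..
  let ?D = "distr M borel (X (1 / 2 ^ n))" and ?E = "distr (\<mu> \<Otimes>\<^sub>M \<nu>) borel (\<lambda>(x, y). x - y)"
  interpret D: real_distribution ?D by (rule real_distribution_distr) (use random_variable in simp)
  interpret E: real_distribution ?E by (rule P.real_distribution_distr) simp
  let ?r = "\<lambda>z. char ?D z / char ?E z"
  define \<psi> where "\<psi> z = - (laplace_exponent (ts_jumps \<alpha>_p \<beta>_p lam_p) (- \<i> * of_real z)
       + laplace_exponent (ts_jumps \<alpha>_m \<beta>_m lam_m) (\<i> * of_real z))" for z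
  have charE: "char ?E z = exp (\<psi> z / 2 ^ n)" for z
    unfolding char_subordinator_difference[OF \<mu> \<nu>] \<psi>_def
    by (simp add: minus_divide_left)
  have powE: "char ?E z ^ (2 ^ n) = exp (\<psi> z)" for z
    unfolding charE by (simp add: exp_of_nat_mult[symmetric])
  have powD: "char ?D z ^ (2 ^ n) = exp (\<psi> z)" for z
    using X char_dyadic_power[of n z] ts_levy_exponent[OF p m]
    by (simp add: tempered_stable_process_def tempered_stable_distribution_def \<psi>_def)
  \<comment> \<open>Both functions are \<open>2 ^ n\<close>-th roots of the same function; continuity selects the same branch.\<close>
  have "?r constant_on UNIV"
  proof (rule continuous_finite_range_constant)
    show "continuous_on UNIV ?r"
      by (intro continuous_on_divide continuous_at_imp_continuous_on ballI D.isCont_char E.isCont_char)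
        (simp add: charE)
    have "range ?r \<subseteq> {w. w ^ (2 ^ n) = 1}"
      by (auto simp: power_divide powD powE)
    then show "finite (range ?r)"
      by (rule finite_subset) (rule finite_roots_unity, simp)
  qed simp
  then obtain c where c: "\<And>z. ?r z = c" by (auto simp: constant_on_def)
  moreover have "?r 0 = 1" by (simp add: D.char_zero E.char_zero)
  ultimately have "?r z = 1" for z by metis
  then have "char ?D = char ?E"
    by (intro ext) (simp add: charE)
  then show ?thesis
    by (intro Levy_uniqueness D.real_distribution_axioms E.real_distribution_axioms)
qed

section \<open>Finite product measures: densities, images and means of sums\<close>

lemma density_PiM:
  assumes I: "finite I" and "prob_space \<kappa>" and [measurable]: "g \<in> borel_measurable \<kappa>"
    and "prob_space (density \<kappa> g)"
  shows "density (PiM I (\<lambda>_. \<kappa>)) (\<lambda>\<omega>. \<Prod>i\<in>I. g (\<omega> i)) = PiM I (\<lambda>_. density \<kappa> g)"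
proof -
  interpret \<kappa>: prob_space \<kappa> by fact
  interpret \<kappa>': prob_space "density \<kappa> g" by fact
  interpret P: product_sigma_finite "\<lambda>_. \<kappa>" by standard
  interpret P': product_sigma_finite "\<lambda>_. density \<kappa> g" by standard
  show ?thesis
  proof (rule P'.PiM_eqI[OF I])
    show "sets (density (PiM I (\<lambda>_. \<kappa>)) (\<lambda>\<omega>. \<Prod>i\<in>I. g (\<omega> i))) = sets (PiM I (\<lambda>_. density \<kappa> g))"
      by (simp cong: sets_PiM_cong)
    fix A assume "\<And>i. i \<in> I \<Longrightarrow> A i \<in> sets (density \<kappa> g)"
    then have A [measurable]: "\<And>i. i \<in> I \<Longrightarrow> A i \<in> sets \<kappa>" by simp
    have "emeasure (density (PiM I (\<lambda>_. \<kappa>)) (\<lambda>\<omega>. \<Prod>i\<in>I. g (\<omega> i))) (Pi\<^sub>E I A)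
        = (\<integral>\<^sup>+\<omega>. (\<Prod>i\<in>I. g (\<omega> i)) * indicator (Pi\<^sub>E I A) \<omega> \<partial>PiM I (\<lambda>_. \<kappa>))"
      using I by (intro emeasure_density) (auto intro!: sets_PiM_I_finite)
    also have "\<dots> = (\<integral>\<^sup>+\<omega>. (\<Prod>i\<in>I. g (\<omega> i) * indicator (A i) (\<omega> i)) \<partial>PiM I (\<lambda>_. \<kappa>))"
    proof (rule nn_integral_cong)
      fix \<omega> assume "\<omega> \<in> space (PiM I (\<lambda>_. \<kappa>))"
      then have "indicator (Pi\<^sub>E I A) \<omega> = (\<Prod>i\<in>I. indicator (A i) (\<omega> i) :: ennreal)"
        using I by (auto simp: space_PiM PiE_iff indicator_def)
      then show "(\<Prod>i\<in>I. g (\<omega> i)) * indicator (Pi\<^sub>E I A) \<omega> = (\<Prod>i\<in>I. g (\<omega> i) * indicator (A i) (\<omega> i))"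
        by (simp add: prod.distrib)
    qed
    also have "\<dots> = (\<Prod>i\<in>I. \<integral>\<^sup>+x. g x * indicator (A i) x \<partial>\<kappa>)"
      by (rule P.product_nn_integral_prod[OF I]) (use A in auto)
    also have "\<dots> = (\<Prod>i\<in>I. emeasure (density \<kappa> g) (A i))"
      by (rule prod.cong) (use A in \<open>auto simp: emeasure_density\<close>)
    finally show "emeasure (density (PiM I (\<lambda>_. \<kappa>)) (\<lambda>\<omega>. \<Prod>i\<in>I. g (\<omega> i))) (Pi\<^sub>E I A)
        = (\<Prod>i\<in>I. emeasure (density \<kappa> g) (A i))" .
  qed
qed

lemma PiM_distr:
  assumes I: "finite I" and \<kappa>: "prob_space \<kappa>" and f [measurable]: "f \<in> measurable \<kappa> N"
  shows "PiM I (\<lambda>_. distr \<kappa> N f) = distr (PiM I (\<lambda>_. \<kappa>)) (PiM I (\<lambda>_. N)) (\<lambda>\<omega>. \<lambda>i\<in>I. f (\<omega> i))"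
proof -
  let ?D = "distr \<kappa> N f"
  have "distr (PiM I (\<lambda>_. \<kappa>)) (PiM I (\<lambda>_. ?D)) (compose I f) = PiM I (\<lambda>_. distr \<kappa> ?D f)"
    by (rule distr_PiM_finite_prob_space'[OF I])
      (use \<kappa> in \<open>auto intro: prob_space.prob_space_distr\<close>)
  also have "distr \<kappa> ?D f = ?D" by (rule distr_cong) auto
  also have "distr (PiM I (\<lambda>_. \<kappa>)) (PiM I (\<lambda>_. ?D)) (compose I f)
      = distr (PiM I (\<lambda>_. \<kappa>)) (PiM I (\<lambda>_. N)) (\<lambda>\<omega>. \<lambda>i\<in>I. f (\<omega> i))"
    by (rule distr_cong) (auto simp: compose_def cong: sets_PiM_cong)
  finally show ?thesis by simp
qed

lemma nn_integral_PiM_sum: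
  assumes I: "finite I" and \<kappa>: "prob_space \<kappa>" and f [measurable]: "f \<in> borel_measurable \<kappa>"
  shows "(\<integral>\<^sup>+\<omega>. (\<Sum>i\<in>I. f (\<omega> i)) \<partial>PiM I (\<lambda>_. \<kappa>)) = of_nat (card I) * (\<integral>\<^sup>+x. f x \<partial>\<kappa>)"
proof -
  have "(\<integral>\<^sup>+\<omega>. f (\<omega> i) \<partial>PiM I (\<lambda>_. \<kappa>)) = (\<integral>\<^sup>+x. f x \<partial>\<kappa>)" if "i \<in> I" for i
  proof -
    have "(\<integral>\<^sup>+x. f x \<partial>\<kappa>) = (\<integral>\<^sup>+x. f x \<partial>distr (PiM I (\<lambda>_. \<kappa>)) \<kappa> (\<lambda>\<omega>. \<omega> i))"
      using distr_PiM_component[of I "\<lambda>_. \<kappa>" i] \<kappa> that by simp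
    also have "\<dots> = (\<integral>\<^sup>+\<omega>. f (\<omega> i) \<partial>PiM I (\<lambda>_. \<kappa>))"
      by (rule nn_integral_distr) (use that in auto)
    finally show ?thesis by simp
  qed
  then show ?thesis by (subst nn_integral_sum) auto
qed

text \<open>The constants depend on \<open>N\<close> and \<open>s\<close> only through
  \<open>T = N * s\<close>. This makes the bound uniform over all refinements of the grid.\<close>

lemma grid_domination:
  assumes F: "jump_measure F" and G: "jump_measure G"
    and \<mu>: "subordinator_law F s \<mu>" and \<nu>: "subordinator_law G s \<nu>"
    and s: "0 \<le> s" and T: "T = real N * s" and R: "0 < R"
    and nonneg: "0 \<le> a1" "0 \<le> b1" "0 \<le> a2" "0 \<le> b2"
    and B: "B \<in> sets (PiM {..<N} (\<lambda>_. borel))"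
  defines "tilt a b \<equiv> density \<mu> (\<lambda>x. ennreal (exp (s * bernstein F a - a * x)))
      \<Otimes>\<^sub>M density \<nu> (\<lambda>y. ennreal (exp (s * bernstein G b - b * y)))"
  defines "law a b \<equiv> PiM {..<N} (\<lambda>_. distr (tilt a b) borel (\<lambda>(x, y). x - y))"
  shows "emeasure (law a2 b2) B
    \<le> ennreal (exp (T * (bernstein F a2 + bernstein G b2 - bernstein F a1 - bernstein G b1)
          + (\<bar>a1 - a2\<bar> + \<bar>b1 - b2\<bar>) * R)) * emeasure (law a1 b1) B
      + ennreal (exp (T * (bernstein F a2 + bernstein G b2))
          * (T * (jump_measure.mean F + jump_measure.mean G) / R))"
proof -
  interpret F: jump_measure F by (rule F)
  interpret G: jump_measure G by (rule G)
  note L = has_laplaceD[OF \<mu>[unfolded subordinator_law_def]]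
    and L' = has_laplaceD[OF \<nu>[unfolded subordinator_law_def]]
  note [measurable_cong] = L(2) L'(2)
  interpret \<mu>: prob_space \<mu> by (rule L)
  interpret \<nu>: prob_space \<nu> by (rule L')
  interpret P: pair_prob_space \<mu> \<nu> ..
  let ?\<kappa> = "\<mu> \<Otimes>\<^sub>M \<nu>" and ?I = "{..<N}"
  let ?\<Pi> = "PiM ?I (\<lambda>_. ?\<kappa>)"
  define C where "C a b = bernstein F a + bernstein G b" for a b
  define S where "S \<omega> = (\<Sum>i<N. fst (\<omega> i) :: real)" for \<omega> :: "nat \<Rightarrow> real \<times> real"
  define S' where "S' \<omega> = (\<Sum>i<N. snd (\<omega> i) :: real)" for \<omega> :: "nat \<Rightarrow> real \<times> real"
  define D where "D = (\<lambda>\<omega>. \<lambda>i\<in>?I. (\<lambda>(x, y). x - y) (\<omega> i) :: real)"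
  have tilt_density: "tilt a b = density ?\<kappa> (\<lambda>z. ennreal (exp (s * C a b - a * fst z - b * snd z)))"
    and tilt_prob: "prob_space (tilt a b)" if "0 \<le> a" "0 \<le> b" for a b
  proof -
    note 1 = has_laplaceD(1)[OF F.subordinator_law_tilt[OF \<mu> that(1), unfolded subordinator_law_def]]
    note 2 = has_laplaceD(1)[OF G.subordinator_law_tilt[OF \<nu> that(2), unfolded subordinator_law_def]]
    interpret a: prob_space "density \<mu> (\<lambda>x. ennreal (exp (s * bernstein F a - a * x)))" by (rule 1)
    interpret b: prob_space "density \<nu> (\<lambda>y. ennreal (exp (s * bernstein G b - b * y)))" by (rule 2)
    interpret ab: pair_prob_space "density \<mu> (\<lambda>x. ennreal (exp (s * bernstein F a - a * x)))"
      "density \<nu> (\<lambda>y. ennreal (exp (s * bernstein G b - b * y)))" ..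
    show "prob_space (tilt a b)" unfolding tilt_def by (rule ab.prob_space_axioms)
    have "tilt a b = density ?\<kappa> (\<lambda>(x, y). ennreal (exp (s * bernstein F a - a * x))
        * ennreal (exp (s * bernstein G b - b * y)))"
      unfolding tilt_def
      by (rule pair_measure_density) (auto intro: \<nu>.sigma_finite_measure_axioms b.sigma_finite_measure_axioms)
    also have "\<dots> = density ?\<kappa> (\<lambda>z. ennreal (exp (s * C a b - a * fst z - b * snd z)))"
      by (rule density_cong)
        (auto simp: ennreal_mult[symmetric] exp_add[symmetric] C_def algebra_simps)
    finally show "tilt a b = density ?\<kappa> (\<lambda>z. ennreal (exp (s * C a b - a * fst z - b * snd z)))" .
  qed
  have D_meas [measurable]: "D \<in> measurable ?\<Pi> (PiM ?I (\<lambda>_. borel))" unfolding D_def by measurable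
  have S_meas [measurable]: "S \<in> borel_measurable ?\<Pi>" "S' \<in> borel_measurable ?\<Pi>"
    unfolding S_def[abs_def] S'_def[abs_def] by measurable
  \<comment> \<open>One pulled-back event serves all parameters \<open>a\<close> and
    \<open>b\<close>, so the two laws are compared on the same set of pair vectors, before
    differences are taken.\<close>
  define A where "A = D -` B \<inter> space ?\<Pi>"
  have A [measurable]: "A \<in> sets ?\<Pi>" unfolding A_def by (rule measurable_sets[OF D_meas B])
  have law_eq: "emeasure (law a b) B = (\<integral>\<^sup>+\<omega>. ennreal (exp (T * C a b - a * S \<omega> - b * S' \<omega>)) * indicator A \<omega> \<partial>?\<Pi>)"
    if ab: "0 \<le> a" "0 \<le> b" for a b
  proof -
    have sets_tilt: "sets (PiM ?I (\<lambda>_. tilt a b)) = sets ?\<Pi>"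
      by (rule sets_PiM_cong) (auto simp: tilt_density[OF ab])
    have "law a b = distr (PiM ?I (\<lambda>_. tilt a b)) (PiM ?I (\<lambda>_. borel)) D"
      unfolding law_def D_def
      by (rule PiM_distr, simp, rule tilt_prob[OF ab], simp add: tilt_density[OF ab])
    moreover have "D \<in> measurable (PiM ?I (\<lambda>_. tilt a b)) (PiM ?I (\<lambda>_. borel))"
      using D_meas measurable_cong_sets[OF sets_tilt refl] by blast
    ultimately have "emeasure (law a b) B = emeasure (PiM ?I (\<lambda>_. tilt a b)) A"
      using B sets_eq_imp_space_eq[OF sets_tilt] by (simp add: emeasure_distr A_def)
    also have "PiM ?I (\<lambda>_. tilt a b) = density ?\<Pi> (\<lambda>\<omega>. \<Prod>i<N. ennreal (exp (s * C a b - a * fst (\<omega> i) - b * snd (\<omega> i))))"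
      using tilt_prob[OF ab] P.prob_space_axioms unfolding tilt_density[OF ab]
      by (intro density_PiM[symmetric]) auto
    also have "emeasure \<dots> A = (\<integral>\<^sup>+\<omega>. (\<Prod>i<N. ennreal (exp (s * C a b - a * fst (\<omega> i) - b * snd (\<omega> i)))) * indicator A \<omega> \<partial>?\<Pi>)"
      by (rule emeasure_density) auto
    also have "(\<lambda>\<omega>. \<Prod>i<N. ennreal (exp (s * C a b - a * fst (\<omega> i) - b * snd (\<omega> i))))
        = (\<lambda>\<omega>. ennreal (exp (T * C a b - a * S \<omega> - b * S' \<omega>)))"
    proof
      fix \<omega> :: "nat \<Rightarrow> real \<times> real"
      have "(\<Prod>i<N. ennreal (exp (s * C a b - a * fst (\<omega> i) - b * snd (\<omega> i))))
          = ennreal (exp (\<Sum>i<N. s * C a b - a * fst (\<omega> i) - b * snd (\<omega> i)))"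
        by (simp add: prod_ennreal exp_sum)
      also have "(\<Sum>i<N. s * C a b - a * fst (\<omega> i) - b * snd (\<omega> i)) = T * C a b - a * S \<omega> - b * S' \<omega>"
        by (simp add: sum_subtractf sum_distrib_left S_def S'_def T)
      finally show "(\<Prod>i<N. ennreal (exp (s * C a b - a * fst (\<omega> i) - b * snd (\<omega> i))))
          = ennreal (exp (T * C a b - a * S \<omega> - b * S' \<omega>))" .
    qed
    finally show ?thesis .
  qed
  let ?K = "exp (T * (C a2 b2 - C a1 b1) + (\<bar>a1 - a2\<bar> + \<bar>b1 - b2\<bar>) * R)"
  let ?g = "\<lambda>z. ennreal (fst z) + ennreal (snd z)"
  have "AE z in ?\<kappa>. 0 \<le> fst z \<and> 0 \<le> snd z"
  proof (rule P.AE_pair_measure)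
    show "AE x in \<mu>. AE y in \<nu>. 0 \<le> fst (x, y) \<and> 0 \<le> snd (x, y)"
      using L(3)
    proof eventually_elim
      case (elim x)
      show ?case using L'(3) by eventually_elim (use elim in simp)
    qed
  qed simp
  then have "AE \<omega> in ?\<Pi>. 0 \<le> fst (\<omega> i) \<and> 0 \<le> snd (\<omega> i)" if "i \<in> ?I" for i
    by (rule AE_PiM_component[OF P.prob_space_axioms that])
  then have AE: "AE \<omega> in ?\<Pi>. \<forall>i\<in>?I. 0 \<le> fst (\<omega> i) \<and> 0 \<le> snd (\<omega> i)"
    by (intro AE_finite_allI) auto
  have "emeasure (law a2 b2) B = (\<integral>\<^sup>+\<omega>. ennreal (exp (T * C a2 b2 - a2 * S \<omega> - b2 * S' \<omega>)) * indicator A \<omega> \<partial>?\<Pi>)"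
    by (rule law_eq) (use nonneg in auto)
  also have "\<dots> \<le> (\<integral>\<^sup>+\<omega>. ennreal ?K * (ennreal (exp (T * C a1 b1 - a1 * S \<omega> - b1 * S' \<omega>)) * indicator A \<omega>)
      + ennreal (exp (T * C a2 b2) / R) * (\<Sum>i<N. ?g (\<omega> i)) \<partial>?\<Pi>)"
  proof (rule nn_integral_mono_AE)
    show "AE \<omega> in ?\<Pi>. ennreal (exp (T * C a2 b2 - a2 * S \<omega> - b2 * S' \<omega>)) * indicator A \<omega>
      \<le> ennreal ?K * (ennreal (exp (T * C a1 b1 - a1 * S \<omega> - b1 * S' \<omega>)) * indicator A \<omega>)
      + ennreal (exp (T * C a2 b2) / R) * (\<Sum>i<N. ?g (\<omega> i))"
      using AE
    proof eventually_elim
      case (elim \<omega>)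
      have SS: "0 \<le> S \<omega>" "0 \<le> S' \<omega>" using elim by (auto simp: S_def S'_def intro!: sum_nonneg)
      have g: "(\<Sum>i<N. ?g (\<omega> i)) = ennreal (S \<omega> + S' \<omega>)"
      proof -
        have "(\<Sum>i<N. ?g (\<omega> i)) = (\<Sum>i<N. ennreal (fst (\<omega> i) + snd (\<omega> i)))"
          by (rule sum.cong) (use elim in auto)
        also have "\<dots> = ennreal (\<Sum>i<N. fst (\<omega> i) + snd (\<omega> i))"
          by (rule sum_ennreal) (use elim in auto)
        finally show ?thesis by (simp add: S_def S'_def sum.distrib)
      qed
      show ?case
      \<comment> \<open>Up to \<open>R\<close> the density ratio is at most \<open>?K\<close>.
        Beyond \<open>R\<close> the density is at most \<open>exp (T * C a2 b2)\<close>, and the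
        extra factor \<open>(S \<omega> + S' \<omega>) / R\<close>, which then exceeds 1, prepares a
        Markov bound.\<close>
      proof (cases "S \<omega> + S' \<omega> \<le> R")
        case True
        have "(a1 - a2) * S \<omega> \<le> \<bar>a1 - a2\<bar> * R" "(b1 - b2) * S' \<omega> \<le> \<bar>b1 - b2\<bar> * R"
          using SS True by (intro mult_mono; linarith)+
        then have "T * C a2 b2 - a2 * S \<omega> - b2 * S' \<omega>
          \<le> (T * (C a2 b2 - C a1 b1) + (\<bar>a1 - a2\<bar> + \<bar>b1 - b2\<bar>) * R) + (T * C a1 b1 - a1 * S \<omega> - b1 * S' \<omega>)"
          by (simp add: algebra_simps)
        then have "exp (T * C a2 b2 - a2 * S \<omega> - b2 * S' \<omega>) \<le> ?K * exp (T * C a1 b1 - a1 * S \<omega> - b1 * S' \<omega>)"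
          by (simp only: exp_add[symmetric] exp_le_cancel_iff)
        then have "ennreal (exp (T * C a2 b2 - a2 * S \<omega> - b2 * S' \<omega>))
            \<le> ennreal ?K * ennreal (exp (T * C a1 b1 - a1 * S \<omega> - b1 * S' \<omega>))"
          by (simp add: ennreal_mult[symmetric] del: ennreal_le_iff) (rule ennreal_leI)
        then have "ennreal (exp (T * C a2 b2 - a2 * S \<omega> - b2 * S' \<omega>)) * indicator A \<omega>
            \<le> ennreal ?K * ennreal (exp (T * C a1 b1 - a1 * S \<omega> - b1 * S' \<omega>)) * indicator A \<omega>"
          by (rule mult_right_mono) simp
        then show ?thesis by (intro add_increasing2) (auto simp: mult.assoc)
      next
        case False
        have "exp (T * C a2 b2 - a2 * S \<omega> - b2 * S' \<omega>) \<le> exp (T * C a2 b2) * 1"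
          using mult_nonneg_nonneg[OF nonneg(3) SS(1)] mult_nonneg_nonneg[OF nonneg(4) SS(2)] by simp
        also have "\<dots> \<le> exp (T * C a2 b2) * ((S \<omega> + S' \<omega>) / R)"
          using False R by (intro mult_left_mono) (auto simp: field_simps)
        finally have "ennreal (exp (T * C a2 b2 - a2 * S \<omega> - b2 * S' \<omega>)) \<le> ennreal (exp (T * C a2 b2) / R * (S \<omega> + S' \<omega>))"
          by (intro ennreal_leI) simp
        also have "\<dots> = ennreal (exp (T * C a2 b2) / R) * (\<Sum>i<N. ?g (\<omega> i))"
          unfolding g by (rule ennreal_mult) (use R SS in auto)
        finally show ?thesis
          by (intro add_increasing) (auto simp: indicator_def)
      qed
    qed
  qed
  also have "\<dots> = ennreal ?K * emeasure (law a1 b1) B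
      + ennreal (exp (T * C a2 b2) / R) * (\<integral>\<^sup>+\<omega>. (\<Sum>i<N. ?g (\<omega> i)) \<partial>?\<Pi>)"
    using nonneg by (simp add: law_eq nn_integral_add nn_integral_cmult)
  also have "(\<integral>\<^sup>+\<omega>. (\<Sum>i<N. ?g (\<omega> i)) \<partial>?\<Pi>) = of_nat N * (\<integral>\<^sup>+z. ?g z \<partial>?\<kappa>)"
    by (subst nn_integral_PiM_sum) (auto intro: P.prob_space_axioms)
  also have "(\<integral>\<^sup>+z. ?g z \<partial>?\<kappa>) = (\<integral>\<^sup>+x. ennreal x \<partial>\<mu>) + (\<integral>\<^sup>+y. ennreal y \<partial>\<nu>)"
    by (subst \<nu>.nn_integral_fst[symmetric])
      (auto simp: nn_integral_add \<mu>.emeasure_space_1 \<nu>.emeasure_space_1)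
  also have "ennreal (exp (T * C a2 b2) / R) * (of_nat N * ((\<integral>\<^sup>+x. ennreal x \<partial>\<mu>) + (\<integral>\<^sup>+y. ennreal y \<partial>\<nu>)))
      \<le> ennreal (exp (T * C a2 b2) / R) * (of_nat N * (ennreal (s * F.mean) + ennreal (s * G.mean)))"
    by (intro mult_left_mono add_mono F.subordinator_mean_le[OF \<mu> s] G.subordinator_mean_le[OF \<nu> s]) auto
  also have "\<dots> = ennreal (exp (T * C a2 b2) * (T * (F.mean + G.mean) / R))"
    using s R F.mean_nonneg G.mean_nonneg
    by (simp add: ennreal_plus[symmetric] ennreal_of_nat_eq_real_of_nat ennreal_mult[symmetric] T algebra_simps add_divide_distrib
        del: ennreal_plus)
  finally show ?thesis by (simp add: C_def algebra_simps add_left_mono)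
qed

section \<open>Local absolute continuity for equal stability parameters\<close>

text \<open>Tilting with a non-negative parameter only increases \<open>lam\<close>. Both laws are
  therefore written as tilts of a common base law that has the smaller of the two tempering
  parameters on each side.\<close>

lemma ts_grid_domination:
  fixes P :: "'a measure" and Q :: "'b measure"
  assumes p: "0 < \<alpha>_p" "\<beta>_p \<in> {0..<1}" "0 < lam_p1" "0 < lam_p2"
    and m: "0 < \<alpha>_m" "\<beta>_m \<in> {0..<1}" "0 < lam_m1" "0 < lam_m2"
    and X: "tempered_stable_process P X \<alpha>_p \<beta>_p lam_p1 \<alpha>_m \<beta>_m lam_m1"
    and Y: "tempered_stable_process Q Y \<alpha>_p \<beta>_p lam_p2 \<alpha>_m \<beta>_m lam_m2"
    and T: "0 < (T :: nat)" and \<delta>: "0 < \<delta>"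
  shows "\<exists>K\<ge>0. \<forall>n. \<forall>B\<in>sets (PiM {..<T * 2 ^ n} (\<lambda>_. borel)).
    emeasure (distr Q (PiM {..<T * 2 ^ n} (\<lambda>_. borel)) (\<lambda>\<omega>. \<lambda>i\<in>{..<T * 2 ^ n}. grid_increment Y n i \<omega>)) B
    \<le> ennreal K *
      emeasure (distr P (PiM {..<T * 2 ^ n} (\<lambda>_. borel)) (\<lambda>\<omega>. \<lambda>i\<in>{..<T * 2 ^ n}. grid_increment X n i \<omega>)) B
      + ennreal \<delta>"
proof -
  define lp lm where "lp = min lam_p1 lam_p2" and "lm = min lam_m1 lam_m2"
  define F G where "F = ts_jumps \<alpha>_p \<beta>_p lp" and "G = ts_jumps \<alpha>_m \<beta>_m lm"
  define a1 a2 b1 b2 where ab_def: "a1 = lam_p1 - lp" "a2 = lam_p2 - lp" "b1 = lam_m1 - lm" "b2 = lam_m2 - lm"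
  have ab: "0 \<le> a1" "0 \<le> b1" "0 \<le> a2" "0 \<le> b2" by (auto simp: ab_def lp_def lm_def)
  have F: "jump_measure F" unfolding F_def by (rule jump_measure_ts_jumps) (use p in \<open>auto simp: lp_def\<close>)
  have G: "jump_measure G" unfolding G_def by (rule jump_measure_ts_jumps) (use m in \<open>auto simp: lm_def\<close>)
  interpret F: jump_measure F by (rule F)
  interpret G: jump_measure G by (rule G)
  \<comment> \<open>Large enough for the Markov remainder to fall below \<open>\<delta>\<close>; the
    added 1 makes \<open>R\<close> positive. Neither \<open>R\<close> nor \<open>K\<close> refers to
    the grid level \<open>n\<close> or to the event.\<close>
  define R where "R = exp (real T * (bernstein F a2 + bernstein G b2)) * (real T * (F.mean + G.mean)) / \<delta> + 1"
  have "0 \<le> R - 1" using \<delta> F.mean_nonneg G.mean_nonneg by (auto simp: R_def)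
  then have R: "0 < R" by simp
  have R_\<delta>: "exp (real T * (bernstein F a2 + bernstein G b2)) * (real T * (F.mean + G.mean) / R) \<le> \<delta>"
    using \<delta> R by (simp add: R_def field_simps)
  define K where "K = exp (real T * (bernstein F a2 + bernstein G b2 - bernstein F a1 - bernstein G b1)
    + (\<bar>a1 - a2\<bar> + \<bar>b1 - b2\<bar>) * R)"
  have "emeasure (distr Q (PiM {..<T * 2 ^ n} (\<lambda>_. borel)) (\<lambda>\<omega>. \<lambda>i\<in>{..<T * 2 ^ n}. grid_increment Y n i \<omega>)) B
    \<le> ennreal K *
      emeasure (distr P (PiM {..<T * 2 ^ n} (\<lambda>_. borel)) (\<lambda>\<omega>. \<lambda>i\<in>{..<T * 2 ^ n}. grid_increment X n i \<omega>)) B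
      + ennreal \<delta>" if B: "B \<in> sets (PiM {..<T * 2 ^ n} (\<lambda>_. borel))" for n B
  proof -
    define s :: real where "s = 1 / 2 ^ n"
    obtain \<mu> where \<mu>: "subordinator_law F s \<mu>"
      using F.subordinator_law_exists[of s] by (auto simp: subordinator_law_def s_def)
    obtain \<nu> where \<nu>: "subordinator_law G s \<nu>"
      using G.subordinator_law_exists[of s] by (auto simp: subordinator_law_def s_def)
    have law: "distr M (PiM {..<T * 2 ^ n} (\<lambda>_. borel)) (\<lambda>\<omega>. \<lambda>i\<in>{..<T * 2 ^ n}. grid_increment Z n i \<omega>)
      = PiM {..<T * 2 ^ n} (\<lambda>_. distr (density \<mu> (\<lambda>x. ennreal (exp (s * bernstein F a - a * x)))
        \<Otimes>\<^sub>M density \<nu> (\<lambda>y. ennreal (exp (s * bernstein G b - b * y)))) borel (\<lambda>(x, y). x - y))"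
      if Z: "tempered_stable_process M Z \<alpha>_p \<beta>_p (lp + a) \<alpha>_m \<beta>_m (lm + b)"
        and "0 \<le> a" "0 \<le> b" "0 < lp + a" "0 < lm + b"
      for M :: "'c measure" and Z a b
    proof -
      interpret levy_process M Z using Z by (simp add: tempered_stable_process_def)
      have "distr M borel (Z (1 / 2 ^ n)) = distr (density \<mu> (\<lambda>x. ennreal (exp (s * bernstein F a - a * x)))
        \<Otimes>\<^sub>M density \<nu> (\<lambda>y. ennreal (exp (s * bernstein G b - b * y)))) borel (\<lambda>(x, y). x - y)"
      proof (rule ts_increment_law[OF p(1,2) _ m(1,2) _ Z])
        show "subordinator_law (ts_jumps \<alpha>_p \<beta>_p (lp + a)) (1 / 2 ^ n)
            (density \<mu> (\<lambda>x. ennreal (exp (s * bernstein F a - a * x))))"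
          using F.subordinator_law_tilt[OF \<mu> that(2)] ts_jumps_tilt[OF p(1), of \<beta>_p lp a]
          by (simp add: F_def s_def)
        show "subordinator_law (ts_jumps \<alpha>_m \<beta>_m (lm + b)) (1 / 2 ^ n)
            (density \<nu> (\<lambda>y. ennreal (exp (s * bernstein G b - b * y))))"
          using G.subordinator_law_tilt[OF \<nu> that(3)] ts_jumps_tilt[OF m(1), of \<beta>_m lm b]
          by (simp add: G_def s_def)
      qed fact+
      then show ?thesis using distr_grid_increments[of "T * 2 ^ n" n] T by simp
    qed
    have lawP: "distr P (PiM {..<T * 2 ^ n} (\<lambda>_. borel)) (\<lambda>\<omega>. \<lambda>i\<in>{..<T * 2 ^ n}. grid_increment X n i \<omega>)
      = PiM {..<T * 2 ^ n} (\<lambda>_. distr (density \<mu> (\<lambda>x. ennreal (exp (s * bernstein F a1 - a1 * x)))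
        \<Otimes>\<^sub>M density \<nu> (\<lambda>y. ennreal (exp (s * bernstein G b1 - b1 * y)))) borel (\<lambda>(x, y). x - y))"
      by (rule law) (use X p m ab in \<open>auto simp: ab_def\<close>)
    have lawQ: "distr Q (PiM {..<T * 2 ^ n} (\<lambda>_. borel)) (\<lambda>\<omega>. \<lambda>i\<in>{..<T * 2 ^ n}. grid_increment Y n i \<omega>)
      = PiM {..<T * 2 ^ n} (\<lambda>_. distr (density \<mu> (\<lambda>x. ennreal (exp (s * bernstein F a2 - a2 * x)))
        \<Otimes>\<^sub>M density \<nu> (\<lambda>y. ennreal (exp (s * bernstein G b2 - b2 * y)))) borel (\<lambda>(x, y). x - y))"
      by (rule law) (use Y p m ab in \<open>auto simp: ab_def\<close>)
    have "real T = real (T * 2 ^ n) * s" by (simp add: s_def)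
    from grid_domination[OF F G \<mu> \<nu> _ this R ab B] have
      "emeasure (distr Q (PiM {..<T * 2 ^ n} (\<lambda>_. borel)) (\<lambda>\<omega>. \<lambda>i\<in>{..<T * 2 ^ n}. grid_increment Y n i \<omega>)) B
      \<le> ennreal K *
        emeasure (distr P (PiM {..<T * 2 ^ n} (\<lambda>_. borel)) (\<lambda>\<omega>. \<lambda>i\<in>{..<T * 2 ^ n}. grid_increment X n i \<omega>)) B
        + ennreal (exp (real T * (bernstein F a2 + bernstein G b2)) * (real T * (F.mean + G.mean) / R))"
      unfolding lawP lawQ K_def by (simp add: s_def)
    also have "\<dots> \<le> ennreal K *
        emeasure (distr P (PiM {..<T * 2 ^ n} (\<lambda>_. borel)) (\<lambda>\<omega>. \<lambda>i\<in>{..<T * 2 ^ n}. grid_increment X n i \<omega>)) B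
        + ennreal \<delta>"
      using R_\<delta> by (intro add_left_mono ennreal_leI)
    finally show ?thesis .
  qed
  moreover have "0 \<le> K" by (simp add: K_def)
  ultimately show ?thesis by blast
qed

text \<open>One approximant has to serve both measures, because the domination compares
  \<open>P\<close> and \<open>Q\<close> on the same grid event. The class of sets that can be
  approximated in this joint sense is closed under complements and countable unions.\<close>

lemma approximation_by_algebra:
  assumes alg: "algebra \<Omega> \<A>"
    and P: "finite_measure P" "\<A> \<subseteq> sets P" and Q: "finite_measure Q" "\<A> \<subseteq> sets Q"
    and sp: "space P = \<Omega>" "space Q = \<Omega>"
    and A: "A \<in> sigma_sets \<Omega> \<A>" and "0 < (e :: real)"
  shows "\<exists>A'\<in>\<A>. measure P ((A - A') \<union> (A' - A)) < e \<and> measure Q ((A - A') \<union> (A' - A)) < e"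
  using A \<open>0 < e\<close>
proof (induction A arbitrary: e rule: sigma_sets.induct)
  case (Basic A)
  then show ?case by (intro bexI[of _ A]) auto
next
  case Empty
  then show ?case using alg[unfolded algebra_iff_Un] by (intro bexI[of _ "{}"]) auto
next
  case (Compl A)
  then obtain A' where A': "A' \<in> \<A>" "measure P ((A - A') \<union> (A' - A)) < e" "measure Q ((A - A') \<union> (A' - A)) < e"
    by blast
  have "A \<subseteq> \<Omega>" "A' \<subseteq> \<Omega>"
    using Compl.hyps A'(1) sigma_sets_into_sp[of \<A> \<Omega>] alg[unfolded algebra_iff_Un] by auto
  then have "((\<Omega> - A) - (\<Omega> - A')) \<union> ((\<Omega> - A') - (\<Omega> - A)) = (A - A') \<union> (A' - A)" by auto
  then show ?case using A' alg[unfolded algebra_iff_Un] by (intro bexI[of _ "\<Omega> - A'"]) auto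
next
  case (Union A)
  interpret P: finite_measure P by (rule P)
  interpret Q: finite_measure Q by (rule Q)
  interpret algebra \<Omega> \<A> by (rule alg)
  have sets_P: "sigma_sets \<Omega> \<A> \<subseteq> sets P" using sets.sigma_sets_subset[OF P(2)] sp by simp
  have sets_Q: "sigma_sets \<Omega> \<A> \<subseteq> sets Q" using sets.sigma_sets_subset[OF Q(2)] sp by simp
  define U where "U = (\<Union>i. A i)"
  have lim: "\<exists>n0. \<forall>n\<ge>n0. measure M (U - (\<Union>i<n. A i)) < e / 2"
    if M: "finite_measure M" "sigma_sets \<Omega> \<A> \<subseteq> sets M" for M
  proof -
    interpret finite_measure M by (rule M)
    have "(\<lambda>n. measure M (U - (\<Union>i<n. A i))) \<longlonglongrightarrow> measure M (\<Inter>n. U - (\<Union>i<n. A i))"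
    proof (rule finite_Lim_measure_decseq)
      show "range (\<lambda>n. U - (\<Union>i<n. A i)) \<subseteq> sets M"
        using Union.hyps M(2) by (auto simp: U_def)
      show "decseq (\<lambda>n. U - (\<Union>i<n. A i))" by (auto simp: decseq_def)
    qed
    moreover have "(\<Inter>n. U - (\<Union>i<n. A i)) = {}" by (auto simp: U_def)
    ultimately have "(\<lambda>n. measure M (U - (\<Union>i<n. A i))) \<longlonglongrightarrow> 0"
      by (simp only: measure_empty)
    then have "\<forall>\<^sub>F n in sequentially. measure M (U - (\<Union>i<n. A i)) < e / 2"
      by (rule order_tendstoD) (use Union.prems in simp)
    then show ?thesis by (simp add: eventually_sequentially)
  qed
  obtain n1 n2 where "\<forall>n\<ge>n1. measure P (U - (\<Union>i<n. A i)) < e / 2"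
    "\<forall>n\<ge>n2. measure Q (U - (\<Union>i<n. A i)) < e / 2"
    using lim[OF P(1) sets_P] lim[OF Q(1) sets_Q] by blast
  then obtain n where n: "measure P (U - (\<Union>i<n. A i)) < e / 2" "measure Q (U - (\<Union>i<n. A i)) < e / 2"
    by (metis max.cobounded1 max.cobounded2)
  \<comment> \<open>Truncating the union costs less than \<open>e / 2\<close> under each measure,
    and \<open>n\<close> errors of size \<open>d\<close> add up to at most \<open>e / 2\<close>. The
    1 in the denominator covers \<open>n = 0\<close>.\<close>
  define d where "d = e / (2 * (real n + 1))"
  have d: "0 < d" using Union.prems by (simp add: d_def)
  have nd: "real n * d \<le> e / 2" using Union.prems by (simp add: d_def field_simps)
  have "\<exists>A'. \<forall>i. A' i \<in> \<A> \<and> measure P ((A i - A' i) \<union> (A' i - A i)) < d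
      \<and> measure Q ((A i - A' i) \<union> (A' i - A i)) < d"
    using Union.IH[OF d] by (intro choice) blast
  then obtain A' where A': "\<And>i. A' i \<in> \<A>" "\<And>i. measure P ((A i - A' i) \<union> (A' i - A i)) < d"
      "\<And>i. measure Q ((A i - A' i) \<union> (A' i - A i)) < d"
    by blast
  define U' where "U' = (\<Union>i<n. A' i)"
  have U': "U' \<in> \<A>" unfolding U'_def using A'(1) by (intro finite_UN) auto
  have bound: "measure M ((U - U') \<union> (U' - U)) < e"
    if M: "finite_measure M" "sigma_sets \<Omega> \<A> \<subseteq> sets M"
      and *: "measure M (U - (\<Union>i<n. A i)) < e / 2" "\<And>i. measure M ((A i - A' i) \<union> (A' i - A i)) < d" for M
  proof -
    interpret finite_measure M by (rule M)
    have A_M: "A i \<in> sets M" "A' i \<in> sets M" for i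
      using Union.hyps A'(1) M(2) by (auto intro: sigma_sets.Basic)
    have U_M: "U \<in> sets M" unfolding U_def using A_M by auto
    let ?D = "\<lambda>i. (A i - A' i) \<union> (A' i - A i)"
    have "measure M ((U - U') \<union> (U' - U)) \<le> measure M ((U - (\<Union>i<n. A i)) \<union> (\<Union>i<n. ?D i))"
      by (rule finite_measure_mono) (use A_M U_M in \<open>auto simp: U_def U'_def\<close>)
    also have "\<dots> \<le> measure M (U - (\<Union>i<n. A i)) + measure M (\<Union>i<n. ?D i)"
      by (rule measure_Un_le) (use A_M U_M in auto)
    also have "measure M (\<Union>i<n. ?D i) \<le> (\<Sum>i<n. measure M (?D i))"
      by (rule finite_measure_subadditive_finite) (use A_M in auto)
    also have "\<dots> \<le> real n * d"
      using sum_bounded_above[of "{..<n}" "\<lambda>i. measure M (?D i)" d] *(2) by (auto simp: less_imp_le)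
    finally show ?thesis using *(1) nd by linarith
  qed
  show ?case
    using bound[OF P(1) sets_P n(1) A'(2)] bound[OF Q(1) sets_Q n(2) A'(3)] U'
    by (intro bexI[of _ U']) (auto simp: U_def)
qed

section \<open>Grid events and the path filtration\<close>

definition dyadic_grid :: "nat \<Rightarrow> nat \<Rightarrow> real set" where
  "dyadic_grid T n = (\<lambda>k. real k / 2 ^ n) ` {..T * 2 ^ n}"

lemma dyadic_grid_mono: "n \<le> n' \<Longrightarrow> dyadic_grid T n \<subseteq> dyadic_grid T n'"
proof (rule subsetI)
  fix x assume "n \<le> n'" "x \<in> dyadic_grid T n"
  then obtain k where k: "k \<le> T * 2 ^ n" "x = real k / 2 ^ n" by (auto simp: dyadic_grid_def)
  have pow: "(2 :: nat) ^ n' = 2 ^ n * 2 ^ (n' - n)" "(2 :: real) ^ n' = 2 ^ n * 2 ^ (n' - n)"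
    using \<open>n \<le> n'\<close> by (simp_all add: power_add[symmetric])
  have "k * 2 ^ (n' - n) \<le> T * 2 ^ n'" using k(1) by (simp add: pow)
  moreover have "x = real (k * 2 ^ (n' - n)) / 2 ^ n'" using k(2) by (simp add: pow)
  ultimately show "x \<in> dyadic_grid T n'" unfolding dyadic_grid_def by blast
qed

lemma coord_algebra_mono: "S \<subseteq> S' \<Longrightarrow> sets (coord_algebra S) \<subseteq> sets (coord_algebra S')"
  unfolding sets_coord_algebra by (rule sigma_sets_mono') auto

lemma coord_algebra_generator:
  assumes "s \<in> S" "B \<in> sets borel"
  shows "canonical_process s -` B \<inter> cadlag_paths \<in> sets (coord_algebra S)"
  unfolding sets_coord_algebra using assms by (auto intro!: sigma_sets.Basic)

text \<open>The grids are nested, so a finite operation takes place at a common level. Countably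
  many events may require unbounded levels, which is why grid events reach the full
  \<open>\<sigma>\<close>-algebra only by approximation.\<close>

lemma algebra_dyadic:
  "algebra cadlag_paths (\<Union>n. sets (coord_algebra (dyadic_grid T n)))"
  unfolding algebra_iff_Un
proof (intro conjI ballI)
  let ?A = "\<lambda>n. sets (coord_algebra (dyadic_grid T n))"
  show "(\<Union>n. ?A n) \<subseteq> Pow cadlag_paths"
    using sets.space_closed by (force simp: space_coord_algebra)
  show "{} \<in> (\<Union>n. ?A n)" by auto
  fix a assume a: "a \<in> (\<Union>n. ?A n)"
  then obtain n where n: "a \<in> ?A n" by auto
  then show "cadlag_paths - a \<in> (\<Union>n. ?A n)"
    using sets.compl_sets[of a "coord_algebra (dyadic_grid T n)"] by (auto simp: space_coord_algebra)
  fix b assume "b \<in> (\<Union>n. ?A n)"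
  then obtain n' where n': "b \<in> ?A n'" by auto
  have "a \<in> ?A (max n n')" "b \<in> ?A (max n n')"
    using n n' coord_algebra_mono[OF dyadic_grid_mono[of n "max n n'" T]]
      coord_algebra_mono[OF dyadic_grid_mono[of n' "max n n'" T]] by auto
  then show "a \<union> b \<in> (\<Union>n. ?A n)" by blast
qed

text \<open>By right-continuity, \<open>X\<^sub>t\<close> is the limit of the values at \<open>d n\<close>, the first grid point after \<open>t\<close>.\<close>

lemma path_filtration_generated_by_dyadics:
  "sets (path_filtration (real T)) \<subseteq> sigma_sets cadlag_paths (\<Union>n. sets (coord_algebra (dyadic_grid T n)))"
proof -
  let ?G = "\<Union>n. sets (coord_algebra (dyadic_grid T n))"
  define G where "G = sigma cadlag_paths ?G"
  have Pow: "?G \<subseteq> Pow cadlag_paths" using algebra_dyadic by (auto simp: algebra_iff_Un)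
  have sets_G: "sets G = sigma_sets cadlag_paths ?G" and space_G: "space G = cadlag_paths"
    unfolding G_def using Pow by (auto intro: sets_measure_of space_measure_of)
  have grid: "canonical_process s \<in> borel_measurable G" if "s \<in> dyadic_grid T n" for s n
  proof (rule measurableI)
    fix B :: "real set" assume "B \<in> sets borel"
    then have "canonical_process s -` B \<inter> cadlag_paths \<in> ?G"
      using coord_algebra_generator[OF that] by blast
    then show "canonical_process s -` B \<inter> space G \<in> sets G"
      unfolding sets_G space_G by (rule sigma_sets.Basic)
  qed simp
  have meas: "canonical_process t \<in> borel_measurable G" if t: "t \<in> {0..real T}" for t
  proof (cases "t = real T")
    \<comment> \<open>Right-continuity cannot reach \<open>T\<close> from within
      \<open>[0, T]\<close>, but \<open>T\<close> is itself a grid point.\<close>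
    case True
    then have "t \<in> dyadic_grid T 0" by (auto simp: dyadic_grid_def)
    then show ?thesis by (rule grid)
  next
    case False
    \<comment> \<open>Floor plus one rather than ceiling: \<open>d n\<close> must exceed
      \<open>t\<close> strictly, even when \<open>t\<close> is a grid point, in order to converge in
      \<open>at_right t\<close>. Since \<open>t < T\<close>, it does not overshoot
      \<open>T\<close>.\<close>
    define k where "k n = nat \<lfloor>t * 2 ^ n\<rfloor> + 1" for n :: nat
    define d where "d n = real (k n) / 2 ^ n" for n
    have k: "real (k n) = real_of_int \<lfloor>t * 2 ^ n\<rfloor> + 1" for n using t by (simp add: k_def)
    have d_bounds: "t < d n" "d n \<le> t + (1 / 2) ^ n" for n
    proof -
      have "t * 2 ^ n < real (k n)" "real (k n) \<le> t * 2 ^ n + 1" unfolding k by linarith+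
      then show "t < d n" "d n \<le> t + (1 / 2) ^ n" by (auto simp: d_def field_simps power_divide)
    qed
    have d_grid: "d n \<in> dyadic_grid T n" for n
    proof -
      have "t * 2 ^ n < real (T * 2 ^ n)" using t False by simp
      then have "\<lfloor>t * 2 ^ n\<rfloor> < int (T * 2 ^ n)" by (simp only: floor_less_iff of_int_of_nat_eq)
      then have "k n \<le> T * 2 ^ n" using t by (simp add: k_def nat_less_iff Suc_le_eq)
      then show ?thesis by (auto simp: dyadic_grid_def d_def)
    qed
    have "d \<longlonglongrightarrow> t"
    proof (rule tendsto_sandwich[of "\<lambda>_. t" _ _ "\<lambda>n. t + (1 / 2) ^ n"])
      have "(\<lambda>n. t + (1 / 2) ^ n) \<longlonglongrightarrow> t + 0" by (intro tendsto_intros) auto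
      then show "(\<lambda>n. t + (1 / 2) ^ n) \<longlonglongrightarrow> t" by simp
    qed (use d_bounds in \<open>auto intro!: always_eventually less_imp_le\<close>)
    then have d_right: "filterlim d (at_right t) sequentially"
      unfolding filterlim_at using d_bounds by (auto intro!: always_eventually)
    show ?thesis
    proof (rule borel_measurable_LIMSEQ_real)
      show "canonical_process (d n) \<in> borel_measurable G" for n by (rule grid[OF d_grid])
      fix \<omega> assume "\<omega> \<in> space G"
      then have "(\<omega> \<longlongrightarrow> \<omega> t) (at_right t)"
        using t by (auto simp: space_G cadlag_paths_def cadlag_def continuous_within)
      then show "(\<lambda>n. canonical_process (d n) \<omega>) \<longlonglongrightarrow> canonical_process t \<omega>"
        using d_right by (rule filterlim_compose)
    qed
  qed
  have "sets (path_filtration (real T)) \<subseteq> sets G"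
    unfolding path_filtration_def sets_coord_algebra space_G[symmetric]
  proof (rule sets.sigma_sets_subset, clarify)
    fix s and B :: "real set" assume "s \<in> {0..real T}" "B \<in> sets borel"
    then show "canonical_process s -` B \<inter> space G \<in> sets G"
      using measurable_sets[OF meas[of s]] by simp
  qed
  then show ?thesis by (simp add: sets_G)
qed

text \<open>For a path that starts at 0 the grid values are partial sums of the grid increments, so
  an event about values is an event about increments.\<close>

lemma grid_event_increments:
  assumes "A \<in> sets (coord_algebra (dyadic_grid T n))"
  shows "\<exists>B\<in>sets (PiM {..<T * 2 ^ n} (\<lambda>_. borel)). \<forall>\<omega>\<in>cadlag_paths. \<omega> 0 = 0 \<longrightarrow>
    (\<omega> \<in> A \<longleftrightarrow> (\<lambda>i\<in>{..<T * 2 ^ n}. grid_increment canonical_process n i \<omega>) \<in> B)"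
  using assms unfolding sets_coord_algebra
proof (induction A rule: sigma_sets.induct)
  case (Basic A)
  let ?M = "PiM {..<T * 2 ^ n} (\<lambda>_. borel) :: (nat \<Rightarrow> real) measure"
  from Basic obtain k B where k: "k \<le> T * 2 ^ n" and B: "B \<in> sets borel"
    and A: "A = canonical_process (real k / 2 ^ n) -` B \<inter> cadlag_paths"
    by (auto simp: dyadic_grid_def)
  have "(\<lambda>v. \<Sum>i<k. v i) \<in> borel_measurable ?M"
    using k by (intro borel_measurable_sum measurable_component_singleton) auto
  then have "(\<lambda>v. \<Sum>i<k. v i) -` B \<inter> space ?M \<in> sets ?M" using B by (rule measurable_sets)
  moreover have "\<omega> \<in> A \<longleftrightarrow> (\<lambda>i\<in>{..<T * 2 ^ n}. grid_increment canonical_process n i \<omega>)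
      \<in> (\<lambda>v. \<Sum>i<k. v i) -` B \<inter> space ?M" if "\<omega> \<in> cadlag_paths" "\<omega> 0 = 0" for \<omega>
  proof -
    have "(\<Sum>i<k. (\<lambda>i\<in>{..<T * 2 ^ n}. grid_increment canonical_process n i \<omega>) i)
        = (\<Sum>i<k. grid_increment canonical_process n i \<omega>)"
      using k by (intro sum.cong) auto
    also have "\<dots> = \<omega> (real k / 2 ^ n)" using that by (simp add: sum_grid_increment)
    finally show ?thesis using that by (auto simp: A space_PiM)
  qed
  ultimately show ?case by blast
next
  case Empty
  then show ?case by (intro bexI[of _ "{}"]) auto
next
  case (Compl A)
  then obtain B where B: "B \<in> sets (PiM {..<T * 2 ^ n} (\<lambda>_. borel))"
    "\<And>\<omega>. \<omega> \<in> cadlag_paths \<Longrightarrow> \<omega> 0 = 0 \<Longrightarrow>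
    (\<omega> \<in> A \<longleftrightarrow> (\<lambda>i\<in>{..<T * 2 ^ n}. grid_increment canonical_process n i \<omega>) \<in> B)" by blast
  show ?case
  proof (intro bexI[of _ "space (PiM {..<T * 2 ^ n} (\<lambda>_. borel)) - B"] ballI impI)
    show "space (PiM {..<T * 2 ^ n} (\<lambda>_. borel)) - B \<in> sets (PiM {..<T * 2 ^ n} (\<lambda>_. borel))"
      using B(1) by (rule sets.compl_sets)
    fix \<omega> assume \<omega>: "\<omega> \<in> cadlag_paths" "\<omega> 0 = 0"
    have "(\<lambda>i\<in>{..<T * 2 ^ n}. grid_increment canonical_process n i \<omega>)
        \<in> space (PiM {..<T * 2 ^ n} (\<lambda>_. borel))"
      by (simp add: space_PiM)
    then show "\<omega> \<in> cadlag_paths - A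
        \<longleftrightarrow> (\<lambda>i\<in>{..<T * 2 ^ n}. grid_increment canonical_process n i \<omega>)
          \<in> space (PiM {..<T * 2 ^ n} (\<lambda>_. borel)) - B"
      using B(2)[OF \<omega>] \<omega>(1) by (simp only: Diff_iff simp_thms)
  qed
next
  case (Union A)
  then have "\<exists>B. \<forall>j. B j \<in> sets (PiM {..<T * 2 ^ n} (\<lambda>_. borel)) \<and> (\<forall>\<omega>\<in>cadlag_paths. \<omega> 0 = 0 \<longrightarrow>
    (\<omega> \<in> A j \<longleftrightarrow> (\<lambda>i\<in>{..<T * 2 ^ n}. grid_increment canonical_process n i \<omega>) \<in> B j))"
    by (intro choice) blast
  then obtain B where B: "\<And>j. B j \<in> sets (PiM {..<T * 2 ^ n} (\<lambda>_. borel))"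
    "\<And>j \<omega>. \<omega> \<in> cadlag_paths \<Longrightarrow> \<omega> 0 = 0 \<Longrightarrow>
    (\<omega> \<in> A j \<longleftrightarrow> (\<lambda>i\<in>{..<T * 2 ^ n}. grid_increment canonical_process n i \<omega>) \<in> B j)" by blast
  show ?case
  proof (intro bexI[of _ "\<Union>j. B j"] ballI impI)
    show "(\<Union>j. B j) \<in> sets (PiM {..<T * 2 ^ n} (\<lambda>_. borel))"
      using B(1) by (intro sets.countable_UN) auto
    fix \<omega> assume "\<omega> \<in> cadlag_paths" "\<omega> 0 = 0"
    then show "\<omega> \<in> (\<Union>j. A j)
        \<longleftrightarrow> (\<lambda>i\<in>{..<T * 2 ^ n}. grid_increment canonical_process n i \<omega>) \<in> (\<Union>j. B j)"
      using B(2) by (simp only: UN_iff)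
  qed
qed

text \<open>The start at 0 holds only almost surely, so the pathwise equivalence becomes an equality
  up to a null set.\<close>

lemma emeasure_grid_event:
  assumes "levy_process P canonical_process" and sets_P: "sets P = sets path_algebra"
    and A: "A \<in> sets P" and B: "B \<in> sets (PiM {..<N} (\<lambda>_. borel))"
    and AB: "\<forall>\<omega>\<in>cadlag_paths. \<omega> 0 = 0 \<longrightarrow>
      (\<omega> \<in> A \<longleftrightarrow> (\<lambda>i\<in>{..<N}. grid_increment canonical_process n i \<omega>) \<in> B)"
  shows "emeasure P A = emeasure (distr P (PiM {..<N} (\<lambda>_. borel))
    (\<lambda>\<omega>. \<lambda>i\<in>{..<N}. grid_increment canonical_process n i \<omega>)) B"
proof -
  interpret levy_process P canonical_process by fact
  let ?f = "\<lambda>\<omega>. \<lambda>i\<in>{..<N}. grid_increment canonical_process n i \<omega>"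
  have f: "?f \<in> measurable P (PiM {..<N} (\<lambda>_. borel))" by measurable
  have "emeasure P A = emeasure P (?f -` B \<inter> space P)"
  proof (rule emeasure_eq_AE)
    show "AE \<omega> in P. \<omega> \<in> A \<longleftrightarrow> \<omega> \<in> ?f -` B \<inter> space P"
      using start_zero AE_space
    proof eventually_elim
      case (elim \<omega>)
      then show ?case
        using AB sets_eq_imp_space_eq[OF sets_P] by (auto simp: path_algebra_def space_coord_algebra)
    qed
  qed (use A B f in \<open>auto intro: measurable_sets\<close>)
  then show ?thesis using B f by (simp add: emeasure_distr)
qed

text \<open>A grid event close to a \<open>P\<close>-null set under both measures has small
  \<open>P\<close>-measure, hence small \<open>Q\<close>-measure by domination. \<open>K\<close> is
  fixed before the grid event is chosen, because the required accuracy depends on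
  \<open>K\<close>.\<close>

theorem ts_locally_absolutely_continuous:
  fixes P Q :: "(real \<Rightarrow> real) measure"
  assumes p: "0 < \<alpha>_p" "\<beta>_p \<in> {0..<1}" "0 < lam_p1" "0 < lam_p2"
    and m: "0 < \<alpha>_m" "\<beta>_m \<in> {0..<1}" "0 < lam_m1" "0 < lam_m2"
    and sets_P: "sets P = sets path_algebra" and sets_Q: "sets Q = sets path_algebra"
    and X: "tempered_stable_process P canonical_process \<alpha>_p \<beta>_p lam_p1 \<alpha>_m \<beta>_m lam_m1"
    and Y: "tempered_stable_process Q canonical_process \<alpha>_p \<beta>_p lam_p2 \<alpha>_m \<beta>_m lam_m2"
  shows "absolutely_continuous (restr_to_subalg P (path_filtration t)) (restr_to_subalg Q (path_filtration t))"
proof -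
  \<comment> \<open>An integer horizon beyond \<open>t\<close> that stays positive when
    \<open>t\<close> is 0 or negative.\<close>
  define T where "T = nat \<lceil>t\<rceil> + 1"
  have T: "0 < T" "t \<le> real T" by (auto simp: T_def) linarith
  have levy: "levy_process P canonical_process" "levy_process Q canonical_process"
    using X Y by (auto simp: tempered_stable_process_def)
  interpret P: levy_process P canonical_process by (rule levy)
  interpret Q: levy_process Q canonical_process by (rule levy)
  let ?\<A> = "\<Union>n. sets (coord_algebra (dyadic_grid T n))"
  have "sets (coord_algebra (dyadic_grid T n)) \<subseteq> sets path_algebra" for n
    unfolding path_algebra_def by (rule coord_algebra_mono) (auto simp: dyadic_grid_def)
  then have \<A>: "?\<A> \<subseteq> sets P" "?\<A> \<subseteq> sets Q" by (auto simp: sets_P sets_Q)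
  have space: "space P = cadlag_paths" "space Q = cadlag_paths"
    using sets_eq_imp_space_eq[OF sets_P] sets_eq_imp_space_eq[OF sets_Q]
    by (simp_all add: path_algebra_def space_coord_algebra)
  have "A \<in> null_sets Q" if A: "A \<in> null_sets P" and A_t: "A \<in> sets (path_filtration t)" for A
  proof -
    have "A \<in> sets (path_filtration (real T))"
      using A_t coord_algebra_mono[of "{0..t}" "{0..real T}"] T by (auto simp: path_filtration_def)
    then have A_gen: "A \<in> sigma_sets cadlag_paths ?\<A>"
      using path_filtration_generated_by_dyadics by blast
    have A_sets: "A \<in> sets P" "A \<in> sets Q" using A by (auto simp: sets_P sets_Q)
    have "measure Q A \<le> e" if e: "0 < e" for e
    proof -
      from ts_grid_domination[OF p m X Y T(1), of "e / 3"] e obtain K where K: "0 \<le> K"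
        and dom: "\<And>n B. B \<in> sets (PiM {..<T * 2 ^ n} (\<lambda>_. borel)) \<Longrightarrow>
        emeasure (distr Q (PiM {..<T * 2 ^ n} (\<lambda>_. borel)) (\<lambda>\<omega>. \<lambda>i\<in>{..<T * 2 ^ n}. grid_increment canonical_process n i \<omega>)) B
        \<le> ennreal K * emeasure (distr P (PiM {..<T * 2 ^ n} (\<lambda>_. borel)) (\<lambda>\<omega>. \<lambda>i\<in>{..<T * 2 ^ n}. grid_increment canonical_process n i \<omega>)) B
          + ennreal (e / 3)"
        by auto
      \<comment> \<open>This accuracy makes both \<open>d\<close> and \<open>K * d\<close> at most
        \<open>e / 3\<close>. The last third is the additive error of the domination.\<close>
      define d where "d = e / (3 * (K + 1))"
      have d: "0 < d" "d \<le> e / 3" "K * d \<le> e / 3" using e K by (auto simp: d_def field_simps)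
      obtain A' where A': "A' \<in> ?\<A>"
        and dP: "measure P ((A - A') \<union> (A' - A)) < d" and dQ: "measure Q ((A - A') \<union> (A' - A)) < d"
        using approximation_by_algebra[OF algebra_dyadic P.finite_measure_axioms \<A>(1)
            Q.finite_measure_axioms \<A>(2) space A_gen d(1)] by blast
      have A'_sets: "A' \<in> sets P" "A' \<in> sets Q" using A' \<A> by auto
      then obtain n where "A' \<in> sets (coord_algebra (dyadic_grid T n))" using A' by blast
      from grid_event_increments[OF this] obtain B where B: "B \<in> sets (PiM {..<T * 2 ^ n} (\<lambda>_. borel))"
        and AB: "\<forall>\<omega>\<in>cadlag_paths. \<omega> 0 = 0 \<longrightarrow>
          (\<omega> \<in> A' \<longleftrightarrow> (\<lambda>i\<in>{..<T * 2 ^ n}. grid_increment canonical_process n i \<omega>) \<in> B)"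
        by blast
      have "emeasure Q A' \<le> ennreal K * emeasure P A' + ennreal (e / 3)"
        unfolding emeasure_grid_event[OF levy(1) sets_P A'_sets(1) B AB]
          emeasure_grid_event[OF levy(2) sets_Q A'_sets(2) B AB]
        by (rule dom[OF B])
      then have QA': "measure Q A' \<le> K * measure P A' + e / 3"
      proof -
        have "ennreal K * emeasure P A' + ennreal (e / 3) = ennreal (K * measure P A' + e / 3)"
          using K e by (simp add: P.emeasure_eq_measure ennreal_mult)
        with \<open>emeasure Q A' \<le> _\<close> have "ennreal (measure Q A') \<le> ennreal (K * measure P A' + e / 3)"
          by (simp only: Q.emeasure_eq_measure)
        then show ?thesis using K e by (subst (asm) ennreal_le_iff) auto
      qed
      have "measure P A' \<le> measure P (A \<union> ((A - A') \<union> (A' - A)))"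
        by (rule P.finite_measure_mono) (use A_sets A'_sets in auto)
      also have "\<dots> \<le> measure P A + measure P ((A - A') \<union> (A' - A))"
        by (rule measure_Un_le) (use A_sets A'_sets in auto)
      also have "measure P A = 0" using A by (simp add: measure_def null_setsD1)
      finally have "measure P A' \<le> d" using dP by simp
      then have "K * measure P A' \<le> e / 3" using mult_left_mono[of "measure P A'" d K] K d(3) by simp
      moreover have "measure Q A \<le> measure Q (A' \<union> ((A - A') \<union> (A' - A)))"
        by (rule Q.finite_measure_mono) (use A_sets A'_sets in auto)
      moreover have "\<dots> \<le> measure Q A' + measure Q ((A - A') \<union> (A' - A))"
        by (rule measure_Un_le) (use A_sets A'_sets in auto)
      ultimately show ?thesis using QA' dQ d(2) by linarith
    qed
    then have "measure Q A \<le> 0" by (rule field_le_epsilon) simp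
    then have "emeasure Q A = 0"
      using measure_nonneg[of Q A] by (simp add: Q.emeasure_eq_measure)
    then show ?thesis using A_sets by (simp add: null_sets_def)
  qed
  then show ?thesis
    unfolding absolutely_continuous_def
    by (auto simp: null_sets_restr_to_subalg[OF subalgebra_path_filtration[OF sets_P]]
        null_sets_restr_to_subalg[OF subalgebra_path_filtration[OF sets_Q]])
qed

section \<open>Separation for different stability parameters\<close>

text \<open>For \<open>x = - y < 0\<close> this follows from \<open>exp y \<ge> 1 + y\<close> and
  the identity \<open>(1 - y + y^2) * (1 + y) = 1 + y^3\<close>. Both signs occur in the Chernoff
  bounds.\<close>

lemma exp_le_quadratic:
  fixes x :: real
  assumes "\<bar>x\<bar> \<le> 1"
  shows "exp x \<le> 1 + x + x\<^sup>2"
proof (cases "0 \<le> x")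
  case True
  then show ?thesis using exp_bound[of x] assms by simp
next
  case False
  define y where "y = - x"
  have y: "0 < y" using False by (simp add: y_def)
  have "exp x = 1 / exp y" by (simp add: y_def exp_minus field_simps)
  also have "\<dots> \<le> 1 / (1 + y)"
    using exp_ge_add_one_self[of y] y by (intro divide_left_mono) auto
  also have "\<dots> \<le> 1 - y + y\<^sup>2"
  proof -
    have "(1 - y + y\<^sup>2) * (1 + y) = 1 + y ^ 3" by (simp add: algebra_simps power2_eq_square power3_eq_cube)
    also have "1 \<le> \<dots>" using y by simp
    finally show ?thesis using y by (simp add: divide_le_eq)
  qed
  finally show ?thesis by (simp add: y_def)
qed

text \<open>The quantity \<open>z / (1 + z)\<close> lies between: it is at most
  \<open>1 - exp (- z)\<close> and at least half of \<open>min 1 z\<close>.\<close>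

lemma one_minus_exp_ge:
  fixes z :: real
  assumes "0 \<le> z"
  shows "min 1 z \<le> 2 * (1 - exp (- z))"
proof -
  have "exp (- z) \<le> 1 / (1 + z)"
    using exp_ge_add_one_self[of z] assms by (simp add: exp_minus divide_inverse le_imp_inverse_le)
  then have "z / (1 + z) \<le> 1 - exp (- z)" using assms by (simp add: field_simps)
  moreover have "min 1 z \<le> 2 * (z / (1 + z))"
  proof (cases "z \<le> 1")
    case True
    then have "z * (1 + z) \<le> z * 2" using assms by (intro mult_left_mono) auto
    then show ?thesis using True assms by (simp add: field_simps)
  qed (use assms in \<open>simp add: field_simps\<close>)
  moreover have "2 * (z / (1 + z)) \<le> 2 * (1 - exp (- z))"
    using calculation(1) by (rule mult_left_mono) simp
  ultimately show ?thesis by (blast intro: order_trans)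
qed

section \<open>The one-sided test function and its mean over one grid step\<close>

definition positive_test :: "real \<Rightarrow> real \<Rightarrow> real" where
  "positive_test u x = 1 - exp (- (u * max 0 x))"

lemma positive_test_measurable [measurable]: "positive_test u \<in> borel_measurable borel"
  unfolding positive_test_def[abs_def] by measurable

lemma positive_test_bounds: "0 < u \<Longrightarrow> 0 \<le> positive_test u x \<and> positive_test u x \<le> 1"
  by (simp add: positive_test_def)

lemma positive_test_diff_le:
  assumes "0 < u" "0 \<le> x" "0 \<le> y"
  shows "positive_test u (x - y) \<le> 1 - exp (- (u * x))"
  using assms by (auto simp: positive_test_def max_def intro!: mult_left_mono)

text \<open>The term \<open>x * y\<close> handles large \<open>x\<close> and has expectation of order \<open>s\<^sup>2\<close>; the last term handles small \<open>x\<close>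
  and has expectation at most \<open>s\<close> times a quantity that is small for large \<open>v\<close>.\<close>

lemma positive_test_diff_ge:
  assumes u: "0 < u" and v: "0 < v" and x: "0 \<le> x" and y: "0 \<le> y"
  shows "1 - exp (- (u * x)) - (u * v) * (x * y) - (2 * u / v) * (1 - exp (- (v * y)))
    \<le> positive_test u (x - y)"
proof -
  define w where "w = max 0 (x - y)"
  have w: "0 \<le> w" "w \<le> x" "x - w = min x y" using x y by (auto simp: w_def)
  \<comment> \<open>Subtracting \<open>y\<close> lowers the test value by at most
    \<open>u * min x y\<close>, and this minimum is what the two error terms have to
    dominate.\<close>
  have "exp (- (u * w)) - exp (- (u * x)) = exp (- (u * w)) * (1 - exp (- (u * (x - w))))"
    by (simp add: right_diff_distrib exp_add[symmetric])
  also have "\<dots> \<le> 1 * (u * (x - w))"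
    using w u exp_ge_add_one_self[of "- (u * (x - w))"] by (intro mult_mono) auto
  also have "\<dots> = u * min x y" using w by simp
  also have "min x y \<le> v * (x * y) + (2 / v) * (1 - exp (- (v * y)))"
  proof (cases "1 \<le> v * x")
    case True
    have "min x y \<le> 1 * y" by simp
    also have "\<dots> \<le> (v * x) * y" using True y by (intro mult_right_mono)
    finally show ?thesis using v y by (intro add_increasing2) (auto simp: mult_ac)
  next
    case False
    have "v * min x y \<le> v * x" "v * min x y \<le> v * y" using v by (auto intro: mult_left_mono)
    with False have "v * min x y \<le> min 1 (v * y)" by simp
    also have "\<dots> \<le> 2 * (1 - exp (- (v * y)))" by (rule one_minus_exp_ge) (use v y in auto)
    finally have "min x y \<le> (2 / v) * (1 - exp (- (v * y)))" using v by (simp add: field_simps)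
    then show ?thesis using v x y by (intro add_increasing) auto
  qed
  finally show ?thesis
    using u by (simp add: positive_test_def w_def[symmetric] algebra_simps diff_divide_distrib)
qed

lemma (in jump_measure) subordinator_expectation:
  assumes \<mu>: "subordinator_law F s \<mu>" and s: "0 \<le> s"
  shows "integrable \<mu> (\<lambda>x. x)" "(LINT x|\<mu>. x) \<le> s * mean" "0 \<le> (LINT x|\<mu>. x)"
proof -
  note L = has_laplaceD[OF \<mu>[unfolded subordinator_law_def]]
  note [measurable_cong] = L(2)
  have nn: "0 \<le> s * mean" using s mean_nonneg by simp
  show "integrable \<mu> (\<lambda>x. x)"
  proof (rule integrableI_nonneg)
    show "(\<integral>\<^sup>+x. ennreal x \<partial>\<mu>) < \<infinity>"
      using subordinator_mean_le[OF \<mu> s] by (rule le_less_trans) simp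
  qed (use L(3) in auto)
  then have "ennreal (LINT x|\<mu>. x) \<le> ennreal (s * mean)"
    using subordinator_mean_le[OF \<mu> s] nn_integral_eq_integral[of \<mu> "\<lambda>x. x"] L(3) by simp
  then show "(LINT x|\<mu>. x) \<le> s * mean" using nn by (simp add: ennreal_le_iff)
  show "0 \<le> (LINT x|\<mu>. x)" by (rule integral_nonneg_AE) (use L(3) in auto)
qed

context
  fixes F G :: "real measure"
  assumes F: "jump_measure F" and G: "jump_measure G"
begin

interpretation F: jump_measure F by (rule F)
interpretation G: jump_measure G by (rule G)

lemma positive_test_mean:
  assumes \<mu>: "subordinator_law F s \<mu>" and \<nu>: "subordinator_law G s \<nu>" and s: "0 < s" and u: "0 < u"
  shows "(LINT z|distr (\<mu> \<Otimes>\<^sub>M \<nu>) borel (\<lambda>(x, y). x - y). positive_test u z) \<le> s * bernstein F u"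
    and "0 < v \<Longrightarrow> 1 - exp (- (s * bernstein F u)) - (u * v) * (s * F.mean * (s * G.mean))
          - (2 * u / v) * (s * bernstein G v)
        \<le> (LINT z|distr (\<mu> \<Otimes>\<^sub>M \<nu>) borel (\<lambda>(x, y). x - y). positive_test u z)"
proof -
  note L = has_laplaceD[OF \<mu>[unfolded subordinator_law_def]]
    and L' = has_laplaceD[OF \<nu>[unfolded subordinator_law_def]]
  note [measurable_cong] = L(2) L'(2)
  interpret \<mu>: prob_space \<mu> by (rule L)
  interpret \<nu>: prob_space \<nu> by (rule L')
  interpret P: pair_prob_space \<mu> \<nu> ..
  have AE: "AE z in \<mu> \<Otimes>\<^sub>M \<nu>. 0 \<le> fst z \<and> 0 \<le> snd z"
  proof (rule P.AE_pair_measure)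
    show "AE x in \<mu>. AE y in \<nu>. 0 \<le> fst (x, y) \<and> 0 \<le> snd (x, y)"
      using L(3)
    proof eventually_elim
      case (elim x)
      show ?case using L'(3) by eventually_elim (use elim in simp)
    qed
  qed simp
  have eq: "(LINT z|distr (\<mu> \<Otimes>\<^sub>M \<nu>) borel (\<lambda>(x, y). x - y). positive_test u z)
      = (LINT z|(\<mu> \<Otimes>\<^sub>M \<nu>). positive_test u (fst z - snd z))"
    by (subst integral_distr) (auto simp: case_prod_beta)
  have int_test: "integrable (\<mu> \<Otimes>\<^sub>M \<nu>) (\<lambda>z. positive_test u (fst z - snd z))"
    by (rule P.integrable_const_bound[where B = 1]) (use positive_test_bounds[OF u] in auto)
  have int_prod: "integrable (\<mu> \<Otimes>\<^sub>M \<nu>) (\<lambda>z. f (fst z) * h (snd z))"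
    and prod_eq: "(LINT z|(\<mu> \<Otimes>\<^sub>M \<nu>). f (fst z) * h (snd z)) = (LINT x|\<mu>. f x) * (LINT y|\<nu>. h y)"
    if "integrable \<mu> f" "integrable \<nu> h" for f h :: "real \<Rightarrow> real"
  proof -
    show i: "integrable (\<mu> \<Otimes>\<^sub>M \<nu>) (\<lambda>z. f (fst z) * h (snd z))"
    proof (rule P.Fubini_integrable)
      show "(\<lambda>z. f (fst z) * h (snd z)) \<in> borel_measurable (\<mu> \<Otimes>\<^sub>M \<nu>)"
        using borel_measurable_integrable[OF that(1)] borel_measurable_integrable[OF that(2)] by measurable
      show "integrable \<mu> (\<lambda>x. LINT y|\<nu>. norm (f (fst (x, y)) * h (snd (x, y))))"
        using integrable_norm[OF that(1)] by (simp add: abs_mult)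
    qed (use that in auto)
    show "(LINT z|(\<mu> \<Otimes>\<^sub>M \<nu>). f (fst z) * h (snd z)) = (LINT x|\<mu>. f x) * (LINT y|\<nu>. h y)"
      using P.integral_fst'[OF i] by simp
  qed
  have int_\<mu>: "integrable \<mu> (\<lambda>x. 1 - exp (- (u * x)))" "(LINT x|\<mu>. 1 - exp (- (u * x))) = 1 - exp (- (s * bernstein F u))"
    using F.expectation_exp_subordinator[OF \<mu>, of u] u by (simp_all add: \<mu>.prob_space)
  have one: "integrable \<mu> (\<lambda>x. 1 :: real)" "integrable \<nu> (\<lambda>x. 1 :: real)" by auto
  note I1 = int_prod[OF int_\<mu>(1) one(2), simplified] prod_eq[OF int_\<mu>(1) one(2), simplified \<nu>.prob_space mult_1_right int_\<mu>(2)]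
  have "(LINT z|(\<mu> \<Otimes>\<^sub>M \<nu>). positive_test u (fst z - snd z)) \<le> (LINT z|(\<mu> \<Otimes>\<^sub>M \<nu>). 1 - exp (- (u * fst z)))"
  proof (rule integral_mono_AE[OF int_test I1(1)])
    show "AE z in \<mu> \<Otimes>\<^sub>M \<nu>. positive_test u (fst z - snd z) \<le> 1 - exp (- (u * fst z))"
      using AE by eventually_elim (use positive_test_diff_le[OF u] in auto)
  qed
  also have "\<dots> = 1 - exp (- (s * bernstein F u))" using I1(2) \<nu>.prob_space by simp
  also have "\<dots> \<le> s * bernstein F u" using exp_ge_add_one_self[of "- (s * bernstein F u)"] by simp
  finally show "(LINT z|distr (\<mu> \<Otimes>\<^sub>M \<nu>) borel (\<lambda>(x, y). x - y). positive_test u z) \<le> s * bernstein F u"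
    unfolding eq .
  assume v: "0 < v"
  have int_\<nu>: "integrable \<nu> (\<lambda>x. 1 - exp (- (v * x)))" "(LINT x|\<nu>. 1 - exp (- (v * x))) = 1 - exp (- (s * bernstein G v))"
    using G.expectation_exp_subordinator[OF \<nu>, of v] v by (simp_all add: \<nu>.prob_space)
  note E\<mu> = F.subordinator_expectation[OF \<mu> less_imp_le[OF s]]
    and E\<nu> = G.subordinator_expectation[OF \<nu> less_imp_le[OF s]]
  note I2 = int_prod[OF E\<mu>(1) E\<nu>(1)] prod_eq[OF E\<mu>(1) E\<nu>(1)]
  note I3 = int_prod[OF one(1) int_\<nu>(1), simplified] prod_eq[OF one(1) int_\<nu>(1)]
  have "1 - exp (- (s * bernstein F u)) - (u * v) * (s * F.mean * (s * G.mean)) - (2 * u / v) * (s * bernstein G v)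
    \<le> 1 - exp (- (s * bernstein F u)) - (u * v) * ((LINT x|\<mu>. x) * (LINT y|\<nu>. y))
        - (2 * u / v) * (1 - exp (- (s * bernstein G v)))"
  proof (intro diff_mono order_refl mult_left_mono)
    show "(LINT x|\<mu>. x) * (LINT y|\<nu>. y) \<le> s * F.mean * (s * G.mean)"
      using E\<mu> E\<nu> s F.mean_nonneg by (intro mult_mono) auto
    show "1 - exp (- (s * bernstein G v)) \<le> s * bernstein G v"
      using exp_ge_add_one_self[of "- (s * bernstein G v)"] by simp
  qed (use u v in auto)
  also have "\<dots> = (LINT z|(\<mu> \<Otimes>\<^sub>M \<nu>). (1 - exp (- (u * fst z))) - (u * v) * (fst z * snd z)
      - (2 * u / v) * (1 - exp (- (v * snd z))))"
    using I1 I2 I3 int_\<nu>(2) \<mu>.prob_space \<nu>.prob_space by simp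
  also have "\<dots> \<le> (LINT z|(\<mu> \<Otimes>\<^sub>M \<nu>). positive_test u (fst z - snd z))"
  proof (rule integral_mono_AE[OF _ int_test])
    show "integrable (\<mu> \<Otimes>\<^sub>M \<nu>) (\<lambda>z. (1 - exp (- (u * fst z))) - (u * v) * (fst z * snd z)
      - (2 * u / v) * (1 - exp (- (v * snd z))))"
      using I1(1) I2(1) I3(1)
      by - (rule Bochner_Integration.integrable_diff, rule Bochner_Integration.integrable_diff, assumption,
          rule integrable_mult_right, assumption, rule integrable_mult_right, assumption)
    show "AE z in \<mu> \<Otimes>\<^sub>M \<nu>. (1 - exp (- (u * fst z))) - (u * v) * (fst z * snd z)
      - (2 * u / v) * (1 - exp (- (v * snd z))) \<le> positive_test u (fst z - snd z)"
      using AE by eventually_elim (use positive_test_diff_ge[OF u v] in auto)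
  qed
  finally show "1 - exp (- (s * bernstein F u)) - (u * v) * (s * F.mean * (s * G.mean))
          - (2 * u / v) * (s * bernstein G v)
        \<le> (LINT z|distr (\<mu> \<Otimes>\<^sub>M \<nu>) borel (\<lambda>(x, y). x - y). positive_test u z)"
    unfolding eq .
qed

text \<open>The allowed loss of \<open>s\<close> is split into halves. First \<open>v\<close> is
  chosen so that the term with \<open>bernstein G v\<close> is at most \<open>s / 2\<close>, then
  \<open>s0\<close> so that the terms quadratic in \<open>s\<close> are at most
  \<open>s / 2\<close>. The order matters, since the quadratic coefficient contains
  \<open>v\<close>.\<close>

lemma positive_test_mean_ge:
  assumes u: "0 < u"
  shows "\<exists>s0>0. \<forall>s \<mu> \<nu>. 0 < s \<and> s \<le> s0 \<and> subordinator_law F s \<mu> \<and> subordinator_law G s \<nu> \<longrightarrow>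
    s * (bernstein F u - 1) \<le> (LINT z|distr (\<mu> \<Otimes>\<^sub>M \<nu>) borel (\<lambda>(x, y). x - y). positive_test u z)"
proof -
  obtain v where v: "0 < v" "bernstein G v \<le> 1 / (4 * u) * v"
    using G.bernstein_sublinear[of "1 / (4 * u)"] u by auto
  define B where "B = bernstein F u"
  define D where "D = B\<^sup>2 + u * v * (F.mean * G.mean)"
  have B: "0 \<le> B" unfolding B_def using u by (intro F.bernstein_nonneg) simp
  have D: "0 \<le> D" using u v F.mean_nonneg G.mean_nonneg by (auto simp: D_def)
  \<comment> \<open>The first entry yields \<open>s * B \<le> 1\<close>, as
    \<open>exp_le_quadratic\<close> demands; the second bounds the quadratic terms.\<close>
  define s0 where "s0 = min (1 / (B + 1)) (1 / (2 * (D + 1)))"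
  have s0: "0 < s0" using B D by (auto simp: s0_def)
  have "s * (B - 1) \<le> (LINT z|distr (\<mu> \<Otimes>\<^sub>M \<nu>) borel (\<lambda>(x, y). x - y). positive_test u z)"
    if s: "0 < s" "s \<le> s0" and \<mu>: "subordinator_law F s \<mu>" and \<nu>: "subordinator_law G s \<nu>" for s \<mu> \<nu>
  proof -
    have "s * (B + 1) \<le> 1" using s(2) B by (simp add: s0_def le_divide_eq)
    then have "s * B \<le> 1" using s B by (simp add: algebra_simps)
    then have "exp (- (s * B)) \<le> 1 + - (s * B) + (- (s * B))\<^sup>2"
      using s B by (intro exp_le_quadratic) auto
    then have 1: "s * B - (s * B)\<^sup>2 \<le> 1 - exp (- (s * B))" by simp
    have "(2 * u / v) * (s * bernstein G v) \<le> (2 * u / v) * (s * (1 / (4 * u) * v))"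
      using u v s by (intro mult_left_mono) auto
    also have "\<dots> = s / 2" using u v by simp
    finally have 2: "(2 * u / v) * (s * bernstein G v) \<le> s / 2" .
    have "s * (2 * (D + 1)) \<le> 1" using s(2) D by (simp add: s0_def le_divide_eq)
    then have "s * D \<le> 1 / 2" using s by (simp add: algebra_simps)
    then have "s * (s * D) \<le> s * (1 / 2)" using s by (intro mult_left_mono) auto
    then have 3: "(s * B)\<^sup>2 + (u * v) * (s * F.mean * (s * G.mean)) \<le> s / 2"
      by (simp add: D_def algebra_simps power2_eq_square)
    have "s * (B - 1) \<le> 1 - exp (- (s * B)) - (u * v) * (s * F.mean * (s * G.mean)) - (2 * u / v) * (s * bernstein G v)"
    proof -
      have "sB - s \<le> 1 - e - W - Z" if "sB - sq \<le> 1 - e" "Z \<le> s / 2" "sq + W \<le> s / 2" for sB sq e W Z :: real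
        using that by linarith
      from this[OF 1 2 3] show ?thesis by (simp only: right_diff_distrib mult_1_right)
    qed
    also have "\<dots> \<le> (LINT z|distr (\<mu> \<Otimes>\<^sub>M \<nu>) borel (\<lambda>(x, y). x - y). positive_test u z)"
      unfolding B_def by (rule positive_test_mean(2)[OF \<mu> \<nu> s(1) u v(1)])
    finally show ?thesis .
  qed
  with s0 show ?thesis unfolding B_def by blast
qed

end

text \<open>A \<open>\<theta>\<close> of either sign covers both tails at once: the event is an
  upper tail of the sum for \<open>\<theta> > 0\<close> and a lower tail for
  \<open>\<theta> < 0\<close>. For values in \<open>[0, 1]\<close> the square of \<open>g\<close> is
  at most \<open>g\<close>, so the quadratic term is again controlled by the mean.\<close>

lemma (in levy_process) chernoff_grid:
  assumes g [measurable]: "g \<in> borel_measurable borel" and g01: "\<And>x. 0 \<le> g x \<and> g x \<le> 1"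
    and \<theta>: "\<bar>\<theta>\<bar> \<le> 1"
  shows "measure M {\<omega> \<in> space M. 0 \<le> \<theta> * ((\<Sum>i<N. g (grid_increment X n i \<omega>)) - \<tau>)}
    \<le> exp (- \<theta> * \<tau> + (\<theta> + \<theta>\<^sup>2) * (real N * (LINT x|distr M borel (X (1 / 2 ^ n)). g x)))"
proof -
  define m where "m = (LINT x|distr M borel (X (1 / 2 ^ n)). g x)"
  define S where "S \<omega> = (\<Sum>i<N. g (grid_increment X n i \<omega>))" for \<omega>
  have [measurable]: "S \<in> borel_measurable M" unfolding S_def[abs_def] by measurable
  let ?e = "\<lambda>i \<omega>. exp (\<theta> * g (grid_increment X n i \<omega>))"
  have \<theta>g: "\<bar>\<theta> * g x\<bar> \<le> 1" for x using \<theta> g01[of x] by (simp add: abs_mult mult_le_one)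
  have int_g: "integrable M (\<lambda>\<omega>. g (grid_increment X n i \<omega>))" for i
    by (rule integrable_const_bound[where B = 1]) (use g01 in auto)
  have int_e: "integrable M (?e i)" for i
    by (rule integrable_const_bound[where B = "exp 1"]) (use \<theta>g abs_le_D1 in auto)
  have m_eq: "(LINT \<omega>|M. g (grid_increment X n i \<omega>)) = m" for i
  proof -
    have "(LINT \<omega>|M. g (grid_increment X n i \<omega>)) = (LINT x|distr M borel (grid_increment X n i). g x)"
      by (subst integral_distr) auto
    then show ?thesis by (simp add: distr_grid_increment m_def)
  qed
  have e_le: "(LINT \<omega>|M. ?e i \<omega>) \<le> exp ((\<theta> + \<theta>\<^sup>2) * m)" for i
  proof -
    have "(LINT \<omega>|M. ?e i \<omega>) \<le> (LINT \<omega>|M. 1 + (\<theta> + \<theta>\<^sup>2) * g (grid_increment X n i \<omega>))"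
    proof (rule integral_mono[OF int_e])
      fix \<omega>
      let ?x = "g (grid_increment X n i \<omega>)"
      have "?e i \<omega> \<le> 1 + \<theta> * ?x + (\<theta> * ?x)\<^sup>2" by (rule exp_le_quadratic[OF \<theta>g])
      moreover have "?x\<^sup>2 \<le> ?x" using g01[of "grid_increment X n i \<omega>"]
        by (simp add: power2_eq_square mult_left_le)
      then have "\<theta>\<^sup>2 * ?x\<^sup>2 \<le> \<theta>\<^sup>2 * ?x" by (rule mult_left_mono) simp
      ultimately show "?e i \<omega> \<le> 1 + (\<theta> + \<theta>\<^sup>2) * ?x" by (simp add: power_mult_distrib algebra_simps)
    qed (use int_g in auto)
    also have "\<dots> = 1 + (\<theta> + \<theta>\<^sup>2) * m" using int_g by (simp add: m_eq prob_space)
    also have "\<dots> \<le> exp ((\<theta> + \<theta>\<^sup>2) * m)" by (rule exp_ge_add_one_self)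
    finally show ?thesis .
  qed
  have indep: "indep_vars (\<lambda>_. borel) ?e {..<N}"
    by (rule indep_vars_compose2[OF indep_grid_increments]) measurable
  have S_exp: "exp (\<theta> * S \<omega>) = (\<Prod>i<N. ?e i \<omega>)" for \<omega>
    by (simp add: S_def sum_distrib_left exp_sum)
  have int_S: "integrable M (\<lambda>\<omega>. exp (\<theta> * S \<omega>))"
    unfolding S_exp by (rule indep_vars_integrable[OF _ indep]) (use int_e in auto)
  have "(LINT \<omega>|M. exp (\<theta> * S \<omega>)) = (\<Prod>i<N. LINT \<omega>|M. ?e i \<omega>)"
    unfolding S_exp by (rule indep_vars_lebesgue_integral[OF _ indep]) (use int_e in auto)
  also have "\<dots> \<le> (\<Prod>i<N. exp ((\<theta> + \<theta>\<^sup>2) * m))"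
    by (rule prod_mono) (use e_le in \<open>auto intro!: integral_nonneg_AE\<close>)
  also have "\<dots> = exp ((\<theta> + \<theta>\<^sup>2) * (real N * m))"
    by (simp add: exp_of_nat_mult[symmetric] algebra_simps)
  finally have ES: "(LINT \<omega>|M. exp (\<theta> * S \<omega>)) \<le> exp ((\<theta> + \<theta>\<^sup>2) * (real N * m))" .
  let ?A = "{\<omega> \<in> space M. 0 \<le> \<theta> * (S \<omega> - \<tau>)}"
  have A: "?A \<in> sets M" by measurable
  have "measure M ?A = (LINT \<omega>|M. indicator ?A \<omega>)" using sets.sets_into_space[OF A] by (simp add: Int_absorb2)
  also have "\<dots> \<le> (LINT \<omega>|M. exp (- \<theta> * \<tau>) * exp (\<theta> * S \<omega>))"
  proof (rule integral_mono)
    show "integrable M (indicator ?A :: _ \<Rightarrow> real)"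
      by (rule integrable_real_indicator[OF A]) (simp add: less_top[symmetric])
    show "indicator ?A \<omega> \<le> exp (- \<theta> * \<tau>) * exp (\<theta> * S \<omega>)" for \<omega>
      by (auto simp: indicator_def exp_add[symmetric] algebra_simps)
  qed (use int_S in auto)
  also have "\<dots> \<le> exp (- \<theta> * \<tau>) * exp ((\<theta> + \<theta>\<^sup>2) * (real N * m))"
    using ES by simp
  finally show ?thesis by (simp add: exp_add[symmetric] S_def m_def)
qed

text \<open>The threshold lies midway between \<open>c * B u\<close> and \<open>B u\<close>, and the
  two Chernoff exponents tend to minus infinity with \<open>B u\<close>. The upper bound on the mean
  is required at every level \<open>n\<close>, because \<open>n\<close> is dictated by the lower
  bound for the other process once \<open>u\<close> is chosen.\<close>

lemma separating_events:
  fixes A B :: "real \<Rightarrow> real" and c C :: real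
  assumes X: "levy_process P X" and Y: "levy_process Q Y"
    and g [measurable]: "\<And>u. g u \<in> borel_measurable borel"
    and g01: "\<And>u x. 0 < u \<Longrightarrow> 0 \<le> g u x \<and> g u x \<le> 1"
    and up: "\<And>u n. 0 < u \<Longrightarrow> 2 ^ n * (LINT x|distr P borel (X (1 / 2 ^ n)). g u x) \<le> A u"
    and low: "\<And>u. 0 < u \<Longrightarrow> \<exists>n. B u - 1 \<le> 2 ^ n * (LINT x|distr Q borel (Y (1 / 2 ^ n)). g u x)"
    and c: "0 < c" "c < 1" and AB: "\<And>u. 0 < u \<Longrightarrow> A u \<le> c * B u + C"
    and B: "filterlim B at_top at_top" and \<epsilon>: "0 < (\<epsilon> :: real)"
  shows "\<exists>u n \<tau>. measure P {\<omega> \<in> space P. \<tau> \<le> (\<Sum>i<2 ^ n. g u (grid_increment X n i \<omega>))} < \<epsilon>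
    \<and> 1 / 2 \<le> measure Q {\<omega> \<in> space Q. \<tau> \<le> (\<Sum>i<2 ^ n. g u (grid_increment Y n i \<omega>))}"
proof -
  interpret P: levy_process P X by (rule X)
  interpret Q: levy_process Q Y by (rule Y)
  \<comment> \<open>Then \<open>c = 1 - 4 * \<theta>\<close>, and the threshold is at distance
    \<open>2 * \<theta> * R\<close> from both \<open>c * R\<close> and \<open>R\<close>. The
    quadratic Chernoff term costs at most \<open>\<theta> * R\<close>, so a gap of
    \<open>\<theta> * R\<close> remains, up to constants independent of \<open>R\<close>.\<close>
  define \<theta> where "\<theta> = (1 - c) / 4"
  have \<theta>: "0 < \<theta>" "\<theta> \<le> 1" using c by (auto simp: \<theta>_def)
  define C' where "C' = max C 0"
  \<comment> \<open>The first entry pushes the exponent for \<open>P\<close> below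
    \<open>ln \<epsilon>\<close>. The second brings the exponent for \<open>Q\<close> to at most -1,
    and \<open>exp (- 1) \<le> 1 / 2\<close>.\<close>
  define R0 where "R0 = max ((2 * C' + (\<bar>ln \<epsilon>\<bar> + 1) / \<theta>) / \<theta>) ((1 + 1 / \<theta>) / \<theta>)"
  have "\<forall>\<^sub>F u in at_top. R0 \<le> B u" using B by (simp add: filterlim_at_top)
  then have "\<forall>\<^sub>F u in at_top. R0 \<le> B u \<and> 0 < u"
    using eventually_gt_at_top[of 0] by eventually_elim simp
  then obtain u where u: "0 < u" and R0: "R0 \<le> B u" by (auto dest: eventually_happens)
  define R where "R = B u"
  have R: "(2 * C' + (\<bar>ln \<epsilon>\<bar> + 1) / \<theta>) / \<theta> \<le> R" "(1 + 1 / \<theta>) / \<theta> \<le> R"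
    using R0 by (auto simp: R_def R0_def)
  have R1: "2 * C' + (\<bar>ln \<epsilon>\<bar> + 1) / \<theta> \<le> \<theta> * R" "1 + 1 / \<theta> \<le> \<theta> * R"
    using R \<theta> by (simp_all add: divide_le_eq mult.commute)
  have R2: "\<theta> * (2 * C' - \<theta> * R) \<le> - (\<bar>ln \<epsilon>\<bar> + 1)" "\<theta> * (1 - \<theta> * R) \<le> - 1"
  proof -
    have "\<theta> * (2 * C' + (\<bar>ln \<epsilon>\<bar> + 1) / \<theta>) \<le> \<theta> * (\<theta> * R)" "\<theta> * (1 + 1 / \<theta>) \<le> \<theta> * (\<theta> * R)"
      using R1 \<theta> by (auto intro: mult_left_mono)
    then show "\<theta> * (2 * C' - \<theta> * R) \<le> - (\<bar>ln \<epsilon>\<bar> + 1)" "\<theta> * (1 - \<theta> * R) \<le> - 1"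
      using \<theta> by (simp_all add: algebra_simps add_divide_distrib)
  qed
  have "0 < (1 + 1 / \<theta>) / \<theta>" using \<theta> by (simp add: add_pos_pos)
  then have R_pos: "0 < R" using R by linarith
  define \<tau> where "\<tau> = (1 + c) / 2 * R"
  have c_eq: "c = 1 - 4 * \<theta>" by (simp add: \<theta>_def field_simps)
  have \<tau>_eq: "\<tau> = (1 - 2 * \<theta>) * R" by (simp add: \<tau>_def c_eq field_simps)
  obtain n where n: "R - 1 \<le> 2 ^ n * (LINT x|distr Q borel (Y (1 / 2 ^ n)). g u x)"
    using low[OF u] by (auto simp: R_def)
  define p where "p = 2 ^ n * (LINT x|distr P borel (X (1 / 2 ^ n)). g u x)"
  define q where "q = 2 ^ n * (LINT x|distr Q borel (Y (1 / 2 ^ n)). g u x)"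
  have p: "p \<le> c * R + C'" using up[OF u, of n] AB[OF u] by (simp add: p_def R_def C'_def)
  have q: "R - 1 \<le> q" using n by (simp add: q_def)
  have "measure P {\<omega> \<in> space P. \<tau> \<le> (\<Sum>i<2 ^ n. g u (grid_increment X n i \<omega>))}
      = measure P {\<omega> \<in> space P. 0 \<le> \<theta> * ((\<Sum>i<2 ^ n. g u (grid_increment X n i \<omega>)) - \<tau>)}"
    using \<theta> by (simp add: zero_le_mult_iff)
  also have "\<dots> \<le> exp (- \<theta> * \<tau> + (\<theta> + \<theta>\<^sup>2) * p)"
    using P.chernoff_grid[OF g g01[OF u], where \<theta> = \<theta> and N = "2 ^ n" and n = n and \<tau> = \<tau>] \<theta> by (simp add: p_def)
  also have "- \<theta> * \<tau> + (\<theta> + \<theta>\<^sup>2) * p \<le> \<theta> * (2 * C' - \<theta> * R)"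
  proof -
    have "(1 + \<theta>) * p \<le> (1 + \<theta>) * (c * R + C')" using p \<theta> by (intro mult_left_mono) auto
    also have "\<dots> \<le> (c + \<theta>) * R + 2 * C'"
    proof -
      have "\<theta> * (c * R) \<le> \<theta> * (1 * R)" using c \<theta> R_pos by (intro mult_left_mono mult_right_mono) auto
      moreover have "\<theta> * C' \<le> 1 * C'" using \<theta> by (intro mult_right_mono) (auto simp: C'_def)
      ultimately show ?thesis by (simp add: algebra_simps)
    qed
    finally have "(1 + \<theta>) * p - \<tau> \<le> 2 * C' - \<theta> * R" by (simp add: \<tau>_eq c_eq algebra_simps)
    then have "\<theta> * ((1 + \<theta>) * p - \<tau>) \<le> \<theta> * (2 * C' - \<theta> * R)" using \<theta> by (intro mult_left_mono) auto
    then show ?thesis by (simp add: algebra_simps power2_eq_square)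
  qed
  also have "exp (\<theta> * (2 * C' - \<theta> * R)) \<le> exp (- (\<bar>ln \<epsilon>\<bar> + 1))" using R2(1) by simp
  also have "\<dots> < exp (ln \<epsilon>)" by (simp add: abs_if)
  finally have 1: "measure P {\<omega> \<in> space P. \<tau> \<le> (\<Sum>i<2 ^ n. g u (grid_increment X n i \<omega>))} < \<epsilon>"
    using \<epsilon> by simp
  let ?A = "{\<omega> \<in> space Q. \<tau> \<le> (\<Sum>i<2 ^ n. g u (grid_increment Y n i \<omega>))}"
  let ?A' = "{\<omega> \<in> space Q. 0 \<le> - \<theta> * ((\<Sum>i<2 ^ n. g u (grid_increment Y n i \<omega>)) - \<tau>)}"
  have A_meas: "?A \<in> sets Q" "?A' \<in> sets Q" by measurable
  have "1 - measure Q ?A = measure Q (space Q - ?A)" using Q.prob_compl[OF A_meas(1)] by simp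
  also have "\<dots> \<le> measure Q ?A'"
    using \<theta> by (intro Q.finite_measure_mono A_meas(2)) (auto simp: mult_le_0_iff)
  also have "\<dots> \<le> exp (- (- \<theta>) * \<tau> + (- \<theta> + (- \<theta>)\<^sup>2) * q)"
    using Q.chernoff_grid[OF g g01[OF u], where \<theta> = "- \<theta>" and N = "2 ^ n" and n = n and \<tau> = \<tau>] \<theta> by (simp add: q_def)
  also have "- (- \<theta>) * \<tau> + (- \<theta> + (- \<theta>)\<^sup>2) * q \<le> \<theta> * (1 - \<theta> * R)"
  proof -
    have "(1 - \<theta>) * (R - 1) \<le> (1 - \<theta>) * q" using q \<theta> by (intro mult_left_mono) auto
    then have "\<tau> - (1 - \<theta>) * q \<le> 1 - \<theta> * R" using \<theta> by (simp add: \<tau>_eq algebra_simps)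
    then have "\<theta> * (\<tau> - (1 - \<theta>) * q) \<le> \<theta> * (1 - \<theta> * R)" using \<theta> by (intro mult_left_mono) auto
    then show ?thesis by (simp add: algebra_simps power2_eq_square)
  qed
  also have "exp (\<theta> * (1 - \<theta> * R)) \<le> exp (- 1)" using R2(2) by simp
  also have "\<dots> \<le> 1 / 2" using exp_ge_add_one_self[of 1] by (simp add: exp_minus field_simps)
  finally have 2: "1 / 2 \<le> measure Q ?A" by simp
  from 1 2 show ?thesis by blast
qed

text \<open>With the summable choice \<open>(1 / 2) ^ j\<close> for \<open>\<epsilon>\<close>,
  Borel-Cantelli makes the limsup of the events \<open>P\<close>-null. Each tail union has
  \<open>Q\<close>-measure at least 1/2, and so has their decreasing limit.\<close>

lemma not_absolutely_continuous_if_separated: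
  assumes P: "prob_space P" and Q: "prob_space Q"
    and sub: "subalgebra P H" "subalgebra Q H"
    and sep: "\<And>\<epsilon>. 0 < (\<epsilon> :: real) \<Longrightarrow> \<exists>A\<in>sets H. measure P A < \<epsilon> \<and> 1 / 2 \<le> measure Q A"
  shows "\<not> absolutely_continuous (restr_to_subalg P H) (restr_to_subalg Q H)"
proof
  assume ac: "absolutely_continuous (restr_to_subalg P H) (restr_to_subalg Q H)"
  interpret P: prob_space P by (rule P)
  interpret Q: prob_space Q by (rule Q)
  have "\<exists>A. \<forall>j. A j \<in> sets H \<and> measure P (A j) < (1 / 2) ^ j \<and> 1 / 2 \<le> measure Q (A j)"
    using sep[of "(1 / 2) ^ j" for j] by (intro choice) auto
  then obtain A where A: "\<And>j. A j \<in> sets H" and AP: "\<And>j. measure P (A j) < (1 / 2) ^ j"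
    and AQ: "\<And>j. 1 / 2 \<le> measure Q (A j)" by blast
  have A_sets: "A j \<in> sets P" "A j \<in> sets Q" for j
    using A sub by (auto simp: subalgebra_def)
  have "limsup A \<in> null_sets P"
  proof (rule borel_cantelli_limsup1)
    show "summable (\<lambda>n. measure P (A n))"
      by (rule summable_comparison_test'[of "\<lambda>n. (1 / 2) ^ n" 0])
        (use AP in \<open>auto intro: summable_geometric less_imp_le\<close>)
  qed (use A_sets in \<open>auto simp: less_top[symmetric]\<close>)
  moreover have limsup: "limsup A = (\<Inter>n. \<Union>m\<in>{n..}. A m)" by (simp add: limsup_INF_SUP)
  then have "limsup A \<in> sets H" using A by auto
  ultimately have "limsup A \<in> null_sets Q"
    using ac sub by (auto simp: absolutely_continuous_def null_sets_restr_to_subalg)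
  then have "measure Q (limsup A) = 0" by (simp add: measure_def null_setsD1)
  moreover have "1 / 2 \<le> measure Q (limsup A)"
  proof (rule LIMSEQ_le_const)
    show "(\<lambda>n. measure Q (\<Union>m\<in>{n..}. A m)) \<longlonglongrightarrow> measure Q (limsup A)"
      unfolding limsup
    proof (rule Q.finite_Lim_measure_decseq)
      show "range (\<lambda>n. \<Union>m\<in>{n..}. A m) \<subseteq> sets Q" using A_sets by auto
      show "decseq (\<lambda>n. \<Union>m\<in>{n..}. A m)"
        unfolding decseq_def by (intro allI impI UN_mono) auto
    qed
    have "measure Q (A n) \<le> measure Q (\<Union>m\<in>{n..}. A m)" for n
      by (rule Q.finite_measure_mono) (use A_sets in auto)
    then show "\<exists>N. \<forall>n\<ge>N. 1 / 2 \<le> measure Q (\<Union>m\<in>{n..}. A m)"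
      using AQ order_trans by blast
  qed
  ultimately show False by simp
qed

text \<open>Reflecting an increment swaps the two components of the pair, so the claims about
  \<open>G\<close> are those about \<open>F\<close> with the roles exchanged.\<close>

lemma ts_increment_expectations:
  assumes p: "0 < \<alpha>_p" "\<beta>_p \<in> {0..<1}" "0 < lam_p"
    and m: "0 < \<alpha>_m" "\<beta>_m \<in> {0..<1}" "0 < lam_m"
    and X: "tempered_stable_process M X \<alpha>_p \<beta>_p lam_p \<alpha>_m \<beta>_m lam_m"
    and u: "0 < u"
  defines "F \<equiv> ts_jumps \<alpha>_p \<beta>_p lam_p" and "G \<equiv> ts_jumps \<alpha>_m \<beta>_m lam_m"
  shows "2 ^ n * (LINT x|distr M borel (X (1 / 2 ^ n)). positive_test u x) \<le> bernstein F u"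
    and "2 ^ n * (LINT x|distr M borel (X (1 / 2 ^ n)). positive_test u (- x)) \<le> bernstein G u"
    and "\<exists>n. bernstein F u - 1 \<le> 2 ^ n * (LINT x|distr M borel (X (1 / 2 ^ n)). positive_test u x)"
    and "\<exists>n. bernstein G u - 1 \<le> 2 ^ n * (LINT x|distr M borel (X (1 / 2 ^ n)). positive_test u (- x))"
proof -
  have F: "jump_measure F" unfolding F_def by (rule jump_measure_ts_jumps) fact+
  have G: "jump_measure G" unfolding G_def by (rule jump_measure_ts_jumps) fact+
  have "\<exists>\<mu>. subordinator_law F (1 / 2 ^ n) \<mu>" "\<exists>\<nu>. subordinator_law G (1 / 2 ^ n) \<nu>" for n :: nat
    using jump_measure.subordinator_law_exists[OF F, of "1 / 2 ^ n"]
      jump_measure.subordinator_law_exists[OF G, of "1 / 2 ^ n"]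
    by (auto simp: subordinator_law_def)
  then obtain \<mu> \<nu> where \<mu>: "\<And>n :: nat. subordinator_law F (1 / 2 ^ n) (\<mu> n)"
    and \<nu>: "\<And>n :: nat. subordinator_law G (1 / 2 ^ n) (\<nu> n)" by metis
  have law: "distr M borel (X (1 / 2 ^ n)) = distr (\<mu> n \<Otimes>\<^sub>M \<nu> n) borel (\<lambda>(x, y). x - y)" for n
    by (rule ts_increment_law[OF p m X \<mu>[unfolded F_def] \<nu>[unfolded G_def]])
  have reflected: "(LINT x|distr M borel (X (1 / 2 ^ n)). positive_test u (- x))
      = (LINT x|distr (\<nu> n \<Otimes>\<^sub>M \<mu> n) borel (\<lambda>(x, y). x - y). positive_test u x)" for n
  proof -
    note L = has_laplaceD[OF \<mu>[unfolded subordinator_law_def], of n]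
      and L' = has_laplaceD[OF \<nu>[unfolded subordinator_law_def], of n]
    note [measurable_cong] = L(2) L'(2)
    interpret \<mu>: prob_space "\<mu> n" by (rule L)
    interpret \<nu>: prob_space "\<nu> n" by (rule L')
    interpret P: pair_prob_space "\<nu> n" "\<mu> n" ..
    have "(LINT x|distr (\<nu> n \<Otimes>\<^sub>M \<mu> n) borel (\<lambda>(x, y). x - y). positive_test u x)
        = (LINT z|(\<nu> n \<Otimes>\<^sub>M \<mu> n). positive_test u (fst z - snd z))"
      by (subst integral_distr) (auto simp: case_prod_beta)
    also have "\<dots> = (LINT z|(\<mu> n \<Otimes>\<^sub>M \<nu> n). positive_test u (snd z - fst z))"
      by (subst P.distr_pair_swap, subst integral_distr) (auto simp: case_prod_beta)
    also have "\<dots> = (LINT x|distr (\<mu> n \<Otimes>\<^sub>M \<nu> n) borel (\<lambda>(x, y). x - y). positive_test u (- x))"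
      by (subst integral_distr) (auto simp: case_prod_beta)
    finally show ?thesis by (simp add: law)
  qed
  have small: "\<exists>n. 1 / 2 ^ n \<le> s0" if "0 < s0" for s0 :: real
    using reals_power_lt_ex[OF that, of 2] by (auto simp: power_divide intro: less_imp_le)
  show "2 ^ n * (LINT x|distr M borel (X (1 / 2 ^ n)). positive_test u x) \<le> bernstein F u"
    using positive_test_mean(1)[OF F G \<mu> \<nu> _ u, of n] by (simp add: law field_simps)
  show "2 ^ n * (LINT x|distr M borel (X (1 / 2 ^ n)). positive_test u (- x)) \<le> bernstein G u"
    using positive_test_mean(1)[OF G F \<nu> \<mu> _ u, of n] by (simp add: reflected field_simps)
  obtain s0 where s0: "0 < s0" "\<And>s \<mu> \<nu>. 0 < s \<and> s \<le> s0 \<and> subordinator_law F s \<mu> \<and> subordinator_law G s \<nu> \<Longrightarrow>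
    s * (bernstein F u - 1) \<le> (LINT z|distr (\<mu> \<Otimes>\<^sub>M \<nu>) borel (\<lambda>(x, y). x - y). positive_test u z)"
    using positive_test_mean_ge[OF F G u] by blast
  obtain n where "1 / 2 ^ n \<le> s0" using small[OF s0(1)] by blast
  then have "1 / 2 ^ n * (bernstein F u - 1) \<le> (LINT x|distr M borel (X (1 / 2 ^ n)). positive_test u x)"
    unfolding law using \<mu> \<nu> by (intro s0(2)) auto
  then show "\<exists>n. bernstein F u - 1 \<le> 2 ^ n * (LINT x|distr M borel (X (1 / 2 ^ n)). positive_test u x)"
    by (intro exI[of _ n]) (simp add: field_simps)
  obtain s1 where s1: "0 < s1" "\<And>s \<mu> \<nu>. 0 < s \<and> s \<le> s1 \<and> subordinator_law G s \<mu> \<and> subordinator_law F s \<nu> \<Longrightarrow>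
    s * (bernstein G u - 1) \<le> (LINT z|distr (\<mu> \<Otimes>\<^sub>M \<nu>) borel (\<lambda>(x, y). x - y). positive_test u z)"
    using positive_test_mean_ge[OF G F u] by blast
  obtain n where "1 / 2 ^ n \<le> s1" using small[OF s1(1)] by blast
  then have "1 / 2 ^ n * (bernstein G u - 1) \<le> (LINT x|distr M borel (X (1 / 2 ^ n)). positive_test u (- x))"
    unfolding reflected using \<mu> \<nu> by (intro s1(2)) auto
  then show "\<exists>n. bernstein G u - 1 \<le> 2 ^ n * (LINT x|distr M borel (X (1 / 2 ^ n)). positive_test u (- x))"
    by (intro exI[of _ n]) (simp add: field_simps)
qed

text \<open>If (\<open>\<beta>\<close>, \<open>\<alpha>\<close>) were lexicographically smaller
  under \<open>P\<close>, test sums would be small under \<open>P\<close> and large under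
  \<open>Q\<close>. One direction of absolute continuity thus excludes one strict comparison for
  each sign of the jumps; the time interval \<open>[0, 1]\<close> suffices.\<close>

theorem ts_absolutely_continuous_imp:
  fixes P Q :: "(real \<Rightarrow> real) measure"
  assumes p1: "0 < \<alpha>_p1" "\<beta>_p1 \<in> {0..<1}" "0 < lam_p1" and m1: "0 < \<alpha>_m1" "\<beta>_m1 \<in> {0..<1}" "0 < lam_m1"
    and p2: "0 < \<alpha>_p2" "\<beta>_p2 \<in> {0..<1}" "0 < lam_p2" and m2: "0 < \<alpha>_m2" "\<beta>_m2 \<in> {0..<1}" "0 < lam_m2"
    and sets_P: "sets P = sets path_algebra" and sets_Q: "sets Q = sets path_algebra"
    and X: "tempered_stable_process P canonical_process \<alpha>_p1 \<beta>_p1 lam_p1 \<alpha>_m1 \<beta>_m1 lam_m1"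
    and Y: "tempered_stable_process Q canonical_process \<alpha>_p2 \<beta>_p2 lam_p2 \<alpha>_m2 \<beta>_m2 lam_m2"
    and ac: "absolutely_continuous (restr_to_subalg P (path_filtration 1)) (restr_to_subalg Q (path_filtration 1))"
  shows "\<not> (\<beta>_p1 < \<beta>_p2 \<or> \<beta>_p1 = \<beta>_p2 \<and> \<alpha>_p1 < \<alpha>_p2)"
    and "\<not> (\<beta>_m1 < \<beta>_m2 \<or> \<beta>_m1 = \<beta>_m2 \<and> \<alpha>_m1 < \<alpha>_m2)"
proof -
  have levy: "levy_process P canonical_process" "levy_process Q canonical_process"
    using X Y by (auto simp: tempered_stable_process_def)
  then have prob: "prob_space P" "prob_space Q" by (auto simp: levy_process_def)
  have space: "space P = cadlag_paths" "space Q = cadlag_paths"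
    using sets_eq_imp_space_eq[OF sets_P] sets_eq_imp_space_eq[OF sets_Q]
    by (simp_all add: path_algebra_def space_coord_algebra)
  have coord: "canonical_process t \<in> borel_measurable (path_filtration 1)" if "t \<in> {0..1}" for t
    unfolding path_filtration_def
    by (rule measurableI) (use coord_algebra_generator[OF that] in \<open>auto simp: space_coord_algebra\<close>)
  have impossible: False
    \<comment> \<open>A general test function lets the positive and the reflected test share the
      measurability argument.\<close>
    if g [measurable]: "\<And>u. g u \<in> borel_measurable borel"
      and sep: "\<And>\<epsilon> :: real. 0 < \<epsilon> \<Longrightarrow> \<exists>u n \<tau>.
        measure P {\<omega> \<in> space P. \<tau> \<le> (\<Sum>i<2 ^ n. g u (grid_increment canonical_process n i \<omega>))} < \<epsilon>
        \<and> 1 / 2 \<le> measure Q {\<omega> \<in> space Q. \<tau> \<le> (\<Sum>i<2 ^ n. g u (grid_increment canonical_process n i \<omega>))}"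
    for g :: "real \<Rightarrow> real \<Rightarrow> real"
  proof -
    have "{\<omega> \<in> cadlag_paths. \<tau> \<le> (\<Sum>i<2 ^ n. g u (grid_increment canonical_process n i \<omega>))}
        \<in> sets (path_filtration 1)" for u \<tau> and n :: nat
    proof -
      have "grid_increment canonical_process n i \<in> borel_measurable (path_filtration 1)" if "i < 2 ^ n" for i
      proof -
        have "real (Suc i) \<le> 2 ^ n" using that by (metis Suc_leI of_nat_le_iff of_nat_numeral of_nat_power)
        then have "real (Suc i) / 2 ^ n \<in> {0..1}" "real i / 2 ^ n \<in> {0..1}"
          using that by auto
        then show ?thesis
          unfolding grid_increment_def[abs_def] by (intro borel_measurable_diff coord)
      qed
      then have "(\<lambda>\<omega>. \<Sum>i<2 ^ n. g u (grid_increment canonical_process n i \<omega>)) \<in> borel_measurable (path_filtration 1)"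
        by (intro borel_measurable_sum measurable_compose[OF _ g]) auto
      then have "{\<omega> \<in> space (path_filtration 1). \<tau> \<le> (\<Sum>i<2 ^ n. g u (grid_increment canonical_process n i \<omega>))}
          \<in> sets (path_filtration 1)"
        by measurable
      then show ?thesis by (simp add: path_filtration_def space_coord_algebra)
    qed
    then have "\<exists>A\<in>sets (path_filtration 1). measure P A < \<epsilon> \<and> 1 / 2 \<le> measure Q A" if "0 < \<epsilon>" for \<epsilon> :: real
      using sep[OF that] unfolding space by blast
    from not_absolutely_continuous_if_separated[OF prob subalgebra_path_filtration[OF sets_P]
        subalgebra_path_filtration[OF sets_Q] this] ac
    show False by blast
  qed
  note E1 = ts_increment_expectations[OF p1 m1 X] and E2 = ts_increment_expectations[OF p2 m2 Y]
  show "\<not> (\<beta>_p1 < \<beta>_p2 \<or> \<beta>_p1 = \<beta>_p2 \<and> \<alpha>_p1 < \<alpha>_p2)"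
  proof
    assume "\<beta>_p1 < \<beta>_p2 \<or> \<beta>_p1 = \<beta>_p2 \<and> \<alpha>_p1 < \<alpha>_p2"
    from bernstein_ts_jumps_comparison[OF p1 p2 this] obtain c C where c: "0 < c" "c < 1"
      and cC: "\<And>u. 0 \<le> u \<Longrightarrow> bernstein (ts_jumps \<alpha>_p1 \<beta>_p1 lam_p1) u
        \<le> c * bernstein (ts_jumps \<alpha>_p2 \<beta>_p2 lam_p2) u + C" by blast
    show False
    proof (rule impossible[of positive_test])
      fix \<epsilon> :: real assume "0 < \<epsilon>"
      show "\<exists>u n \<tau>. measure P {\<omega> \<in> space P. \<tau> \<le> (\<Sum>i<2 ^ n. positive_test u (grid_increment canonical_process n i \<omega>))} < \<epsilon>
        \<and> 1 / 2 \<le> measure Q {\<omega> \<in> space Q. \<tau> \<le> (\<Sum>i<2 ^ n. positive_test u (grid_increment canonical_process n i \<omega>))}"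
        by (rule separating_events[OF levy _ positive_test_bounds E1(1) E2(3) c cC
              bernstein_ts_jumps_at_top[OF p2] \<open>0 < \<epsilon>\<close>]) auto
    qed auto
  qed
  show "\<not> (\<beta>_m1 < \<beta>_m2 \<or> \<beta>_m1 = \<beta>_m2 \<and> \<alpha>_m1 < \<alpha>_m2)"
  proof
    assume "\<beta>_m1 < \<beta>_m2 \<or> \<beta>_m1 = \<beta>_m2 \<and> \<alpha>_m1 < \<alpha>_m2"
    from bernstein_ts_jumps_comparison[OF m1 m2 this] obtain c C where c: "0 < c" "c < 1"
      and cC: "\<And>u. 0 \<le> u \<Longrightarrow> bernstein (ts_jumps \<alpha>_m1 \<beta>_m1 lam_m1) u
        \<le> c * bernstein (ts_jumps \<alpha>_m2 \<beta>_m2 lam_m2) u + C" by blast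
    show False
    proof (rule impossible[of "\<lambda>u x. positive_test u (- x)"])
      fix \<epsilon> :: real assume "0 < \<epsilon>"
      show "\<exists>u n \<tau>. measure P {\<omega> \<in> space P. \<tau> \<le> (\<Sum>i<2 ^ n. positive_test u (- grid_increment canonical_process n i \<omega>))} < \<epsilon>
        \<and> 1 / 2 \<le> measure Q {\<omega> \<in> space Q. \<tau> \<le> (\<Sum>i<2 ^ n. positive_test u (- grid_increment canonical_process n i \<omega>))}"
        by (rule separating_events[where g = "\<lambda>u x. positive_test u (- x)", OF levy _ positive_test_bounds E1(2) E2(4) c cC
              bernstein_ts_jumps_at_top[OF m2] \<open>0 < \<epsilon>\<close>]) auto
    qed auto
  qed
qed

theorem proposition8p1:
  fixes P Q :: "(real \<Rightarrow> real) measure"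
    and \<alpha>_p1 \<beta>_p1 lam_p1 \<alpha>_m1 \<beta>_m1 lam_m1 :: real
    and \<alpha>_p2 \<beta>_p2 lam_p2 \<alpha>_m2 \<beta>_m2 lam_m2 :: real
  assumes "\<alpha>_p1 > 0" "lam_p1 > 0" "\<alpha>_m1 > 0" "lam_m1 > 0"
    and "\<alpha>_p2 > 0" "lam_p2 > 0" "\<alpha>_m2 > 0" "lam_m2 > 0"
    and "\<beta>_p1 \<in> {0..<1}" "\<beta>_m1 \<in> {0..<1}" "\<beta>_p2 \<in> {0..<1}" "\<beta>_m2 \<in> {0..<1}"
    and "prob_space P" "sets P = sets path_algebra"
    and "prob_space Q" "sets Q = sets path_algebra"
    and "tempered_stable_process P canonical_process \<alpha>_p1 \<beta>_p1 lam_p1 \<alpha>_m1 \<beta>_m1 lam_m1"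
    and "tempered_stable_process Q canonical_process \<alpha>_p2 \<beta>_p2 lam_p2 \<alpha>_m2 \<beta>_m2 lam_m2"
  shows "locally_equivalent path_filtration P Q \<longleftrightarrow>
    \<alpha>_p1 = \<alpha>_p2 \<and> \<alpha>_m1 = \<alpha>_m2 \<and> \<beta>_p1 = \<beta>_p2 \<and> \<beta>_m1 = \<beta>_m2"
proof
  note 1 = assms(1,9,2) assms(3,10,4) and 2 = assms(5,11,6) assms(7,12,8)
  note sets = assms(14,16) and processes = assms(17,18)
  assume "locally_equivalent path_filtration P Q"
  then have
    PQ: "absolutely_continuous (restr_to_subalg P (path_filtration 1)) (restr_to_subalg Q (path_filtration 1))" and
    QP: "absolutely_continuous (restr_to_subalg Q (path_filtration 1)) (restr_to_subalg P (path_filtration 1))"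
    by (auto simp: locally_equivalent_def equivalent_measures_def)
  \<comment> \<open>The lexicographic order of (\<open>\<beta>\<close>, \<open>\<alpha>\<close>) is
    total, and the two directions exclude both strict comparisons for each sign.\<close>
  show "\<alpha>_p1 = \<alpha>_p2 \<and> \<alpha>_m1 = \<alpha>_m2 \<and> \<beta>_p1 = \<beta>_p2 \<and> \<beta>_m1 = \<beta>_m2"
    using ts_absolutely_continuous_imp[OF 1 2 sets processes PQ]
      ts_absolutely_continuous_imp[OF 2 1 sets(2,1) processes(2,1) QP]
    by force
next
  assume *: "\<alpha>_p1 = \<alpha>_p2 \<and> \<alpha>_m1 = \<alpha>_m2 \<and> \<beta>_p1 = \<beta>_p2 \<and> \<beta>_m1 = \<beta>_m2"
  have PQ: "absolutely_continuous (restr_to_subalg P (path_filtration t)) (restr_to_subalg Q (path_filtration t))" for t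
    by (rule ts_locally_absolutely_continuous[of \<alpha>_p1 \<beta>_p1 lam_p1 lam_p2 \<alpha>_m1 \<beta>_m1 lam_m1 lam_m2])
      (use assms * in auto)
  have QP: "absolutely_continuous (restr_to_subalg Q (path_filtration t)) (restr_to_subalg P (path_filtration t))" for t
    by (rule ts_locally_absolutely_continuous[of \<alpha>_p1 \<beta>_p1 lam_p2 lam_p1 \<alpha>_m1 \<beta>_m1 lam_m2 lam_m1])
      (use assms * in auto)
  from PQ QP show "locally_equivalent path_filtration P Q"
    by (simp add: locally_equivalent_def equivalent_measures_def)
qed

end
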